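(* Let $\langle X_m\rangle_{m\ge 0}$ and $\langle Y_n\rangle_{n\ge 0}$ be independent transient Markov chains on the same countable state space $\mathcal S$ that have the same transition probabilities, but possibly different initial states. Then on the event that $|\{X_m : m\ge 0\}\cap\{Y_n : n\ge 0\}|=\infty$, almost surely $|\mathrm{LE}\langle X_m\rangle_{m\ge 0}\cap\{Y_n : n\ge 0\}|=\infty$. That is, $$\mathbf P\bigl[\,|\{X_m\}\cap\{Y_n\}|=\infty\ \text{ and }\ |\mathrm{LE}\langle X_m\rangle\cap\{Y_n\}|<\infty\,\bigr]=0 .$$
   Context: Angle brackets $\langle\cdots\rangle$ denote sequences, braces $\{\cdots\}$ denote sets, and $|\cdot|$ denotes cardinality. Chains are time-homogeneous with discrete time; a chain is transient if every state is transient, so almost surely each state is visited only finitely often. Loop-erasure: let $\mathcal S$ be a countable set and $\gamma=\langle v_0,v_1,v_2,\ldots\rangle$ a finite or infinite sequence in $\mathcal S$ in which each element of $\mathcal S$ occurs only finitely often. The loop-erasure $\mathrm{LE}(\gamma)=\langle u_0,u_1,u_2,\ldots\rangle$ is constructed inductively: set $u_0:=v_0$. If $u_j$ has been chosen, let $k$ be the last index such that $v_k=u_j$. If $v_k$ is the last element of $\gamma$, then $\mathrm{LE}(\gamma):=\langle u_0,\dots,u_j\rangle$; otherwise set $u_{j+1}:=v_{k+1}$ and continue. $\mathrm{LE}(\gamma)$ stands both for this sequence and for the set of its elements. *)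

theory Defs
  imports "HOL-Probability.Probability"
begin

text \<open>
  A time-homogeneous Markov chain on \<open>S\<close> whose one-step transition probabilities are
  \<open>pmf (K x) y\<close>.  The initial distribution is arbitrary.
\<close>

definition markov_chain ::
    "'a measure \<Rightarrow> 's set \<Rightarrow> ('s \<Rightarrow> 's pmf) \<Rightarrow> (nat \<Rightarrow> 'a \<Rightarrow> 's) \<Rightarrow> bool" where
  "markov_chain M S K X \<longleftrightarrow>
     (\<forall>x\<in>S. set_pmf (K x) \<subseteq> S) \<and>
     (\<forall>n. X n \<in> measurable M (count_space S)) \<and>
     (\<forall>n w y. \<P>(\<omega> in M. \<forall>i\<le>n. X i \<omega> = w i) > 0 \<longrightarrow>
        \<P>(\<omega> in M. X (Suc n) \<omega> = y \<bar> \<forall>i\<le>n. X i \<omega> = w i) = pmf (K (w n)) y)"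

text \<open>
  The law \<open>P\<^sub>x\<close>, on path space, of the chain with transition probabilities \<open>K\<close> started at \<open>x\<close>.
\<close>

definition step_law :: "('s \<Rightarrow> 's pmf) \<Rightarrow> 's \<Rightarrow> nat \<Rightarrow> (nat \<Rightarrow> 's) \<Rightarrow> 's measure" where
  "step_law K x n \<omega> = measure_pmf (case n of 0 \<Rightarrow> return_pmf x | Suc m \<Rightarrow> K (\<omega> m))"

lemma Ionescu_Tulcea_step_law: "Ionescu_Tulcea (step_law K x) (\<lambda>_. count_space UNIV)"
proof (rule Ionescu_Tulcea.intro)
  fix i
  show "step_law K x i \<in>
      measurable (PiM {0..<i} (\<lambda>_. count_space UNIV)) (subprob_algebra (count_space UNIV))"
  proof (cases i)
    case 0
    then show ?thesis
      by (auto simp: step_law_def[abs_def] measure_pmf_in_subprob_algebra)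
  next
    case (Suc m)
    have "(\<lambda>\<omega>. \<omega> m) \<in> measurable (PiM {0..<i} (\<lambda>_. count_space UNIV)) (count_space UNIV)"
      using Suc by (intro measurable_component_singleton) auto
    moreover have "(\<lambda>y. measure_pmf (K y)) \<in>
        measurable (count_space UNIV) (subprob_algebra (count_space UNIV))"
      by (auto intro: measure_pmf_in_subprob_algebra)
    ultimately have "(\<lambda>\<omega>. measure_pmf (K (\<omega> m))) \<in>
        measurable (PiM {0..<i} (\<lambda>_. count_space UNIV)) (subprob_algebra (count_space UNIV))"
      by (rule measurable_compose)
    then show ?thesis
      using Suc by (simp add: step_law_def[abs_def])
  qed
qed (simp add: step_law_def prob_space_measure_pmf)

global_interpretation path: Ionescu_Tulcea "step_law K x" "\<lambda>_. count_space UNIV"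
  for K :: "'s \<Rightarrow> 's pmf" and x :: 's
  by (rule Ionescu_Tulcea_step_law)

definition path_law :: "('s \<Rightarrow> 's pmf) \<Rightarrow> 's \<Rightarrow> (nat \<Rightarrow> 's) measure" where
  "path_law K x = path.PF.lim K x"

lemma space_path_law: "space (path_law K x) = UNIV"
  by (simp add: path_law_def path.PF.space_lim space_PiM PiE_def)

lemma sets_path_law: "sets (path_law K x) = sets (PiM UNIV (\<lambda>_. count_space UNIV))"
  by (simp add: path_law_def path.PF.sets_lim)

lemma prob_space_path_law: "prob_space (path_law K x)"
proof
  have "emeasure (path_law K x) (path.PF.emb UNIV {} (space (PiM {} (\<lambda>_. count_space UNIV)))) = 1"
    unfolding path_law_def
    using prob_space.emeasure_space_1[OF path.PF.prob_space_P[of "{}" K x]]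
    by (subst path.lim) (auto simp: path.PF.space_P)
  then show "emeasure (path_law K x) (space (path_law K x)) = 1"
    by (simp add: space_path_law prod_emb_def space_PiM PiE_def restrict_def)
qed

lemma emeasure_path_C:
  "emeasure (path.C K x 0 n (\<lambda>_. undefined)) {restrict w {0..<n}} =
     (\<Prod>i<n. emeasure (step_law K x i w) {w i})"
proof (induction n)
  case 0
  then show ?case
    by (simp add: PiM_empty restrict_def)
next
  case (Suc n)
  let ?M = "\<lambda>_::nat. count_space (UNIV :: 'a set)"
  have sets: "{restrict w {0..<m}} \<in> sets (PiM {0..<m} ?M)" for m
  proof -
    have "{restrict w {0..<m}} = PiE {0..<m} (\<lambda>i. {w i})"
      by (auto simp: PiE_iff restrict_def extensional_def fun_eq_iff)
    also have "\<dots> \<in> sets (PiM {0..<m} ?M)"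
      by (rule sets_PiM_I_finite) auto
    finally show ?thesis .
  qed
  have und: "(\<lambda>_. undefined) \<in> space (PiM {0..<0} ?M)"
    by simp
  have sp: "space (path.C K x 0 n (\<lambda>_. undefined)) = space (PiM {0..<n} ?M)"
    using path.space_C[OF und, of K x n] by simp
  have ne: "space (path.C K x 0 n (\<lambda>_. undefined)) \<noteq> {}"
    using path.prob_space_C[OF und] by (rule prob_space.not_empty)
  have eP: "path.eP K x n \<in> measurable (path.C K x 0 n (\<lambda>_. undefined))
      (subprob_algebra (PiM {0..<Suc n} ?M))"
  proof -
    have "sets (path.C K x 0 n (\<lambda>_. undefined)) = sets (PiM {0..<n} ?M)"
      using path.sets_C[OF und, of K x n] by simp
    from measurable_cong_sets[OF this refl] path.measurable_eP[of K x n] show ?thesis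
      by blast
  qed
  have *: "emeasure (path.eP K x n \<omega>) {restrict w {0..<Suc n}} =
      emeasure (step_law K x n w) {w n} * indicator {restrict w {0..<n}} \<omega>"
    if "\<omega> \<in> space (PiM {0..<n} ?M)" for \<omega>
  proof -
    have ext: "\<omega> i = undefined" if "i \<ge> n" for i
      using \<open>\<omega> \<in> _\<close> that by (auto simp: space_PiM PiE_iff extensional_def)
    have iff: "fun_upd \<omega> n y = restrict w {0..<Suc n} \<longleftrightarrow> \<omega> = restrict w {0..<n} \<and> y = w n" for y
      using ext by (auto simp: fun_eq_iff restrict_def split: if_splits)
    have "emeasure (path.eP K x n \<omega>) {restrict w {0..<Suc n}} =
        emeasure (step_law K x n \<omega>) {y. fun_upd \<omega> n y = restrict w {0..<Suc n}}"
      by (subst path.emeasure_eP[OF that sets]) (simp add: vimage_def)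
    also have "\<dots> = emeasure (step_law K x n w) {w n} * indicator {restrict w {0..<n}} \<omega>"
      unfolding iff by (cases n) (auto simp: step_law_def indicator_def)
    finally show ?thesis .
  qed
  have "emeasure (path.C K x 0 (Suc n) (\<lambda>_. undefined)) {restrict w {0..<Suc n}} =
      (\<integral>\<^sup>+\<omega>. emeasure (path.eP K x n \<omega>) {restrict w {0..<Suc n}} \<partial>path.C K x 0 n (\<lambda>_. undefined))"
    using emeasure_bind[OF ne eP sets] by simp
  also have "\<dots> = (\<integral>\<^sup>+\<omega>. emeasure (step_law K x n w) {w n} * indicator {restrict w {0..<n}} \<omega>
      \<partial>path.C K x 0 n (\<lambda>_. undefined))"
    by (intro nn_integral_cong *) (simp add: sp)
  also have "\<dots> = emeasure (step_law K x n w) {w n} *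
      emeasure (path.C K x 0 n (\<lambda>_. undefined)) {restrict w {0..<n}}"
    using sets[of n] path.sets_C[OF und, of K x n] by (intro nn_integral_cmult_indicator) simp
  finally show ?case
    unfolding Suc prod.lessThan_Suc by (simp only: mult.commute)
qed

lemma path_law_cylinder:
  "\<P>(\<omega> in path_law K x. \<forall>i\<le>n. \<omega> i = w i) =
     (if w 0 = x then \<Prod>i<n. pmf (K (w i)) (w (Suc i)) else 0)"
proof -
  let ?M = "\<lambda>_::nat. count_space (UNIV :: 'a set)"
  have eq: "{restrict w {0..<Suc n}} = PiE {0..<Suc n} (\<lambda>i. {w i})"
    by (auto simp: PiE_iff restrict_def extensional_def fun_eq_iff)
  have sets: "{restrict w {0..<Suc n}} \<in> sets (PiM {0..<Suc n} ?M)"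
    unfolding eq by (rule sets_PiM_I_finite) auto
  have "{\<omega>. \<forall>i\<le>n. \<omega> i = w i} = path.PF.emb UNIV {0..<Suc n} {restrict w {0..<Suc n}}"
    by (auto simp: prod_emb_def space_PiM restrict_def fun_eq_iff less_Suc_eq_le) metis
  then have "emeasure (path_law K x) {\<omega>. \<forall>i\<le>n. \<omega> i = w i} =
      emeasure (path.C K x 0 (Suc n) (\<lambda>_. undefined)) {restrict w {0..<Suc n}}"
    unfolding path_law_def
    by (simp add: path.lim[OF _ sets] path.emeasure_CI[OF order_refl sets] prod_emb_id
        del: path.C.simps)
  also have "\<dots> = (\<Prod>i<Suc n. emeasure (step_law K x i w) {w i})"
    by (rule emeasure_path_C)
  also have "\<dots> = (\<Prod>i<Suc n. ennreal (measure (step_law K x i w) {w i}))"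
    by (simp add: step_law_def measure_pmf.emeasure_eq_measure)
  also have "\<dots> = ennreal (\<Prod>i<Suc n. measure (step_law K x i w) {w i})"
    by (rule prod_ennreal) simp
  also have "(\<Prod>i<Suc n. measure (step_law K x i w) {w i}) =
      (if w 0 = x then \<Prod>i<n. pmf (K (w i)) (w (Suc i)) else 0)"
    unfolding prod.lessThan_Suc_shift by (auto simp: step_law_def measure_pmf_single)
  finally show ?thesis
    by (subst measure_def) (simp add: space_path_law prod_nonneg)
qed

lemma markov_chain_path_law: "markov_chain (path_law K x) UNIV K (\<lambda>n \<omega>. \<omega> n)"
proof -
  have "\<P>(\<omega> in path_law K x. \<omega> (Suc n) = y \<bar> \<forall>i\<le>n. \<omega> i = w i) = pmf (K (w n)) y"
    if "\<P>(\<omega> in path_law K x. \<forall>i\<le>n. \<omega> i = w i) > 0" for n w y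
  proof -
    let ?w = "w(Suc n := y)"
    have "(\<omega> (Suc n) = y \<and> (\<forall>i\<le>n. \<omega> i = w i)) \<longleftrightarrow> (\<forall>i\<le>Suc n. \<omega> i = ?w i)" for \<omega>
      by (auto simp: le_Suc_eq)
    then have "\<P>(\<omega> in path_law K x. \<omega> (Suc n) = y \<and> (\<forall>i\<le>n. \<omega> i = w i)) =
        (if w 0 = x then \<Prod>i<Suc n. pmf (K (?w i)) (?w (Suc i)) else 0)"
      by (simp only: path_law_cylinder) simp
    also have "\<dots> = \<P>(\<omega> in path_law K x. \<forall>i\<le>n. \<omega> i = w i) * pmf (K (w n)) y"
      by (simp add: path_law_cylinder)
    finally show ?thesis
      using that by (simp add: cond_prob_def)
  qed
  moreover have "(\<lambda>\<omega>. \<omega> n) \<in> measurable (path_law K x) (count_space UNIV)" for n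
    unfolding measurable_cong_sets[OF sets_path_law refl] by (intro measurable_component_singleton) simp
  ultimately show ?thesis
    by (auto simp: markov_chain_def)
qed

lemma path_law_initial: "AE \<omega> in path_law K x. \<omega> 0 = x"
proof -
  interpret prob_space "path_law K x" by (rule prob_space_path_law)
  have "prob {\<omega> \<in> space (path_law K x). \<omega> 0 = x} = 1"
    using path_law_cylinder[of K x 0 "\<lambda>_. x"] by simp
  then have "AE \<omega> in path_law K x. \<omega> \<in> {\<omega> \<in> space (path_law K x). \<omega> 0 = x}"
    by (rule AE_prob_1)
  then show ?thesis by auto
qed

lemma sets_return_event: "{\<omega>. \<exists>n\<ge>1. \<omega> n = x} \<in> sets (path_law K x)"
proof -
  have "{\<omega> \<in> space (path_law K x). \<omega> n = x} \<in> sets (path_law K x)" for n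
  proof -
    have "(\<lambda>\<omega>. \<omega> n) \<in> measurable (path_law K x) (count_space UNIV)"
      using markov_chain_path_law[of K x] unfolding markov_chain_def by blast
    from measurable_sets[OF this, of "{x}"] show ?thesis
      by (simp add: vimage_def Int_def conj_commute)
  qed
  then have "(\<Union>n\<in>{1..}. {\<omega> \<in> space (path_law K x). \<omega> n = x}) \<in> sets (path_law K x)"
    by (intro sets.countable_UN') auto
  also have "(\<Union>n\<in>{1..}. {\<omega> \<in> space (path_law K x). \<omega> n = x}) = {\<omega>. \<exists>n\<ge>1. \<omega> n = x}"
    by (auto simp: space_path_law)
  finally show ?thesis .
qed

definition transient_state :: "('s \<Rightarrow> 's pmf) \<Rightarrow> 's \<Rightarrow> bool" where
  "transient_state K x \<longleftrightarrow> \<P>(\<omega> in path_law K x. \<exists>n\<ge>1. \<omega> n = x) < 1"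

text \<open>
  Loop-erasure of an infinite sequence in which every element occurs only finitely often.  Since
  the sequence has no last element, the construction never stops.  If some \<open>u\<close> occurs infinitely
  often, \<open>Max\<close> and hence the value of \<open>loop_erasure\<close> is meaningless.
\<close>

primrec loop_erasure :: "(nat \<Rightarrow> 's) \<Rightarrow> nat \<Rightarrow> 's" where
  "loop_erasure v 0 = v 0"
| "loop_erasure v (Suc j) = v (Suc (Max {k. v k = loop_erasure v j}))"

end

theory Submission
  imports Defs
begin

text \<open>
  Suppose \<open>X m = Y n\<close>, and let \<open>L\<close> be the loop-erasure of \<open>X 0, \<dots>, X m\<close>. Given the pasts, the futures of the
  two chains are independent with the same law, so with probability at least 1/2 the first vertex of
  \<open>L\<close> visited by the future of \<open>Y\<close> does not come after the first one visited by the future of \<open>X\<close>.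
  In that case it survives in the loop-erasure of the whole path of \<open>X\<close>.

  By the second moment method this yields a point in the loop-erasure of \<open>X\<close> and in \<open>Y\<close> with probability
  at least 1/256 of that of an intersection, provided the intersections can be weighted so that the
  total weight has mean \<open>H\<close>, the probability of an intersection, and second moment at most \<open>64 * H\<close>.
  Following Fitzsimmons and Salisbury, the weights come from the law of the first intersection along
  \<open>Y\<close>; optional stopping in \<open>Y\<close> and Doob's inequality for \<open>X\<close> and for the time reversal of \<open>X\<close> bound
  the second moment.

  The estimate is uniform over all initial segments of the two paths. Hence the event that the paths
  meet infinitely often but the loop-erasure does not is null, by approximation with cylinder events.
\<close>

section \<open>Expectations of bounded functions and the maximal inequality\<close>

text \<open>The plain number of intersections need not have a second moment comparable with the
  chance of one, because two chains may meet rarely but then very often; hence the weights. The two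
  chains are treated unequally. Once \<open>X\<close> is fixed, the selected time is a stopping time
  for \<open>Y\<close>, so the Markov property of \<open>Y\<close> applies there exactly. Along
  \<open>X\<close> it depends on the whole path, so only a maximal inequality, valid at arbitrary
  random times, is available; it costs a factor 4. The reversal of \<open>X\<close> is in general
  not homogeneous, hence a Markov property without transition probabilities.

  Pairs of intersections fall into four time orderings, each contributing at most
  \<open>8 * H + E2 / 8\<close> to the second moment \<open>E2\<close>. So
  \<open>E2 \<le> 32 * H + E2 / 2\<close>, and 64 results on subtracting \<open>E2 / 2\<close>,
  which a finite horizon and a finite set of states keep finite. Keeping half of the mean leaves
  \<open>\<tau> * H - 64 * \<tau>\<^sup>2 * H\<close> to maximise; the maximum
  \<open>H / 256\<close> is at \<open>\<tau> = 1 / 128\<close>.\<close>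

definition bfun :: "('a \<Rightarrow> real) \<Rightarrow> bool" where
  "bfun f \<longleftrightarrow> (\<exists>B. \<forall>x. \<bar>f x\<bar> \<le> B)"

lemma bfunI: "(\<And>x. \<bar>f x\<bar> \<le> B) \<Longrightarrow> bfun f"
  unfolding bfun_def by blast

lemma bfunE: assumes "bfun f" obtains B where "B \<ge> 0" "\<And>x. \<bar>f x\<bar> \<le> B"
proof -
  from assms obtain B where "\<And>x. \<bar>f x\<bar> \<le> B" unfolding bfun_def by blast
  then show thesis by (intro that[of B]) (auto intro: order_trans[OF abs_ge_zero])
qed

lemma bfun_const [intro, simp]: "bfun (\<lambda>x. c)"
  by (rule bfunI[of _ "\<bar>c\<bar>"]) simp

lemma bfun_of_bool [intro, simp]: "bfun (\<lambda>x. of_bool (P x))"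
  by (rule bfunI[of _ 1]) simp

lemma bfun_add [intro]: assumes "bfun f" "bfun g" shows "bfun (\<lambda>x. f x + g x)"
proof -
  obtain B C where "\<And>x. \<bar>f x\<bar> \<le> B" "\<And>x. \<bar>g x\<bar> \<le> C" using assms by (auto simp: bfun_def)
  then show ?thesis by (intro bfunI[of _ "B + C"]) (meson abs_triangle_ineq add_mono order_trans)
qed

lemma bfun_mult [intro]: assumes "bfun f" "bfun g" shows "bfun (\<lambda>x. f x * g x)"
proof -
  obtain B where B: "B \<ge> 0" "\<And>x. \<bar>f x\<bar> \<le> B" using assms(1) by (rule bfunE) blast
  obtain C where C: "C \<ge> 0" "\<And>x. \<bar>g x\<bar> \<le> C" using assms(2) by (rule bfunE) blast
  show ?thesis by (rule bfunI[of _ "B * C"]) (simp add: abs_mult B C mult_mono)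
qed

lemma bfun_uminus [intro]: "bfun f \<Longrightarrow> bfun (\<lambda>x. - f x)"
  by (simp add: bfun_def)

lemma bfun_diff [intro]: "bfun f \<Longrightarrow> bfun g \<Longrightarrow> bfun (\<lambda>x. f x - g x)"
  using bfun_add[OF _ bfun_uminus] by auto

lemma bfun_divide [intro]: "bfun f \<Longrightarrow> bfun (\<lambda>x. f x / c)"
  using bfun_mult[OF _ bfun_const[of "inverse c"]] by (simp add: divide_inverse)

lemma bfun_power [intro]: "bfun f \<Longrightarrow> bfun (\<lambda>x. f x ^ n)"
  by (induction n) (auto)

lemma bfun_sum [intro]: "(\<And>i. i \<in> I \<Longrightarrow> bfun (f i)) \<Longrightarrow> bfun (\<lambda>x. \<Sum>i\<in>I. f i x)"
  by (induction I rule: infinite_finite_induct) auto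

lemma bfun_comp: "bfun f \<Longrightarrow> bfun (\<lambda>x. f (g x))"
  by (auto simp: bfun_def)

lemma bfun_abs [intro]: "bfun f \<Longrightarrow> bfun (\<lambda>x. \<bar>f x\<bar>)"
  by (auto simp: bfun_def)

lemma bfun_max [intro]: assumes "bfun f" "bfun g" shows "bfun (\<lambda>x. max (f x) (g x))"
proof -
  obtain B C where "\<And>x. \<bar>f x\<bar> \<le> B" "\<And>x. \<bar>g x\<bar> \<le> C" using assms by (auto simp: bfun_def)
  then show ?thesis by (intro bfunI[of _ "max B C"]) (smt (verit))
qed

abbreviation expect :: "'a pmf \<Rightarrow> ('a \<Rightarrow> real) \<Rightarrow> real" where
  "expect p f \<equiv> measure_pmf.expectation p f"

lemma bfun_integrable [intro]: "bfun f \<Longrightarrow> integrable (measure_pmf p) f"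
  by (elim bfunE, rule measure_pmf.integrable_const_bound) auto

lemma expect_bound: 
  assumes "\<And>x. \<bar>f x\<bar> \<le> B" shows "\<bar>expect p f\<bar> \<le> B"
proof -
  have "bfun f" using assms by (rule bfunI)
  have "B \<ge> 0" using assms order_trans[OF abs_ge_zero] by blast
  have "\<bar>expect p f\<bar> \<le> expect p (\<lambda>x. \<bar>f x\<bar>)" by (rule integral_abs_bound)
  also have "\<dots> \<le> expect p (\<lambda>_. B)"
    using \<open>bfun f\<close> assms by (intro integral_mono) (auto intro!: bfun_integrable intro: bfun_abs)
  finally show ?thesis by simp
qed

lemma bfun_expect [intro]: "bfun (\<lambda>z. f (fst z) (snd z)) \<Longrightarrow> bfun (\<lambda>y. expect p (\<lambda>x. f x y))"
  unfolding bfun_def by (force intro!: expect_bound)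

lemma expect_bind:
  assumes "bfun f" shows "expect (bind_pmf p g) f = expect p (\<lambda>x. expect (g x) f)"
proof -
  obtain B where B: "\<And>x. \<bar>f x\<bar> \<le> B" using assms by (rule bfunE) blast
  show ?thesis unfolding measure_pmf_bind
    by (rule integral_bind[where K="count_space UNIV" and B=B and B'=1])
       (use B measurable_measure_pmf[of g] in \<open>auto intro!: measure_pmf.finite_measure\<close>)
qed

lemma expect_add: "bfun f \<Longrightarrow> bfun g \<Longrightarrow> expect p (\<lambda>x. f x + g x) = expect p f + expect p g"
  by (intro Bochner_Integration.integral_add bfun_integrable)

lemma expect_diff: "bfun f \<Longrightarrow> bfun g \<Longrightarrow> expect p (\<lambda>x. f x - g x) = expect p f - expect p g"
  by (intro Bochner_Integration.integral_diff bfun_integrable)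

lemma expect_sum: "(\<And>i. i \<in> I \<Longrightarrow> bfun (f i)) \<Longrightarrow> expect p (\<lambda>x. \<Sum>i\<in>I. f i x) = (\<Sum>i\<in>I. expect p (f i))"
  by (intro Bochner_Integration.integral_sum bfun_integrable)

lemma expect_mono: "bfun f \<Longrightarrow> bfun g \<Longrightarrow> (\<And>x. f x \<le> g x) \<Longrightarrow> expect p f \<le> expect p g"
  by (intro integral_mono bfun_integrable)

lemma expect_nonneg: "(\<And>x. 0 \<le> f x) \<Longrightarrow> 0 \<le> expect r f"
  by (rule Bochner_Integration.integral_nonneg)

lemma expect_swap:
  assumes "bfun (\<lambda>z. f (fst z) (snd z))"
  shows "expect p (\<lambda>x. expect q (f x)) = expect q (\<lambda>y. expect p (\<lambda>x. f x y))"
proof -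
  obtain B where B: "\<And>x y. \<bar>f x y\<bar> \<le> B" using assms unfolding bfun_def by force
  have 1: "expect (bind_pmf p (\<lambda>x. map_pmf (\<lambda>y. (x, y)) q)) (\<lambda>z. f (fst z) (snd z))
      = expect p (\<lambda>x. expect q (f x))"
    using assms by (simp add: expect_bind)
  have 2: "expect (bind_pmf q (\<lambda>y. map_pmf (\<lambda>x. (x, y)) p)) (\<lambda>z. f (fst z) (snd z))
      = expect q (\<lambda>y. expect p (\<lambda>x. f x y))"
    using assms by (simp add: expect_bind)
  have "bind_pmf p (\<lambda>x. map_pmf (\<lambda>y. (x, y)) q) = bind_pmf q (\<lambda>y. map_pmf (\<lambda>x. (x, y)) p)"
    unfolding map_pmf_def by (rule bind_commute_pmf)
  then show ?thesis using 1 2 by simp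
qed

text \<open>\<open>X\<close> takes countably many values on the support of \<open>p\<close>, so the
  integral of \<open>F - G\<close> is the limit of its integrals over finitely many fibres. This
  passes from formulas at a fixed present state to full expectations.\<close>

lemma expect_eq_fibres:
  assumes F: "bfun F" "bfun G" and eq: "\<And>z. expect p (\<lambda>x. of_bool (X x = z) * F x)
      = expect p (\<lambda>x. of_bool (X x = z) * G x)"
  shows "expect p F = expect p G"
proof -
  define D where "D x = F x - G x" for x
  have D: "bfun D" unfolding D_def using F by blast
  have 0: "expect p (\<lambda>x. of_bool (X x = z) * D x) = 0" for z
    unfolding D_def right_diff_distrib
    by (subst expect_diff) (use F eq in auto)
  \<comment> \<open>The enumeration may repeat values; the sums below run over an image set, so no
    fibre is counted twice.\<close>
  define e where "e = from_nat_into (X ` set_pmf p)"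
  have e: "e ` UNIV = X ` set_pmf p"
    unfolding e_def using range_from_nat_into[of "X ` set_pmf p"] by (simp add: set_pmf_not_empty)
  define W where "W n x = of_bool (X x \<in> e ` {..<n}) * D x" for n x
  obtain B where B: "B \<ge> 0" "\<And>x. \<bar>D x\<bar> \<le> B" using D by (rule bfunE) blast
  have "(\<lambda>n. expect p (W n)) \<longlonglongrightarrow> expect p D"
  proof (rule integral_dominated_convergence[where w="\<lambda>_. B"])
    show "AE x in measure_pmf p. (\<lambda>n. W n x) \<longlonglongrightarrow> D x"
    proof (rule AE_pmfI)
      fix x assume "x \<in> set_pmf p"
      then obtain k where "X x = e k" using e by (metis imageE imageI)
      then have "\<forall>n\<ge>Suc k. W n x = D x" by (auto simp: W_def)
      then show "(\<lambda>n. W n x) \<longlonglongrightarrow> D x"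
        by (intro tendsto_eventually) (auto simp: eventually_sequentially)
    qed
  qed (use B in \<open>auto simp: W_def abs_mult\<close>)
  moreover have "expect p (W n) = 0" for n
  proof -
    have "W n = (\<lambda>x. \<Sum>z\<in>e ` {..<n}. of_bool (X x = z) * D x)"
    proof
      fix x
      have "(\<Sum>z\<in>e ` {..<n}. of_bool (X x = z) * D x) = (\<Sum>z\<in>e ` {..<n}. if z = X x then D x else 0)"
        by (intro sum.cong) auto
      also have "\<dots> = W n x" by (subst sum.delta) (auto simp: W_def)
      finally show "W n x = (\<Sum>z\<in>e ` {..<n}. of_bool (X x = z) * D x)" by simp
    qed
    then show ?thesis using D by (simp only:) (subst expect_sum; auto simp: 0)
  qed
  ultimately have "expect p D = 0" by (simp add: LIMSEQ_const_iff)
  then show ?thesis unfolding D_def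
    by (subst (asm) expect_diff) (use F in auto)
qed

section \<open>Doob's maximal inequality in L2, from a pathwise inequality\<close>

primrec rmax :: "(nat \<Rightarrow> real) \<Rightarrow> nat \<Rightarrow> real" where
  "rmax s 0 = s 0"
| "rmax s (Suc n) = max (rmax s n) (s (Suc n))"

lemma rmax_ge: "k \<le> n \<Longrightarrow> s k \<le> rmax s n"
  by (induction n) (auto simp: le_Suc_eq max_def intro: order_trans)

lemma rmax_cong: "(\<And>k. k \<le> n \<Longrightarrow> s k = t k) \<Longrightarrow> rmax s n = rmax t n"
  by (induction n) auto

text \<open>The sum on the left is a martingale transform: its expectation vanishes if \<open>s\<close> is a martingale.\<close>

lemma doob_pathwise:
  "(rmax s n)\<^sup>2 + 4 * (\<Sum>k<n. rmax s k * (s (Suc k) - s k)) \<le> 4 * (s n)\<^sup>2"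
proof -
  have "(\<Sum>k<n. rmax s k * (s (Suc k) - s k)) \<le> rmax s n * s n - (rmax s n)\<^sup>2 / 2"
  proof (induction n)
    case 0 
    have "0 \<le> s 0 * s 0" by simp
    then show ?case by (simp add: power2_eq_square)
  next
    case (Suc n)
    have "(\<Sum>k<Suc n. rmax s k * (s (Suc k) - s k)) \<le> rmax s n * s (Suc n) - (rmax s n)\<^sup>2 / 2"
      using Suc by (simp add: algebra_simps)
    also have "\<dots> \<le> rmax s (Suc n) * s (Suc n) - (rmax s (Suc n))\<^sup>2 / 2"
    proof (cases "s (Suc n) \<le> rmax s n")
      case True then show ?thesis by (simp add: max_absorb1)
    next
      case False
      \<comment> \<open>At a new maximum the two sides differ by half of this square.\<close>
      have "0 \<le> (s (Suc n) - rmax s n)\<^sup>2" by simp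
      then show ?thesis using False by (simp add: max_absorb2 power2_eq_square algebra_simps)
    qed
    finally show ?case .
  qed
  \<comment> \<open>\<open>4 * (s n)\<^sup>2\<close> exceeds the remaining
    \<open>4 * rmax s n * s n - (rmax s n)\<^sup>2\<close> by exactly this square.\<close>
  moreover have "0 \<le> (2 * s n - rmax s n)\<^sup>2" by simp
  ultimately show ?thesis by (simp add: power2_eq_square algebra_simps)
qed

lemma bfun_rmax [intro]: "(\<And>k. k \<le> n \<Longrightarrow> bfun (\<lambda>x. s x k)) \<Longrightarrow> bfun (\<lambda>x. rmax (s x) n)"
  by (induction n) auto

text \<open>The pathwise inequality contains the increments only multiplied by the running maximum,
  so the martingale property enters as orthogonality to \<open>rmax\<close> and no filtration
  appears.\<close>

lemma doob_expect:
  assumes s: "\<And>k. bfun (\<lambda>x. s x k)"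
    and mart: "\<And>k. k < n \<Longrightarrow> expect p (\<lambda>x. rmax (s x) k * s x (Suc k)) = expect p (\<lambda>x. rmax (s x) k * s x k)"
  shows "expect p (\<lambda>x. (rmax (s x) n)\<^sup>2) \<le> 4 * expect p (\<lambda>x. (s x n)\<^sup>2)"
proof -
  have b: "bfun (\<lambda>x. rmax (s x) k)" for k using s by blast
  let ?d = "\<lambda>k x. rmax (s x) k * s x (Suc k) - rmax (s x) k * s x k"
  have d: "bfun (?d k)" for k by (intro bfun_diff bfun_mult s b)
  have "expect p (\<lambda>x. (rmax (s x) n)\<^sup>2 + 4 * (\<Sum>k<n. ?d k x)) \<le> expect p (\<lambda>x. 4 * (s x n)\<^sup>2)"
    using doob_pathwise by (intro expect_mono bfun_add bfun_power bfun_mult bfun_const bfun_sum d b s)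
        (simp add: right_diff_distrib)
  also have "expect p (\<lambda>x. (rmax (s x) n)\<^sup>2 + 4 * (\<Sum>k<n. ?d k x))
    = expect p (\<lambda>x. (rmax (s x) n)\<^sup>2) + 4 * (\<Sum>k<n. expect p (?d k))"
    
  proof -
    have "bfun (\<lambda>x. 4 * (\<Sum>k<n. ?d k x))" by (intro bfun_mult bfun_const bfun_sum d)
    moreover have "expect p (\<lambda>x. \<Sum>k<n. ?d k x) = (\<Sum>k<n. expect p (?d k))" by (intro expect_sum d)
    ultimately show ?thesis using b by (subst expect_add) auto
  qed
  also have "(\<Sum>k<n. expect p (?d k)) = 0"
    using mart s b by (intro sum.neutral ballI) (auto simp: expect_diff bfun_mult)
  finally show ?thesis by simp
qed

section \<open>Markov chains on a finite horizon\<close>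

lemma expect_of_bool_zero:
  assumes "expect p (\<lambda>x. of_bool (P x)) = 0" "bfun F" shows "expect p (\<lambda>x. of_bool (P x) * F x) = 0"
proof -
  obtain B where B: "\<And>x. \<bar>F x\<bar> \<le> B" using assms(2) by (rule bfunE) blast
  have "\<bar>expect p (\<lambda>x. of_bool (P x) * F x)\<bar> \<le> expect p (\<lambda>x. \<bar>of_bool (P x) * F x\<bar>)" by (rule integral_abs_bound)
  also have "\<dots> \<le> expect p (\<lambda>x. B * of_bool (P x))" 
  proof (intro expect_mono bfun_abs bfun_mult bfun_of_bool bfun_const assms(2))
    show "\<bar>of_bool (P x) * F x\<bar> \<le> B * of_bool (P x)" for x using B[of x] by (cases "P x") auto
  qed
  also have "\<dots> = 0" using assms(1) by simp
  finally show ?thesis by simp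
qed

text \<open>On a \<open>pmf\<close> every function is measurable, so measurability with respect to
  \<open>X 0, ..., X m\<close> becomes dependence on these coordinates alone.\<close>

definition past :: "(nat \<Rightarrow> 'a \<Rightarrow> 's) \<Rightarrow> nat \<Rightarrow> ('a \<Rightarrow> 'b) \<Rightarrow> bool" where
  "past X m f \<longleftrightarrow> (\<forall>x x'. (\<forall>i\<le>m. X i x = X i x') \<longrightarrow> f x = f x')"

definition future :: "(nat \<Rightarrow> 'a \<Rightarrow> 's) \<Rightarrow> nat \<Rightarrow> nat \<Rightarrow> ('a \<Rightarrow> 'b) \<Rightarrow> bool" where
  "future X N m f \<longleftrightarrow> (\<forall>x x'. (\<forall>i\<in>{m..N}. X i x = X i x') \<longrightarrow> f x = f x')"

text \<open>Conditional independence of past and future given the present, in a form that also makes sense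
  for null events and is invariant under time reversal.\<close>

definition markov_prop :: "'a pmf \<Rightarrow> (nat \<Rightarrow> 'a \<Rightarrow> 's) \<Rightarrow> nat \<Rightarrow> bool" where
  "markov_prop p X N \<longleftrightarrow> (\<forall>m\<le>N. \<forall>z f g. bfun f \<longrightarrow> bfun g \<longrightarrow> past X m f \<longrightarrow> future X N m g \<longrightarrow>
     expect p (\<lambda>x. of_bool (X m x = z) * (f x * g x)) * expect p (\<lambda>x. of_bool (X m x = z)) =
     expect p (\<lambda>x. of_bool (X m x = z) * f x) * expect p (\<lambda>x. of_bool (X m x = z) * g x))"

text \<open>The quotient is the conditional expectation of \<open>g\<close> given the present state.
  If that state has probability 0, both sides vanish, in agreement with
  \<open>x / 0 = 0\<close>.\<close>

lemma markov_propD: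
  assumes "markov_prop p X N" "m \<le> N" "bfun f" "bfun g" "past X m f" "future X N m g"
  shows "expect p (\<lambda>x. of_bool (X m x = z) * (f x * g x)) =
    expect p (\<lambda>x. of_bool (X m x = z) * f x) * (expect p (\<lambda>x. of_bool (X m x = z)
        * g x) / expect p (\<lambda>x. of_bool (X m x = z)))"
proof (cases "expect p (\<lambda>x. of_bool (X m x = z)) = 0")
  case True
  then show ?thesis using assms by (simp add: expect_of_bool_zero bfun_mult)
next
  case False
  then show ?thesis using assms unfolding markov_prop_def by (simp add: field_simps)
qed

text \<open>The identity is symmetric in \<open>f\<close> and \<open>g\<close>, and reversal turns
  the past of \<open>m\<close> into the future of \<open>N - m\<close>.\<close>

lemma markov_prop_rev:
  assumes "markov_prop p X N" shows "markov_prop p (\<lambda>i. X (N - i)) N"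
  unfolding markov_prop_def
proof (intro allI impI)
  fix m z and f g :: "'a \<Rightarrow> real"
  assume *: "m \<le> N" "bfun f" "bfun g" "past (\<lambda>i. X (N - i)) m f" "future (\<lambda>i. X (N - i)) N m g"
  have 1: "past X (N - m) g" unfolding past_def
  proof (intro allI impI)
    fix x x' assume "\<forall>i\<le>N - m. X i x = X i x'"
    then have "\<forall>i\<in>{m..N}. X (N - i) x = X (N - i) x'" by auto
    then show "g x = g x'" using *(5) unfolding future_def by blast
  qed
  have 2: "future X N (N - m) f" unfolding future_def
  proof (intro allI impI)
    fix x x' assume "\<forall>i\<in>{N - m..N}. X i x = X i x'"
    then have "\<forall>i\<le>m. X (N - i) x = X (N - i) x'" using *(1) by auto
    then show "f x = f x'" using *(4) unfolding past_def by blast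
  qed
  show "expect p (\<lambda>x. of_bool (X (N - m) x = z) * (f x * g x)) * expect p (\<lambda>x. of_bool (X (N - m) x = z)) =
     expect p (\<lambda>x. of_bool (X (N - m) x = z) * f x) * expect p (\<lambda>x. of_bool (X (N - m) x = z) * g x)"
    using assms[unfolded markov_prop_def, rule_format, of "N - m" g f z] *(1-3) 1 2
    by (simp add: mult.commute)
qed

text \<open>The conditional expectation of \<open>\<Sum>i\<in>I. a i (X i)\<close> given \<open>X m = z\<close>, and 0 if \<open>X m = z\<close> is null.\<close>

definition cexp :: "'a pmf \<Rightarrow> (nat \<Rightarrow> 'a \<Rightarrow> 's) \<Rightarrow> nat set \<Rightarrow> (nat \<Rightarrow> 's \<Rightarrow> real) \<Rightarrow> nat \<Rightarrow> 's \<Rightarrow> real" where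
  "cexp p X I a m z = expect p (\<lambda>x. of_bool (X m x = z)
      * (\<Sum>i\<in>I. a i (X i x))) / expect p (\<lambda>x. of_bool (X m x = z))"

lemma bfun_cexp:
  assumes "\<And>i. i \<in> I \<Longrightarrow> bfun (a i)" shows "bfun (cexp p X I a m)"
proof -
  have b: "bfun (\<lambda>x. \<Sum>i\<in>I. a i (X i x))" by (intro bfun_sum bfun_comp[OF assms])
  then obtain B where B: "B \<ge> 0" "\<And>x. \<bar>\<Sum>i\<in>I. a i (X i x)\<bar> \<le> B" by (rule bfunE) blast
  show ?thesis
  proof (rule bfunI[of _ B])
    fix z
    have "\<bar>expect p (\<lambda>x. of_bool (X m x = z) * (\<Sum>i\<in>I. a i (X i x)))\<bar>
        \<le> expect p (\<lambda>x. \<bar>of_bool (X m x = z) * (\<Sum>i\<in>I. a i (X i x))\<bar>)"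
      by (rule integral_abs_bound)
    also have "\<dots> \<le> expect p (\<lambda>x. B * of_bool (X m x = z))" 
    proof (intro expect_mono bfun_abs bfun_mult bfun_of_bool bfun_const b)
      show "\<bar>of_bool (X m x = z) * (\<Sum>i\<in>I. a i (X i x))\<bar> \<le> B * of_bool (X m x = z)" for x
        using B(2)[of x] by (cases "X m x = z") auto
    qed
    also have "\<dots> = B * expect p (\<lambda>x. of_bool (X m x = z))" by simp
    finally have le: "\<bar>expect p (\<lambda>x. of_bool (X m x = z) * (\<Sum>i\<in>I. a i (X i x)))\<bar> \<le> B
        * expect p (\<lambda>x. of_bool (X m x = z))" .
    show "\<bar>cexp p X I a m z\<bar> \<le> B"
    proof (cases "expect p (\<lambda>x. of_bool (X m x = z)) = 0")
      case False
      moreover have "0 \<le> expect p (\<lambda>x. of_bool (X m x = z))" by (rule expect_nonneg) simp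
      ultimately have "0 < expect p (\<lambda>x. of_bool (X m x = z))" by (metis order_le_less)
      then show ?thesis using le by (simp add: cexp_def abs_divide divide_le_eq)
    qed (simp add: cexp_def B(1))
  qed
qed

text \<open>The tower property: on each fibre of \<open>X m\<close> the past factor \<open>h\<close>
  and the future sum are conditionally independent.\<close>

lemma cexp_future:
  assumes mk: "markov_prop p X N" "m \<le> N" and a: "\<And>i. bfun (a i)" and h: "bfun h" "past X m h"
  shows "expect p (\<lambda>x. h x * (\<Sum>i\<in>{m..N}. a i (X i x))) = expect p (\<lambda>x. h x * cexp p X {m..N} a m (X m x))"
proof (rule expect_eq_fibres[where X="X m"])
  have s: "bfun (\<lambda>x. \<Sum>i\<in>{m..N}. a i (X i x))" by (intro bfun_sum bfun_comp[OF a])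
  have c: "bfun (\<lambda>x. cexp p X {m..N} a m (X m x))" by (rule bfun_comp[OF bfun_cexp]) (rule a)
  show "bfun (\<lambda>x. h x * (\<Sum>i\<in>{m..N}. a i (X i x)))" "bfun (\<lambda>x. h x * cexp p X {m..N} a m (X m x))"
    by (intro bfun_mult h s c)+
  fix z
  have "future X N m (\<lambda>x. \<Sum>i\<in>{m..N}. a i (X i x))"
    unfolding future_def by (auto intro!: sum.cong)
  from markov_propD[OF mk h(1) s h(2) this, of z]
  have "expect p (\<lambda>x. of_bool (X m x = z) * (h x * (\<Sum>i\<in>{m..N}. a i (X i x)))) =
    expect p (\<lambda>x. of_bool (X m x = z) * h x) * cexp p X {m..N} a m z"
    by (simp add: cexp_def)
  also have "\<dots> = expect p (\<lambda>x. of_bool (X m x = z) * h x * cexp p X {m..N} a m z)" by simp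
  also have "\<dots> = expect p (\<lambda>x. of_bool (X m x = z) * (h x * cexp p X {m..N} a m (X m x)))"
    by (rule Bochner_Integration.integral_cong) auto
  finally show "expect p (\<lambda>x. of_bool (X m x = z) * (h x * (\<Sum>i\<in>{m..N}. a i (X i x)))) = \<dots>" .
qed

lemma past_rmax: "(\<And>k. k \<le> n \<Longrightarrow> past X k (\<lambda>x. s x k)) \<Longrightarrow> past X n (\<lambda>x. rmax (s x) n)"
  unfolding past_def by (auto intro!: rmax_cong)

text \<open>Since \<open>a\<close> is nonnegative, the conditional expectation of the future sum
  lies below the martingale of the total sum, hence below its maximum. The maximum bounds all
  indices at once, so \<open>\<mu>\<close> may be any function of the path, not merely a stopping
  time.\<close>

lemma doob_markov_future:
  assumes mk: "markov_prop p X N" and a: "\<And>i. bfun (a i)" "\<And>i z. 0 \<le> a i z"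
    and \<mu>: "\<And>x. \<mu> x \<le> N"
  shows "expect p (\<lambda>x. (cexp p X {\<mu> x..N} a (\<mu> x) (X (\<mu> x) x))\<^sup>2) \<le> 4 * expect p (\<lambda>x. (\<Sum>i\<le>N. a i (X i x))\<^sup>2)"
proof -
  let ?G = "\<lambda>m. cexp p X {m..N} a m"
  define A where "A x = (\<Sum>i\<le>N. a i (X i x))" for x
  \<comment> \<open>The martingale closed by the total sum \<open>A\<close>. The extra index
    \<open>N + 1\<close> makes its last value equal to \<open>A\<close> everywhere; at index
    \<open>N\<close> this could fail at states of probability 0, where \<open>cexp\<close> is
    0.\<close>
  define s where "s x k = (if k \<le> N then (\<Sum>i<k. a i (X i x)) + ?G k (X k x) else A x)" for x k
  have A: "bfun A" unfolding A_def by (intro bfun_sum bfun_comp[OF a(1)])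
  have G: "bfun (\<lambda>x. ?G k (X k x))" for k by (rule bfun_comp[OF bfun_cexp]) (rule a)
  have s: "bfun (\<lambda>x. s x k)" for k unfolding s_def
    by (cases "k \<le> N") (simp_all only: if_True if_False not_False_eq_True, intro bfun_add bfun_sum
        bfun_comp[OF a(1)] G A, rule A)
  have pst: "past X k (\<lambda>x. s x k)" if "k \<le> N" for k
    using that unfolding past_def s_def by (auto intro!: sum.cong)
  \<comment> \<open>Consecutive values are both compared with \<open>A\<close>, which gives the
    martingale identity without a direct comparison.\<close>
  have cond: "expect p (\<lambda>x. h x * s x k) = expect p (\<lambda>x. h x * A x)" if "k \<le> Suc N" "bfun h"
      "past X (min k N) h" for h k
  proof (cases "k \<le> N")
    case True
    have b1: "bfun (\<lambda>x. \<Sum>i<k. a i (X i x))" and b2: "bfun (\<lambda>x. \<Sum>i=k..N. a i (X i x))"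
      by (intro bfun_sum bfun_comp[OF a(1)])+
    have "A x = (\<Sum>i<k. a i (X i x)) + (\<Sum>i=k..N. a i (X i x))" for x
    proof -
      have *: "{..N} = {..<k} \<union> {k..N}" using True by auto
      show ?thesis unfolding A_def * by (rule sum.union_disjoint) auto
    qed
    then have "expect p (\<lambda>x. h x * A x) = expect p (\<lambda>x. h x * (\<Sum>i<k. a i (X i x)) + h x * (\<Sum>i=k..N. a i (X i x)))"
      by (simp add: distrib_left)
    also have "\<dots> = expect p (\<lambda>x. h x * (\<Sum>i<k. a i (X i x))) + expect p (\<lambda>x. h x * ?G k (X k x))"
      using that b1 b2 True cexp_future[OF mk True a(1), of h] by (simp add: expect_add bfun_mult min_def)
    also have "\<dots> = expect p (\<lambda>x. h x * (\<Sum>i<k. a i (X i x)) + h x * ?G k (X k x))"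
      using that b1 G by (simp add: expect_add bfun_mult)
    finally show ?thesis using True by (simp add: s_def distrib_left)
  qed (simp add: s_def)
  have le: "expect p (\<lambda>x. (rmax (s x) (Suc N))\<^sup>2) \<le> 4 * expect p (\<lambda>x. (s x (Suc N))\<^sup>2)"
  proof (rule doob_expect)
    fix k assume k: "k < Suc N"
    have p: "past X k (\<lambda>x. rmax (s x) k)" using k by (intro past_rmax pst) auto
    have p': "past X (min (Suc k) N) (\<lambda>x. rmax (s x) k)" 
      using p k unfolding past_def by (simp add: min_def)
    show "expect p (\<lambda>x. rmax (s x) k * s x (Suc k)) = expect p (\<lambda>x. rmax (s x) k * s x k)"
      using cond[of k "\<lambda>x. rmax (s x) k"] cond[of "Suc k" "\<lambda>x. rmax (s x) k"] p p' k s
      by (simp add: bfun_rmax min_def split: if_splits)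
  qed (rule s)
  have G0: "0 \<le> ?G k z" for k z unfolding cexp_def
    using a(2) by (intro divide_nonneg_nonneg expect_nonneg mult_nonneg_nonneg sum_nonneg) auto
  have Gle: "?G (\<mu> x) (X (\<mu> x) x) \<le> rmax (s x) (Suc N)" for x
  proof -
    have "?G (\<mu> x) (X (\<mu> x) x) \<le> s x (\<mu> x)" using \<mu>[of x] a(2) by (simp add: s_def sum_nonneg)
    also have "\<dots> \<le> rmax (s x) (Suc N)" using \<mu>[of x] by (intro rmax_ge) auto
    finally show ?thesis .
  qed
  have r: "bfun (\<lambda>x. rmax (s x) (Suc N))" using s by blast
  then obtain B where B: "B \<ge> 0" "\<And>x. \<bar>rmax (s x) (Suc N)\<bar> \<le> B" by (rule bfunE) blast
  have "bfun (\<lambda>x. ?G (\<mu> x) (X (\<mu> x) x))"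
    using Gle G0 B by (intro bfunI[of _ B]) (smt (verit, best))
  then have "expect p (\<lambda>x. (?G (\<mu> x) (X (\<mu> x) x))\<^sup>2) \<le> expect p (\<lambda>x. (rmax (s x) (Suc N))\<^sup>2)"
    by (intro expect_mono power_mono bfun_power r Gle G0)
  then show ?thesis using le by (simp add: s_def A_def)
qed

text \<open>Along the reversed chain \<open>{..m}\<close> becomes a future interval, so the previous
  bound applies.\<close>

lemma doob_markov_past:
  assumes mk: "markov_prop p X N" and a: "\<And>i. bfun (a i)" "\<And>i z. 0 \<le> a i z"
    and \<mu>: "\<And>x. \<mu> x \<le> N"
  shows "expect p (\<lambda>x. (cexp p X {..\<mu> x} a (\<mu> x) (X (\<mu> x) x))\<^sup>2) \<le> 4 * expect p (\<lambda>x. (\<Sum>i\<le>N. a i (X i x))\<^sup>2)"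
proof -
  have *: "cexp p (\<lambda>i. X (N - i)) {N - m..N} (\<lambda>i. a (N - i)) (N - m) z = cexp p X {..m} a m z" if "m \<le> N" for m z
  proof -
    have "(\<Sum>i\<in>{N - m..N}. a (N - i) (X (N - i) x)) = (\<Sum>i\<le>m. a i (X i x))" for x
      using that by (intro sum.reindex_bij_witness[of _ "\<lambda>i. N - i" "\<lambda>i. N - i"]) auto
    then show ?thesis using that by (simp add: cexp_def)
  qed
  have **: "(\<Sum>i\<le>N. a (N - i) (X (N - i) x)) = (\<Sum>i\<le>N. a i (X i x))" for x
    by (intro sum.reindex_bij_witness[of _ "\<lambda>i. N - i" "\<lambda>i. N - i"]) auto
  show ?thesis
    using doob_markov_future[OF markov_prop_rev[OF mk], of "\<lambda>i. a (N - i)" "\<lambda>x. N - \<mu> x"] a \<mu>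
    by (simp add: * **)
qed

section \<open>A weighted count of intersections with small second moment\<close>

text \<open>Two independent chains on a finite horizon; their starting points and transitions may
  differ. \<open>n0\<close> keeps the intersections late on \<open>Y\<close>. Finiteness of
  \<open>N\<close> and \<open>B\<close> makes all sums below finite.\<close>

locale chain_pair =
  fixes p :: "'a pmf" and q :: "'b pmf" and X :: "nat \<Rightarrow> 'a \<Rightarrow> 's" and Y :: "nat \<Rightarrow> 'b \<Rightarrow> 's"
    and N n0 :: nat and B :: "'s set"
  assumes mX: "markov_prop p X N" and mY: "markov_prop q Y N" and B: "finite B"
begin

text \<open>When \<open>X\<close> is fixed, the \<open>n\<close> with \<open>first_hit x n y\<close> is a stopping time for \<open>Y\<close>. The weights \<open>w\<close> below are
  chosen so that the expected weight of an intersection at \<open>(m, n, z)\<close> is the probability \<open>\<nu> m n z\<close> that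
  it is the selected one.\<close>

definition first_hit :: "'a \<Rightarrow> nat \<Rightarrow> 'b \<Rightarrow> bool" where
  "first_hit x n y \<longleftrightarrow> n0 \<le> n \<and> n \<le> N \<and> Y n y \<in> B \<inter> (\<lambda>m. X m x) ` {..N} \<and>
     (\<forall>n'. n0 \<le> n' \<and> n' < n \<longrightarrow> Y n' y \<notin> B \<inter> (\<lambda>m. X m x) ` {..N})"

definition hit :: "'a \<Rightarrow> 'b \<Rightarrow> bool" where
  "hit x y \<longleftrightarrow> (\<exists>n m. n0 \<le> n \<and> n \<le> N \<and> m \<le> N \<and> Y n y \<in> B \<and> X m x = Y n y)"

text \<open>A choice that depends on \<open>x\<close> and \<open>z\<close> and never on
  \<open>y\<close>, so that for fixed \<open>x\<close> the event \<open>sel m n z x y\<close> is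
  decided by \<open>Y\<close> up to time \<open>n\<close>.\<close>

definition pick :: "'a \<Rightarrow> 's \<Rightarrow> nat" where
  "pick x z = (LEAST m. X m x = z)"

definition sel :: "nat \<Rightarrow> nat \<Rightarrow> 's \<Rightarrow> 'a \<Rightarrow> 'b \<Rightarrow> bool" where
  "sel m n z x y \<longleftrightarrow> first_hit x n y \<and> Y n y = z \<and> pick x z = m"

definition T :: "(nat \<times> nat \<times> 's) set" where "T = {..N} \<times> {..N} \<times> B"

lemma finite_T [simp]: "finite T" using B by (simp add: T_def)

lemma pick: assumes "m \<le> N" "X m x = z" shows "X (pick x z) x = z" "pick x z \<le> N"
  unfolding pick_def using assms LeastI[of "\<lambda>m. X m x = z" m] Least_le[of "\<lambda>m. X m x = z" m] by auto

lemma sel_D: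
  assumes "sel m n z x y" shows "m \<le> N" "n \<le> N" "z \<in> B" "X m x = z" "Y n y = z"
  using assms pick[of _ x z] unfolding sel_def first_hit_def by auto

lemma first_hit_unique: "first_hit x n y \<Longrightarrow> first_hit x n' y \<Longrightarrow> n = n'"
  unfolding first_hit_def by (meson linorder_neqE_nat)

lemma sel_unique: "sel m n z x y \<Longrightarrow> sel m' n' z' x y \<Longrightarrow> m = m' \<and> n = n' \<and> z = z'"
  using first_hit_unique unfolding sel_def by blast

lemma hit_sel: "hit x y \<Longrightarrow> \<exists>m n z. sel m n z x y"
proof -
  let ?P = "\<lambda>n. n0 \<le> n \<and> n \<le> N \<and> Y n y \<in> B \<inter> (\<lambda>m. X m x) ` {..N}"
  assume "hit x y"
  then obtain n where "?P n" unfolding hit_def by force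
  then have "?P (LEAST n. ?P n)" by (rule LeastI)
  moreover have "\<not> ?P n'" if "n' < (LEAST n. ?P n)" for n' using that by (rule not_less_Least)
  ultimately have "first_hit x (LEAST n. ?P n) y" unfolding first_hit_def by (smt (verit) le_trans less_imp_le)
  then show ?thesis unfolding sel_def by blast
qed

lemma sum_T: "(\<Sum>t\<in>T. f t) = (\<Sum>m\<le>N. \<Sum>n\<le>N. \<Sum>z\<in>B. f (m, n, z))"
  unfolding T_def by (simp add: sum.cartesian_product split_def)

text \<open>Exactly one triple is selected on \<open>hit\<close> and none off it, so the sum has at
  most one term.\<close>

lemma sum_sel: "(\<Sum>(m, n, z)\<in>T. of_bool (sel m n z x y) * f m n z) = 
  (if hit x y then (THE r. \<exists>m n z. sel m n z x y \<and> r = f m n z) else (0::real))"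
proof (cases "hit x y")
  case True
  then obtain m n z where s: "sel m n z x y" using hit_sel by blast
  then have "(\<Sum>(m', n', z')\<in>T. of_bool (sel m' n' z' x y) * f m' n' z')
      = (\<Sum>t\<in>T. if t = (m, n, z) then f m n z else 0)"
    by (intro sum.cong) (auto dest: sel_unique)
  also have "\<dots> = f m n z" using sel_D[OF s] by (simp add: T_def B)
  also have "\<dots> = (THE r. \<exists>m n z. sel m n z x y \<and> r = f m n z)"
    using s by (intro the_equality[symmetric]) (auto dest: sel_unique)
  finally show ?thesis using True by simp
next
  case False
  have "\<not> sel m n z x y" for m n z
    using False sel_D[of m n z x y] unfolding hit_def sel_def first_hit_def by metis
  then show ?thesis using False by simp
qed

lemma sum_sel_1: "(\<Sum>(m, n, z)\<in>T. of_bool (sel m n z x y)) = (of_bool (hit x y) :: real)"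
proof -
  have "(THE r. \<exists>m n z. sel m n z x y \<and> r = 1) = (1::real)" if "hit x y"
    using hit_sel[OF that] by (intro the_equality) auto
  then show ?thesis using sum_sel[of x y "\<lambda>_ _ _. 1"] by simp
qed

section \<open>One- and two-point probabilities, the weights and their first moment\<close>

definition "\<alpha> m z = expect p (\<lambda>x. of_bool (X m x = z))"
definition "\<beta> n z = expect q (\<lambda>y. of_bool (Y n y = z))"
definition "\<nu> m n z = expect p (\<lambda>x. expect q (\<lambda>y. of_bool (sel m n z x y)))"
text \<open>The density of the law of the selected intersection against the product of the laws of
  \<open>X m\<close> and \<open>Y n\<close>.\<close>

definition "w m n z = \<nu> m n z / (\<alpha> m z * \<beta> n z)"
definition "p2 m z m' z' = expect p (\<lambda>x. of_bool (X m x = z \<and> X m' x = z'))"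
definition "q2 n z n' z' = expect q (\<lambda>y. of_bool (Y n y = z \<and> Y n' y = z'))"
definition "H = expect p (\<lambda>x. expect q (\<lambda>y. of_bool (hit x y)))"

lemma nonneg: "0 \<le> \<alpha> m z" "0 \<le> \<beta> n z" "0 \<le> \<nu> m n z" "0 \<le> p2 m z m' z'" "0 \<le> q2 n z n' z'" "0 \<le> H" "0 \<le> w m n z"
  unfolding w_def \<alpha>_def \<beta>_def \<nu>_def p2_def q2_def H_def
  by (intro divide_nonneg_nonneg mult_nonneg_nonneg expect_nonneg; simp)+

lemma bfun_expect_bool: "bfun (\<lambda>x. expect q (\<lambda>y. of_bool (P x y)))"
  by (rule bfun_expect) (rule bfun_of_bool)

text \<open>Selection forces \<open>X m = z\<close> and \<open>Y n = z\<close>, and the chains are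
  independent. Consequently a zero denominator in \<open>w\<close> comes with
  \<open>\<nu> = 0\<close>.\<close>

lemma \<nu>_le: "\<nu> m n z \<le> \<alpha> m z * \<beta> n z"
proof -
  have "\<nu> m n z \<le> expect p (\<lambda>x. of_bool (X m x = z) * \<beta> n z)"
    unfolding \<nu>_def
  proof (intro expect_mono bfun_expect_bool bfun_mult bfun_of_bool bfun_const)
    fix x
    have "expect q (\<lambda>y. of_bool (sel m n z x y)) \<le> expect q (\<lambda>y. of_bool (X m x = z) * of_bool (Y n y = z))"
      by (intro expect_mono bfun_mult bfun_of_bool) (use sel_D[of m n z x] in auto)
    then show "expect q (\<lambda>y. of_bool (sel m n z x y)) \<le> of_bool (X m x = z) * \<beta> n z"
      by (simp add: \<beta>_def)
  qed
  then show ?thesis by (simp add: \<alpha>_def)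
qed

lemma w_mult: "w m n z * (\<alpha> m z * \<beta> n z) = \<nu> m n z"
  using \<nu>_le[of m n z] nonneg(3)[of m n z] unfolding w_def by auto

lemma sum_\<nu>: "(\<Sum>(m, n, z)\<in>T. \<nu> m n z) = H"
proof -
  have "H = expect p (\<lambda>x. expect q (\<lambda>y. \<Sum>(m, n, z)\<in>T. of_bool (sel m n z x y)))"
    unfolding H_def by (simp add: sum_sel_1)
  also have "\<dots> = expect p (\<lambda>x. \<Sum>(m, n, z)\<in>T. expect q (\<lambda>y. of_bool (sel m n z x y)))"
    by (intro arg_cong[where f="expect p"] ext) (simp only: split_def expect_sum bfun_of_bool)
  also have "\<dots> = (\<Sum>(m, n, z)\<in>T. \<nu> m n z)"
    unfolding \<nu>_def by (simp only: split_def, intro expect_sum bfun_expect_bool)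
  finally show ?thesis by simp
qed

lemma first_moment: "(\<Sum>(m, n, z)\<in>T. w m n z * (\<alpha> m z * \<beta> n z)) = H"
  by (simp add: w_mult sum_\<nu>)

text \<open>With \<open>y\<close> frozen, \<open>S x y\<close> is a sum of terms
  \<open>a m (X m x)\<close>, the form to which the maximal inequality applies. The factor for
  \<open>z \<in> B\<close> is explicit because the state of \<open>X\<close> will be substituted for
  \<open>z\<close>.\<close>

definition slice_weight :: "'b \<Rightarrow> nat \<Rightarrow> 's \<Rightarrow> real" where
  "slice_weight y m z = (\<Sum>n\<le>N. of_bool (z \<in> B) * w m n z * of_bool (Y n y = z))"

definition S :: "'a \<Rightarrow> 'b \<Rightarrow> real" where
  "S x y = (\<Sum>(m, n, z)\<in>T. w m n z * of_bool (X m x = z) * of_bool (Y n y = z))"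

definition E2 :: real where
  "E2 = (\<Sum>(m, n, z)\<in>T. \<Sum>(m', n', z')\<in>T. w m n z * w m' n' z' * (p2 m z m' z' * q2 n z n' z'))"

lemma S_slice_weight: "S x y = (\<Sum>m\<le>N. slice_weight y m (X m x))"
proof -
  have "slice_weight y m (X m x) = (\<Sum>n\<le>N. \<Sum>z\<in>B. w m n z * of_bool (X m x = z) * of_bool (Y n y = z))" for m
  proof -
    have "(\<Sum>z\<in>B. w m n z * of_bool (X m x = z) * of_bool (Y n y = z)) =
      (\<Sum>z\<in>B. if z = X m x then w m n z * of_bool (Y n y = z) else 0)" for n
      by (intro sum.cong) auto
    then show ?thesis unfolding slice_weight_def by (intro sum.cong) (auto simp: B)
  qed
  then show ?thesis unfolding S_def sum_T by simp
qed

text \<open>The two-point form of \<open>E2\<close> is compared later with events of the original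
  chains; the second moment of \<open>S\<close> is what the maximal inequality produces.\<close>

lemma E2_eq: "E2 = expect q (\<lambda>y. expect p (\<lambda>x. (S x y)\<^sup>2))"
proof -
  have sq: "(S x y)\<^sup>2 = (\<Sum>t\<in>T. \<Sum>t'\<in>T. 
      (\<lambda>(m, n, z) (m', n', z'). w m n z * w m' n' z' *
        (of_bool (X m x = z \<and> X m' x = z') * of_bool (Y n y = z \<and> Y n' y = z'))) t t')" for x y
    unfolding S_def power2_eq_square sum_product
    by (intro sum.cong) (auto simp: split_def)
  let ?f = "\<lambda>(m, n, z) (m', n', z'). w m n z * w m' n' z' * p2 m z m' z'"
  let ?g = "\<lambda>y (m, n, z) (m', n', z'). of_bool (Y n y = z \<and> Y n' y = z') :: real"
  have "expect p (\<lambda>x. (S x y)\<^sup>2) = (\<Sum>t\<in>T. \<Sum>t'\<in>T. ?f t t' * ?g y t t')" for y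
    unfolding sq split_def p2_def
    by (subst expect_sum, (intro bfun_sum bfun_mult bfun_const bfun_of_bool)[], intro sum.cong refl,
        subst expect_sum, (intro bfun_sum bfun_mult bfun_const bfun_of_bool)[], intro sum.cong refl, simp)
  then have "expect q (\<lambda>y. expect p (\<lambda>x. (S x y)\<^sup>2)) = expect q (\<lambda>y. \<Sum>t\<in>T. \<Sum>t'\<in>T. ?f t t' * ?g y t t')" by simp
  also have "\<dots> = (\<Sum>t\<in>T. \<Sum>t'\<in>T. ?f t t' * expect q (\<lambda>y. ?g y t t'))"
    unfolding split_def
    by (subst expect_sum, (intro bfun_sum bfun_mult bfun_const bfun_of_bool)[], intro sum.cong refl,
        subst expect_sum, (intro bfun_sum bfun_mult bfun_const bfun_of_bool)[], intro sum.cong refl, simp)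
  also have "\<dots> = E2" unfolding E2_def q2_def by (simp add: split_def mult.assoc)
  finally show ?thesis by simp
qed

lemma bfun_slice_weight: "bfun (slice_weight y m)"
  unfolding slice_weight_def
proof (rule bfun_sum)
  fix n assume "n \<in> {..N}"
  show "bfun (\<lambda>z. of_bool (z \<in> B) * w m n z * of_bool (Y n y = z))"
  proof (rule bfunI)
    fix z
    show "\<bar>of_bool (z \<in> B) * w m n z * of_bool (Y n y = z)\<bar> \<le> (\<Sum>z\<in>B. w m n z)"
      using B nonneg(7) by (cases "z \<in> B"; cases "Y n y = z") (auto intro!: member_le_sum sum_nonneg)
  qed
qed

lemma slice_weight_nonneg: "0 \<le> slice_weight y m z"
  unfolding slice_weight_def by (intro sum_nonneg mult_nonneg_nonneg) (auto simp: nonneg)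

text \<open>For fixed \<open>x\<close>, \<open>first_hit x n\<close> is the first entrance of
  \<open>Y\<close>, from time \<open>n0\<close> on, into a fixed set.\<close>

lemma past_sel: "past Y n (\<lambda>y. of_bool (sel m n z x y) :: real)"
  unfolding past_def sel_def first_hit_def by (auto simp: less_imp_le)

lemma cexp_slice_weight:
  assumes "I \<subseteq> {..N}"
  shows "cexp p X I (slice_weight y) m z = (\<Sum>m'\<in>I. \<Sum>n'\<le>N. \<Sum>z'\<in>B. w m' n' z' * (p2 m z m' z' / \<alpha> m z)
      * of_bool (Y n' y = z'))"
proof -
  have fin: "finite I" using assms finite_subset by blast
  have "of_bool (X m x = z) * (\<Sum>m'\<in>I. slice_weight y m' (X m' x)) = 
    (\<Sum>m'\<in>I. \<Sum>n'\<le>N. \<Sum>z'\<in>B. w m' n' z' * of_bool (Y n' y = z') * of_bool (X m x = z \<and> X m' x = z'))" for x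
  proof -
    have *: "of_bool (X m x = z) * (of_bool (X m' x \<in> B) * w m' n' (X m' x) * of_bool (Y n' y = X m' x)) =
      (\<Sum>z'\<in>B. w m' n' z' * of_bool (Y n' y = z') * of_bool (X m x = z \<and> X m' x = z'))" for m' n'
    proof -
      have "(\<Sum>z'\<in>B. w m' n' z' * of_bool (Y n' y = z') * of_bool (X m x = z \<and> X m' x = z')) =
        (\<Sum>z'\<in>B. if z' = X m' x then of_bool (X m x = z) * (w m' n' z' * of_bool (Y n' y = z')) else 0)"
        by (intro sum.cong) auto
      then show ?thesis using B by auto
    qed
    show ?thesis unfolding slice_weight_def sum_distrib_left * by simp
  qed
  then have "expect p (\<lambda>x. of_bool (X m x = z) * (\<Sum>m'\<in>I. slice_weight y m' (X m' x))) =
    (\<Sum>m'\<in>I. \<Sum>n'\<le>N. \<Sum>z'\<in>B. w m' n' z' * of_bool (Y n' y = z') * p2 m z m' z')"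
    unfolding p2_def
    by (simp only:) (subst expect_sum, (intro bfun_sum bfun_mult bfun_const bfun_of_bool)[], intro sum.cong refl,
        subst expect_sum, (intro bfun_sum bfun_mult bfun_const bfun_of_bool)[], intro sum.cong refl, 
        subst expect_sum, (intro bfun_sum bfun_mult bfun_const bfun_of_bool)[], intro sum.cong refl, simp)
  then show ?thesis unfolding cexp_def \<alpha>_def[symmetric] by (simp add: sum_divide_distrib mult_ac)
qed

text \<open>One time ordering of the second moment; \<open>I m\<close> will be the future or the
  past of \<open>m\<close>.\<close>

definition Q :: "(nat \<Rightarrow> nat set) \<Rightarrow> real" where
  "Q I = (\<Sum>(m, n, z)\<in>T. \<Sum>(m', n', z')\<in>T. of_bool (m' \<in> I m \<and> n \<le> n') * 
     (w m n z * w m' n' z' * (p2 m z m' z' * q2 n z n' z')))"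

text \<open>\<open>D x y\<close> is the conditional expectation given \<open>X\<close> at the selected time, for \<open>Y\<close> known. Optional
  stopping in \<open>Y\<close> bounds \<open>Q I\<close> by the expectation of \<open>D\<close> on \<open>hit\<close>, and Doob's inequality in \<open>X\<close> controls
  the square of \<open>D\<close>.\<close>

lemma Q_bound:
  assumes I: "\<And>m. m \<le> N \<Longrightarrow> I m \<subseteq> {..N}"
    and doob: "\<And>a \<mu>. (\<And>i. bfun (a i)) \<Longrightarrow> (\<And>i z. 0 \<le> a i z) \<Longrightarrow> (\<And>x. \<mu> x \<le> N) \<Longrightarrow>
      expect p (\<lambda>x. (cexp p X (I (\<mu> x)) a (\<mu> x) (X (\<mu> x) x))\<^sup>2) \<le> 4 * expect p (\<lambda>x. (\<Sum>i\<le>N. a i (X i x))\<^sup>2)"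
  shows "Q I \<le> 8 * H + E2 / 8"
proof -
  define G where "G y m z = cexp p X (I m) (slice_weight y) m z" for y m z
  \<comment> \<open>Off \<open>hit\<close> the index is 0, still at most \<open>N\<close>, so
    \<open>idx\<close> is an admissible \<open>\<mu>\<close> for every \<open>x\<close>.\<close>
  define idx where "idx x y = (if hit x y then (THE m. \<exists>n z. sel m n z x y) else 0)" for x y
  define D where "D x y = G y (idx x y) (X (idx x y) x)" for x y
  have idx: "idx x y = m" "D x y = G y m z" "hit x y" if "sel m n z x y" for m n z x y
  proof -
    show h: "hit x y" 
    proof -
      have "n0 \<le> n" using that by (simp add: sel_def first_hit_def)
      with sel_D[OF that] show ?thesis unfolding hit_def by (intro exI[of _ n] exI[of _ m]) simp
    qed
    have "(THE m. \<exists>n z. sel m n z x y) = m"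
    proof (rule the_equality)
      show "\<exists>n z. sel m n z x y" using that by blast
      show "m' = m" if "\<exists>n z. sel m' n z x y" for m' 
        using that sel_unique[OF \<open>sel m n z x y\<close>] by blast
    qed
    with h show i: "idx x y = m" by (simp add: idx_def)
    show "D x y = G y m z" unfolding D_def i using sel_D[OF that] by simp
  qed
  have idx_le: "idx x y \<le> N" for x y
  proof (cases "hit x y")
    case True
    then obtain m n z where "sel m n z x y" using hit_sel by blast
    then show ?thesis using idx sel_D by metis
  qed (simp add: idx_def)
  have G_eq: "G y m z = (\<Sum>m'\<in>I m. \<Sum>n'\<le>N. \<Sum>z'\<in>B. w m' n' z' * (p2 m z m' z' / \<alpha> m z) * of_bool (Y n' y = z'))"
    if "m \<le> N" for y m z unfolding G_def using I[OF that] by (rule cexp_slice_weight)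
  have p2_le: "p2 m z m' z' / \<alpha> m z \<le> 1" for m z m' z'
  proof -
    have "p2 m z m' z' \<le> \<alpha> m z" unfolding p2_def \<alpha>_def by (intro expect_mono bfun_of_bool) auto
    then show ?thesis using nonneg(1)[of m z] by (simp add: divide_le_eq)
  qed
  have wle: "w m' n' z' * (p2 m z m' z' / \<alpha> m z) * of_bool b \<le> w m' n' z'" for m n z m' n' z' b
    using mult_left_le[OF p2_le nonneg(7)] nonneg(7) by (cases b) auto
  have D0: "0 \<le> D x y" for x y
    unfolding D_def G_eq[OF idx_le] by (intro sum_nonneg mult_nonneg_nonneg divide_nonneg_nonneg)
        (auto simp: nonneg)
  have bD: "bfun (\<lambda>t. D (fst t) (snd t))"
  proof (rule bfunI)
    fix t :: "'a \<times> 'b"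
    let ?x = "fst t" and ?y = "snd t"
    have "D ?x ?y \<le> (\<Sum>m'\<in>I (idx ?x ?y). \<Sum>n'\<le>N. \<Sum>z'\<in>B. w m' n' z')"
      unfolding D_def G_eq[OF idx_le]
      by (intro sum_mono wle)
    also have "\<dots> \<le> (\<Sum>m'\<le>N. \<Sum>n'\<le>N. \<Sum>z'\<in>B. w m' n' z')"
      using I[OF idx_le] by (intro sum_mono2) (auto intro!: sum_nonneg simp: nonneg)
    finally show "\<bar>D ?x ?y\<bar> \<le> (\<Sum>m'\<le>N. \<Sum>n'\<le>N. \<Sum>z'\<in>B. w m' n' z')" using D0 by simp
  qed
  have bD1: "bfun (D x)" for x using bfun_comp[OF bD, of "\<lambda>y. (x, y)"] by simp
  have bD2: "bfun (\<lambda>x. D x y)" for y using bfun_comp[OF bD, of "\<lambda>x. (x, y)"] by simp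
  have bSD: "bfun (\<lambda>x. expect q (\<lambda>y. of_bool (P x y) * D x y))" for P
    by (rule bfun_expect) (intro bfun_mult bfun_of_bool bD[THEN bfun_comp, of prod.swap, simplified])
  have one: "(\<Sum>(m', n', z')\<in>T. of_bool (m' \<in> I m \<and> n \<le> n')
      * (w m n z * w m' n' z' * (p2 m z m' z' * q2 n z n' z')))
    \<le> expect p (\<lambda>x. expect q (\<lambda>y. of_bool (sel m n z x y) * D x y))" if t: "(m, n, z) \<in> T" for m n z
  proof -
    have mn: "m \<le> N" "n \<le> N" "z \<in> B" using t by (auto simp: T_def)
    let ?s = "\<lambda>m' n' z'. of_bool (m' \<in> I m \<and> n \<le> n') * w m' n' z' * (p2 m z m' z' / \<alpha> m z)"
    have s0: "0 \<le> ?s m' n' z'" for m' n' z' by (auto intro!: mult_nonneg_nonneg simp: nonneg)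
    \<comment> \<open>The weight at \<open>(m, n, z)\<close> is taken apart: \<open>\<nu>\<close>
      will become the selection event, and the denominators turn \<open>p2\<close> and
      \<open>q2\<close> into conditional probabilities.\<close>
    have "(\<Sum>(m', n', z')\<in>T. of_bool (m' \<in> I m \<and> n \<le> n') * (w m n z * w m' n' z' * (p2 m z m' z' * q2 n z n' z')))
      = (\<Sum>(m', n', z')\<in>T. \<nu> m n z * (?s m' n' z' * (q2 n z n' z' / \<beta> n z)))"
      by (intro sum.cong) (auto simp: w_def mult_ac)
    also have "\<dots> = expect p (\<lambda>x. \<Sum>(m', n', z')\<in>T. expect q (\<lambda>y. of_bool (sel m n z x y))
        * (?s m' n' z' * (q2 n z n' z' / \<beta> n z)))"
      unfolding \<nu>_def split_def
      by (subst expect_sum, (intro bfun_mult bfun_const bfun_expect_bool)[], simp)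
    also have "\<dots> \<le> expect p (\<lambda>x. expect q (\<lambda>y. of_bool (sel m n z x y) * D x y))"
    proof (intro expect_mono bSD)
      show "bfun (\<lambda>x. \<Sum>(m', n', z')\<in>T. expect q (\<lambda>y. of_bool (sel m n z x y))
          * (?s m' n' z' * (q2 n z n' z' / \<beta> n z)))"
        unfolding split_def by (intro bfun_sum bfun_mult bfun_const bfun_expect_bool)
      fix x
      have "(\<Sum>(m', n', z')\<in>T. expect q (\<lambda>y. of_bool (sel m n z x y)) * (?s m' n' z' * (q2 n z n' z' / \<beta> n z)))
        = (\<Sum>(m', n', z')\<in>T. expect q (\<lambda>y. of_bool (sel m n z x y) * (?s m' n' z' * of_bool (Y n' y = z'))))"
      proof (intro sum.cong refl, clarify)
        fix m' n' z' assume "(m', n', z') \<in> T"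
        then have n': "n' \<le> N" by (auto simp: T_def)
        show "expect q (\<lambda>y. of_bool (sel m n z x y)) * (?s m' n' z' * (q2 n z n' z' / \<beta> n z)) =
          expect q (\<lambda>y. of_bool (sel m n z x y) * (?s m' n' z' * of_bool (Y n' y = z')))"
        proof (cases "n \<le> n'")
          case True
          \<comment> \<open>Selection at time \<open>n\<close> belongs to the past of
            \<open>Y\<close>, so the Markov property replaces the conditional probability of a visit
            to \<open>z'\<close> by the visit itself.\<close>
          have "future Y N n (\<lambda>y. of_bool (Y n' y = z') :: real)"
            unfolding future_def using True n' by auto
          from markov_propD[OF mY mn(2) bfun_of_bool bfun_of_bool past_sel this, of z m z x]
          have "expect q (\<lambda>y. of_bool (Y n y = z) * (of_bool (sel m n z x y) * of_bool (Y n' y = z'))) =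
             expect q (\<lambda>y. of_bool (Y n y = z) * of_bool (sel m n z x y)) * (q2 n z n' z' / \<beta> n z)"
            unfolding q2_def \<beta>_def by (simp add: of_bool_conj)
          moreover have "of_bool (Y n y = z) * (of_bool (sel m n z x y) * r) = of_bool (sel m n z x y)
              * (r::real)" for y r
            using sel_D(5)[of m n z x y] by auto
          moreover have "of_bool (Y n y = z) * of_bool (sel m n z x y) = (of_bool (sel m n z x y) ::real)" for y
            using sel_D(5)[of m n z x y] by auto
          ultimately have "expect q (\<lambda>y. of_bool (sel m n z x y) * of_bool (Y n' y = z')) =
             expect q (\<lambda>y. of_bool (sel m n z x y)) * (q2 n z n' z' / \<beta> n z)" by simp
          moreover have "expect q (\<lambda>y. of_bool (sel m n z x y) * (?s m' n' z' * of_bool (Y n' y = z'))) =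
            ?s m' n' z' * expect q (\<lambda>y. of_bool (sel m n z x y) * of_bool (Y n' y = z'))"
            by (subst Bochner_Integration.integral_mult_right_zero[symmetric]) (simp add: mult_ac)
          ultimately show ?thesis by simp
        qed simp
      qed
      also have "\<dots> = expect q (\<lambda>y. \<Sum>(m', n', z')\<in>T. of_bool (sel m n z x y)
          * (?s m' n' z' * of_bool (Y n' y = z')))"
        unfolding split_def
        by (subst expect_sum, (intro bfun_mult bfun_const bfun_of_bool)[], simp)
      also have "\<dots> \<le> expect q (\<lambda>y. of_bool (sel m n z x y) * D x y)"
      proof (intro expect_mono bfun_mult bfun_of_bool bD1)
        show "bfun (\<lambda>y. \<Sum>(m', n', z')\<in>T. of_bool (sel m n z x y) * (?s m' n' z' * of_bool (Y n' y = z')))"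
          unfolding split_def by (intro bfun_sum bfun_mult bfun_const bfun_of_bool)
        fix y
        show "(\<Sum>(m', n', z')\<in>T. of_bool (sel m n z x y) * (?s m' n' z' * of_bool (Y n' y = z')))
            \<le> of_bool (sel m n z x y) * D x y"
        proof (cases "sel m n z x y")
          case True
          \<comment> \<open>Dropping \<open>n \<le> n'\<close> only adds nonnegative terms and
            completes the sum to the conditional expectation at the selected index.\<close>
          have "(\<Sum>(m', n', z')\<in>T. ?s m' n' z' * of_bool (Y n' y = z')) \<le> 
             (\<Sum>(m', n', z')\<in>T. of_bool (m' \<in> I m) * (w m' n' z' * (p2 m z m' z' / \<alpha> m z)
                 * of_bool (Y n' y = z')))"
            by (intro sum_mono) (auto simp: nonneg)
          also have "\<dots> = (\<Sum>m'\<le>N. of_bool (m' \<in> I m)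
              * (\<Sum>n'\<le>N. \<Sum>z'\<in>B. w m' n' z' * (p2 m z m' z' / \<alpha> m z) * of_bool (Y n' y = z')))"
            unfolding sum_T by (simp add: sum_distrib_left)
          also have "\<dots> = (\<Sum>m'\<in>I m. of_bool (m' \<in> I m)
              * (\<Sum>n'\<le>N. \<Sum>z'\<in>B. w m' n' z' * (p2 m z m' z' / \<alpha> m z) * of_bool (Y n' y = z')))"
            using I[OF mn(1)] by (intro sum.mono_neutral_right) auto
          also have "\<dots> = G y m z" unfolding G_eq[OF mn(1)] by (intro sum.cong) auto
          also have "\<dots> = D x y" using idx(2)[OF True] by simp
          finally show ?thesis using True by simp
        qed simp
      qed
      finally show "(\<Sum>(m', n', z')\<in>T. expect q (\<lambda>y. of_bool (sel m n z x y))
          * (?s m' n' z' * (q2 n z n' z' / \<beta> n z)))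
         \<le> expect q (\<lambda>y. of_bool (sel m n z x y) * D x y)" .
    qed
    finally show ?thesis .
  qed
  have "Q I \<le> (\<Sum>(m, n, z)\<in>T. expect p (\<lambda>x. expect q (\<lambda>y. of_bool (sel m n z x y) * D x y)))"
    unfolding Q_def using one by (intro sum_mono) auto
  also have "\<dots> = expect p (\<lambda>x. \<Sum>(m, n, z)\<in>T. expect q (\<lambda>y. of_bool (sel m n z x y) * D x y))"
    unfolding split_def by (rule expect_sum[symmetric]) (rule bSD)
  also have "\<dots> = expect p (\<lambda>x. expect q (\<lambda>y. \<Sum>(m, n, z)\<in>T. of_bool (sel m n z x y) * D x y))"
    unfolding split_def by (intro arg_cong[where f="expect p"] ext expect_sum[symmetric] bfun_mult
        bfun_of_bool bD1)
  also have "\<dots> = expect p (\<lambda>x. expect q (\<lambda>y. of_bool (hit x y) * D x y))"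
  proof -
    have "(\<Sum>(m, n, z)\<in>T. of_bool (sel m n z x y) * D x y) = of_bool (hit x y) * D x y" for x y
      unfolding sum_sel_1[symmetric] by (simp add: split_def sum_distrib_right)
    then show ?thesis by simp
  qed
  \<comment> \<open>With the factor 4 of the maximal inequality these coefficients give
    \<open>E2 / 8\<close> per ordering, so the four orderings together use up only half of
    \<open>E2\<close>.\<close>
  also have "\<dots> \<le> expect p (\<lambda>x. expect q (\<lambda>y. 8 * of_bool (hit x y) + (D x y)\<^sup>2 / 32))"
  proof (intro expect_mono bSD bfun_mult bfun_add bfun_divide bfun_power bfun_of_bool bfun_const bD1)
    show "bfun (\<lambda>x. expect q (\<lambda>y. 8 * of_bool (hit x y) + (D x y)\<^sup>2 / 32))"
      by (rule bfun_expect) (intro bfun_mult bfun_add bfun_divide bfun_power bfun_of_bool bfun_const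
          bD[THEN bfun_comp, of prod.swap, simplified])
    fix x y
    \<comment> \<open>AM-GM in place of the Cauchy-Schwarz inequality\<close>
    have "0 \<le> (D x y - 16)\<^sup>2" by simp
    then have "D x y \<le> 8 + (D x y)\<^sup>2 / 32" by (simp add: power2_eq_square algebra_simps)
    then show "of_bool (hit x y) * D x y \<le> 8 * of_bool (hit x y) + (D x y)\<^sup>2 / 32" by auto
  qed
  also have "\<dots> = expect p (\<lambda>x. 8 * expect q (\<lambda>y. of_bool (hit x y)) + expect q (\<lambda>y. (D x y)\<^sup>2) / 32)"
    using bD1 by (simp add: expect_add bfun_mult bfun_divide bfun_power)
  also have "\<dots> = 8 * H + expect p (\<lambda>x. expect q (\<lambda>y. (D x y)\<^sup>2)) / 32"
  proof -
    have "bfun (\<lambda>x. expect q (\<lambda>y. (D x y)\<^sup>2))"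
      by (rule bfun_expect) (intro bfun_power bD[THEN bfun_comp, of prod.swap, simplified])
    then show ?thesis unfolding H_def by (simp add: expect_add bfun_mult bfun_divide bfun_expect_bool)
  qed
  \<comment> \<open>The maximal inequality concerns \<open>X\<close> with \<open>y\<close> frozen,
    so \<open>x\<close> has to be integrated first.\<close>
  also have "expect p (\<lambda>x. expect q (\<lambda>y. (D x y)\<^sup>2)) = expect q (\<lambda>y. expect p (\<lambda>x. (D x y)\<^sup>2))"
    by (rule expect_swap) (intro bfun_power bD)
  also have "expect q (\<lambda>y. expect p (\<lambda>x. (D x y)\<^sup>2)) \<le> expect q (\<lambda>y. 4 * expect p (\<lambda>x. (S x y)\<^sup>2))"
  proof (intro expect_mono bfun_mult bfun_const)
    show "bfun (\<lambda>y. expect p (\<lambda>x. (D x y)\<^sup>2))" by (rule bfun_expect) (intro bfun_power bD)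
    show "bfun (\<lambda>y. expect p (\<lambda>x. (S x y)\<^sup>2))"
      unfolding S_def split_def by (rule bfun_expect)
          (intro bfun_power bfun_sum bfun_mult bfun_const bfun_of_bool)
    show "expect p (\<lambda>x. (D x y)\<^sup>2) \<le> 4 * expect p (\<lambda>x. (S x y)\<^sup>2)" for y
      unfolding D_def G_def S_slice_weight using bfun_slice_weight slice_weight_nonneg idx_le by (rule doob)
  qed
  also have "\<dots> = 4 * E2" by (simp add: E2_eq)
  finally show ?thesis by simp
qed

text \<open>Two triples are ordered in time in at least one of four ways, and swapping them reduces
  these to \<open>Q\<close> for the future and for the past of \<open>m\<close>, each counted
  twice.\<close>

lemma second_moment: "E2 \<le> 64 * H"
proof -
  let ?c = "\<lambda>(m, n, z) (m', n', z'). w m n z * w m' n' z' * (p2 m z m' z' * q2 n z n' z')"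
  let ?r = "\<lambda>I (m, n, z) (m', n', z'). of_bool (m' \<in> I m \<and> n \<le> n') :: real"
  let ?A = "\<lambda>m. {m..N}" and ?B = "\<lambda>m::nat. {..m}"
  have c0: "0 \<le> ?c t t'" for t t' by (auto simp: split_def nonneg)
  have csym: "?c t t' = ?c t' t" for t t'
    by (auto simp: split_def p2_def q2_def conj_commute mult_ac)
  have Q: "Q I = (\<Sum>t\<in>T. \<Sum>t'\<in>T. ?r I t t' * ?c t t')" for I
    unfolding Q_def by (simp add: split_def)
  have Q': "Q I = (\<Sum>t\<in>T. \<Sum>t'\<in>T. ?r I t' t * ?c t t')" for I
    unfolding Q by (subst sum.swap) (use csym in simp)
  have "E2 = (\<Sum>t\<in>T. \<Sum>t'\<in>T. ?c t t')" unfolding E2_def by (simp add: split_def)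
  also have "\<dots> \<le> (\<Sum>t\<in>T. \<Sum>t'\<in>T. (?r ?A t t' + ?r ?B t t' + ?r ?A t' t + ?r ?B t' t) * ?c t t')"
  proof (intro sum_mono)
    fix t t' assume "t \<in> T" "t' \<in> T"
    then have "1 \<le> ?r ?A t t' + ?r ?B t t' + ?r ?A t' t + ?r ?B t' t" by (auto simp: T_def split_def)
    from mult_right_mono[OF this c0[of t t']]
    show "?c t t' \<le> (?r ?A t t' + ?r ?B t t' + ?r ?A t' t + ?r ?B t' t) * ?c t t'" by simp
  qed
  also have "\<dots> = 2 * (Q ?A + Q ?B)"
    unfolding distrib_right sum.distrib Q[symmetric] Q'[symmetric] by simp
  also have "Q ?A \<le> 8 * H + E2 / 8" by (intro Q_bound doob_markov_future mX) auto
  also have "Q ?B \<le> 8 * H + E2 / 8" by (intro Q_bound doob_markov_past mX) auto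
  finally show ?thesis by simp
qed

end

section \<open>Finite random walks\<close>

text \<open>Grows at its end, like the conditioning in \<open>markov_chain\<close>, and is never
  empty, so \<open>last\<close> is its present state.\<close>

primrec walk :: "('s \<Rightarrow> 's pmf) \<Rightarrow> 's \<Rightarrow> nat \<Rightarrow> 's list pmf" where
  "walk K x 0 = return_pmf [x]"
| "walk K x (Suc n) = bind_pmf (walk K x n) (\<lambda>u. map_pmf (\<lambda>y. u @ [y]) (K (last u)))"

lemma set_walk: "u \<in> set_pmf (walk K x n) \<Longrightarrow> length u = Suc n \<and> hd u = x"
  by (induction n arbitrary: u) (force simp: hd_append)+

lemma set_walk_subset:
  assumes "\<And>x. x \<in> S \<Longrightarrow> set_pmf (K x) \<subseteq> S" "x \<in> S"
  shows "u \<in> set_pmf (walk K x n) \<Longrightarrow> set u \<subseteq> S"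
proof (induction n arbitrary: u)
  case (Suc n)
  then obtain v y where v: "v \<in> set_pmf (walk K x n)" "y \<in> set_pmf (K (last v))" "u = v @ [y]" by auto
  moreover have "last v \<in> S" using Suc.IH[OF v(1)] set_walk[OF v(1)]
      by (metis last_in_set list.size(3) nat.distinct(1) subsetD)
  ultimately show ?case using Suc.IH[OF v(1)] assms(1) by auto
qed (use assms in auto)

lemma pmf_walk_0: "pmf (walk K x 0) u = of_bool (u = [x])"
  by (simp add: indicator_def)

lemma pmf_walk_snoc: "pmf (walk K x (Suc n)) (u @ [y]) = pmf (walk K x n) u * pmf (K (last u)) y"
proof -
  have *: "pmf (map_pmf (\<lambda>y. u' @ [y]) (K (last u'))) (u @ [y]) = indicator {u} u' * pmf (K (last u)) y" for u'
  proof (cases "u' = u")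
    case True
    have "inj (\<lambda>y. u @ [y])" by (auto intro: injI)
    then show ?thesis using True pmf_map_inj'[of "\<lambda>y. u @ [y]" "K (last u)" y] by simp
  next
    case False
    then have "u @ [y] \<notin> (\<lambda>y. u' @ [y]) ` set_pmf (K (last u'))" by auto
    then show ?thesis using False pmf_map_outside by fastforce
  qed
  show ?thesis by (simp add: pmf_bind * measure_pmf_single)
qed

text \<open>The second walk starts at the end of the first; \<open>butlast\<close> removes the
  doubled state.\<close>

lemma walk_append:
  "walk K x (m + n) = bind_pmf (walk K x m) (\<lambda>u. map_pmf (\<lambda>v. butlast u @ v) (walk K (last u) n))"
proof (induction n)
  case 0
  have "walk K x m = bind_pmf (walk K x m) return_pmf" by (simp add: bind_return_pmf')
  also have "\<dots> = bind_pmf (walk K x m) (\<lambda>u. return_pmf (butlast u @ [last u]))"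
    by (intro bind_pmf_cong refl) (metis append_butlast_last_id list.size(3) nat.distinct(1) set_walk)
  finally show ?case by simp
next
  case (Suc n)
  have "walk K x (m + Suc n) = bind_pmf (walk K x m) (\<lambda>u. bind_pmf (walk K (last u) n)
     (\<lambda>v. map_pmf (\<lambda>y. (butlast u @ v) @ [y]) (K (last (butlast u @ v)))))"
    by (simp add: Suc bind_assoc_pmf bind_map_pmf)
  also have "\<dots> = bind_pmf (walk K x m) (\<lambda>u. bind_pmf (walk K (last u) n)
     (\<lambda>v. map_pmf (\<lambda>y. butlast u @ v @ [y]) (K (last v))))"
  proof (intro bind_pmf_cong refl)
    fix u v assume "v \<in> set_pmf (walk K (last u) n)"
    then have "v \<noteq> []" using set_walk by fastforce
    then show "map_pmf (\<lambda>y. (butlast u @ v) @ [y]) (K (last (butlast u @ v)))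
        = map_pmf (\<lambda>y. butlast u @ v @ [y]) (K (last v))"
      by simp
  qed
  also have "\<dots> = bind_pmf (walk K x m) (\<lambda>u. map_pmf (\<lambda>v. butlast u @ v) (walk K (last u) (Suc n)))"
    by (simp add: map_bind_pmf map_pmf_comp)
  finally show ?case .
qed

lemma expect_cong: "(\<And>x. x \<in> set_pmf p \<Longrightarrow> f x = g x) \<Longrightarrow> expect p f = expect p g"
  by (intro integral_cong_AE) (auto simp: AE_measure_pmf_iff)

text \<open>On the event that the state at \<open>m\<close> is \<open>z\<close>, the expectation
  factors as \<open>\<phi> f * \<gamma> g\<close>; putting 1 for \<open>f\<close> or
  \<open>g\<close> gives all four expectations in the product identity.\<close>

lemma markov_prop_walk: "markov_prop (walk K x N) (\<lambda>i xs. xs ! i) N"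
  unfolding markov_prop_def
proof (intro allI impI)
  fix m z and f g :: "'a list \<Rightarrow> real"
  assume m: "m \<le> N" and f: "bfun f" and g: "bfun g"
    and past: "past (\<lambda>i xs. xs ! i) m f" and future: "future (\<lambda>i xs. xs ! i) N m g"
  define \<phi> where "\<phi> f = expect (walk K x m) (\<lambda>u. of_bool (last u = z) * f u)" for f
  \<comment> \<open>\<open>g\<close> reads the coordinates from \<open>m\<close> on; the padding
    puts the future walk at these positions.\<close>
  define \<gamma> where "\<gamma> g = expect (walk K z (N - m)) (\<lambda>v. g (replicate m undefined @ v))" for g :: "'a list \<Rightarrow> real"
  have key: "expect (walk K x N) (\<lambda>xs. of_bool (xs ! m = z) * (f xs * g xs)) = \<phi> f * \<gamma> g"
    if f: "bfun f" and g: "bfun g" and past: "past (\<lambda>i xs. xs ! i) m f" and future: "future (\<lambda>i xs. xs ! i) N m g"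
    for f g :: "'a list \<Rightarrow> real"
  proof -
    have "expect (walk K x N) (\<lambda>xs. of_bool (xs ! m = z) * (f xs * g xs)) =
      expect (walk K x m) (\<lambda>u. expect (walk K (last u) (N - m)) (\<lambda>v. of_bool ((butlast u @ v) ! m = z)
          * (f (butlast u @ v) * g (butlast u @ v))))"
      using walk_append[of K x m "N - m"] m f g by (simp add: expect_bind bfun_mult)
    also have "\<dots> = expect (walk K x m) (\<lambda>u. expect (walk K (last u) (N - m)) (\<lambda>v. of_bool (last u = z)
        * (f u * g (replicate m undefined @ v))))"
    proof (intro expect_cong)
      fix u v assume u: "u \<in> set_pmf (walk K x m)" and v: "v \<in> set_pmf (walk K (last u) (N - m))"
      have lu: "length u = Suc m" and lv: "length v = Suc (N - m)" and hv: "hd v = last u"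
        using set_walk[OF u] set_walk[OF v] by auto
      have hv: "v ! 0 = last u" using hv lv by (cases v) auto
      have 1: "(butlast u @ v) ! i = u ! i" if "i \<le> m" for i
      proof (cases "i = m")
        case True
        have "u \<noteq> []" using lu by auto
        then show ?thesis using True lu hv last_conv_nth[of u] by (simp add: nth_append)
      qed (use that lu in \<open>simp add: nth_append nth_butlast\<close>)
      have 2: "(butlast u @ v) ! i = (replicate m undefined @ v) ! i" if "i \<ge> m" for i
        using that lu by (simp add: nth_append)
      have "(butlast u @ v) ! m = last u" using lu hv by (simp add: nth_append)
      moreover have "f (butlast u @ v) = f u" using past 1 unfolding past_def by blast
      moreover have "g (butlast u @ v) = g (replicate m undefined @ v)" using future 2 unfolding future_def
          by simp
      ultimately show "of_bool ((butlast u @ v) ! m = z) * (f (butlast u @ v) * g (butlast u @ v)) =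
        of_bool (last u = z) * (f u * g (replicate m undefined @ v))" by simp
    qed
    also have "\<dots> = expect (walk K x m) (\<lambda>u. of_bool (last u = z) * f u * \<gamma> g)"
      unfolding \<gamma>_def by (intro expect_cong) auto
    finally show ?thesis by (simp add: \<phi>_def)
  qed
  have one: "bfun (\<lambda>_. 1)" "past (\<lambda>i xs. xs ! i) m (\<lambda>_. 1::real)" "future (\<lambda>i xs. xs ! i) N m (\<lambda>_. 1::real)"
    by (auto simp: past_def future_def)
  have \<gamma>1: "\<gamma> (\<lambda>_. 1) = 1" by (simp add: \<gamma>_def)
  show "expect (walk K x N) (\<lambda>xs. of_bool (xs ! m = z) * (f xs * g xs))
      * expect (walk K x N) (\<lambda>xs. of_bool (xs ! m = z)) =
    expect (walk K x N) (\<lambda>xs. of_bool (xs ! m = z) * f xs)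
        * expect (walk K x N) (\<lambda>xs. of_bool (xs ! m = z) * g xs)"
    using key[OF f g past future] key[OF f one(1) past one(3)] key[OF one(1) g one(2) future]
        key[OF one(1) one(1) one(2,3)]
    by (simp add: \<gamma>1)
qed

section \<open>Markov chains as processes; transience\<close>

lemma measure_countable_fibres:
  assumes "finite_measure M" "countable C" "E \<in> sets M" "0 \<le> k"
    and f: "\<And>c. c \<in> C \<Longrightarrow> {\<omega> \<in> space M. f \<omega> = c} \<in> sets M"
    and eq: "\<And>c. c \<in> C \<Longrightarrow> measure M {\<omega> \<in> E. f \<omega> = c} = k * pmf r c"
  shows "measure M {\<omega> \<in> E. f \<omega> \<in> C} = k * measure (measure_pmf r) C" "{\<omega> \<in> E. f \<omega> \<in> C} \<in> sets M"
proof -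
  interpret finite_measure M by fact
  have Ec: "{\<omega> \<in> E. f \<omega> = c} \<in> sets M" if "c \<in> C" for c
  proof -
    have "{\<omega> \<in> E. f \<omega> = c} = E \<inter> {\<omega> \<in> space M. f \<omega> = c}" using sets.sets_into_space[OF assms(3)] by auto
    then show ?thesis using f[OF that] assms(3) by auto
  qed
  have U: "{\<omega> \<in> E. f \<omega> \<in> C} = (\<Union>c\<in>C. {\<omega> \<in> E. f \<omega> = c})" by auto
  show "{\<omega> \<in> E. f \<omega> \<in> C} \<in> sets M" unfolding U using Ec assms(2) by auto
  have "emeasure M {\<omega> \<in> E. f \<omega> \<in> C} = (\<integral>\<^sup>+c. emeasure M {\<omega> \<in> E. f \<omega> = c} \<partial>count_space C)"
    unfolding U using Ec assms(2) by (intro emeasure_UN_countable) (auto simp: disjoint_family_on_def)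
  also have "\<dots> = (\<integral>\<^sup>+c. ennreal k * ennreal (pmf r c) \<partial>count_space C)"
    using eq assms(4) by (intro nn_integral_cong) (auto simp: emeasure_eq_measure ennreal_mult)
  also have "\<dots> = ennreal k * emeasure (measure_pmf r) C"
    by (subst nn_integral_cmult) (auto simp: nn_integral_pmf)
  finally show "measure M {\<omega> \<in> E. f \<omega> \<in> C} = k * measure (measure_pmf r) C"
    using assms(4) by (simp add: emeasure_eq_measure measure_pmf.emeasure_eq_measure ennreal_mult[symmetric])
qed

text \<open>Summation over countably many fibres turns conditional estimates into unconditional
  ones. Only \<open>B\<close> has to be covered by the fibres over \<open>C\<close>.\<close>

lemma measure_le_fibres:
  assumes "finite_measure M" "countable C" "A \<in> sets M" "B \<in> sets M" "0 \<le> k"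
    and fC: "\<And>\<omega>. \<omega> \<in> B \<Longrightarrow> f \<omega> \<in> C"
    and f: "\<And>c. c \<in> C \<Longrightarrow> {\<omega> \<in> space M. f \<omega> = c} \<in> sets M"
    and le: "\<And>c. c \<in> C \<Longrightarrow> k * measure M {\<omega> \<in> B. f \<omega> = c} \<le> measure M {\<omega> \<in> A. f \<omega> = c}"
  shows "k * measure M B \<le> measure M A"
proof -
  interpret finite_measure M by fact
  have Ec: "{\<omega> \<in> E. f \<omega> = c} \<in> sets M" if "c \<in> C" "E \<in> sets M" for c E
  proof -
    have "{\<omega> \<in> E. f \<omega> = c} = E \<inter> {\<omega> \<in> space M. f \<omega> = c}" using sets.sets_into_space[OF that(2)] by auto
    then show ?thesis using f[OF that(1)] that(2) by auto
  qed
  have U: "emeasure M (\<Union>c\<in>C. {\<omega> \<in> E. f \<omega> = c}) = (\<integral>\<^sup>+c. emeasure M {\<omega> \<in> E. f \<omega> = c} \<partial>count_space C)" if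
      "E \<in> sets M" for E
    using Ec[OF _ that] assms(2) by (intro emeasure_UN_countable) (auto simp: disjoint_family_on_def)
  have "ennreal k * emeasure M B = ennreal k * emeasure M (\<Union>c\<in>C. {\<omega> \<in> B. f \<omega> = c})"
    using fC by (intro arg_cong2[where f="(*)"] arg_cong2[where f=emeasure]) auto
  also have "\<dots> = (\<integral>\<^sup>+c. ennreal k * emeasure M {\<omega> \<in> B. f \<omega> = c} \<partial>count_space C)"
    by (subst nn_integral_cmult) (auto simp: U assms)
  also have "\<dots> \<le> (\<integral>\<^sup>+c. emeasure M {\<omega> \<in> A. f \<omega> = c} \<partial>count_space C)"
    using le assms(5) by (intro nn_integral_mono) (auto simp: emeasure_eq_measure ennreal_mult[symmetric])
  also have "\<dots> = emeasure M (\<Union>c\<in>C. {\<omega> \<in> A. f \<omega> = c})" by (simp add: U assms)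
  also have "\<dots> \<le> emeasure M A" using assms by (intro emeasure_mono) auto
  finally show ?thesis using assms(5) by (simp add: emeasure_eq_measure ennreal_mult[symmetric])
qed

text \<open>Both end points are included, so \<open>pre X m\<close> and \<open>seg X m a\<close>
  share the state at time \<open>m\<close>; hence the \<open>butlast\<close> when they are
  joined.\<close>

definition seg :: "(nat \<Rightarrow> 'a \<Rightarrow> 's) \<Rightarrow> nat \<Rightarrow> nat \<Rightarrow> 'a \<Rightarrow> 's list" where
  "seg X m a \<omega> = map (\<lambda>i. X i \<omega>) [m..<Suc (m + a)]"

abbreviation "pre X m \<equiv> seg X 0 m"

lemma length_seg [simp]: "length (seg X m a \<omega>) = Suc a"
  by (simp add: seg_def)

lemma seg_Suc: "seg X m (Suc a) \<omega> = seg X m a \<omega> @ [X (m + Suc a) \<omega>]"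
  by (simp add: seg_def)

lemma seg_0 [simp]: "seg X m 0 \<omega> = [X m \<omega>]"
  by (simp add: seg_def)

lemma nth_seg: "i \<le> a \<Longrightarrow> seg X m a \<omega> ! i = X (m + i) \<omega>"
  by (simp add: seg_def nth_append del: upt_Suc)

lemma hd_seg [simp]: "hd (seg X m a \<omega>) = X m \<omega>"
  by (simp add: seg_def hd_map del: upt_Suc)

lemma last_seg [simp]: "last (seg X m a \<omega>) = X (m + a) \<omega>"
  by (simp add: seg_def)

lemma set_seg: "set (seg X m a \<omega>) = (\<lambda>i. X i \<omega>) ` {m..m + a}"
  by (simp add: seg_def atLeastLessThanSuc_atLeastAtMost del: upt_Suc)

lemma pre_append: "pre X (m + a) \<omega> = butlast (pre X m \<omega>) @ seg X m a \<omega>"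
  by (induction a) (simp_all add: seg_Suc, simp add: seg_def)

lemma pre_eq_iff: "length u = Suc m \<Longrightarrow> pre X m \<omega> = u \<longleftrightarrow> (\<forall>i\<le>m. X i \<omega> = u ! i)"
  by (auto simp: list_eq_iff_nth_eq nth_seg less_Suc_eq_le)

text \<open>Two overlapping pieces that agree at the joint amount to one longer initial segment, and
  the law of initial segments is what \<open>markov_chain\<close> controls.\<close>

lemma pre_seg_iff:
  assumes "length u = Suc m"
  shows "(pre X m \<omega> = u \<and> seg X m a \<omega> = s) \<longleftrightarrow> (length s = Suc a \<and> hd s = last u \<and> pre X (m + a) \<omega> = butlast u @ s)"
proof
  assume "pre X m \<omega> = u \<and> seg X m a \<omega> = s"
  then show "length s = Suc a \<and> hd s = last u \<and> pre X (m + a) \<omega> = butlast u @ s"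
    using pre_append[of X m a \<omega>] by auto
next
  assume *: "length s = Suc a \<and> hd s = last u \<and> pre X (m + a) \<omega> = butlast u @ s"
  then have "butlast (pre X m \<omega>) = butlast u" "seg X m a \<omega> = s"
    unfolding pre_append using assms by (auto simp: append_eq_append_conv)
  moreover have "last (pre X m \<omega>) = last u" using calculation(2) * by auto
  moreover have "pre X m \<omega> \<noteq> []" "u \<noteq> []" using assms by (auto simp: seg_def)
  ultimately show "pre X m \<omega> = u \<and> seg X m a \<omega> = s" by (metis append_butlast_last_id)
qed

section \<open>The law of a segment of one chain given its past\<close>

locale chain = prob_space M for M :: "'a measure" +
  fixes S :: "'s set" and K :: "'s \<Rightarrow> 's pmf" and X :: "nat \<Rightarrow> 'a \<Rightarrow> 's"
  assumes mc: "markov_chain M S K X"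
begin

lemma X_meas: "X n \<in> measurable M (count_space S)"
  using mc unfolding markov_chain_def by blast

lemma X_in_S: "\<omega> \<in> space M \<Longrightarrow> X n \<omega> \<in> S"
  using measurable_space[OF X_meas] by simp

lemma K_closed: "x \<in> S \<Longrightarrow> set_pmf (K x) \<subseteq> S"
  using mc unfolding markov_chain_def by blast

lemma X_eq_sets: "{\<omega> \<in> space M. X n \<omega> = x} \<in> sets M"
proof (cases "x \<in> S")
  case True
  have "X n -` {x} \<inter> space M \<in> sets M" by (rule measurable_sets[OF X_meas]) (use True in simp)
  also have "X n -` {x} \<inter> space M = {\<omega> \<in> space M. X n \<omega> = x}" by auto
  finally show ?thesis .
next
  case False
  then have e: "{\<omega> \<in> space M. X n \<omega> = x} = {}" using X_in_S by auto
  show ?thesis unfolding e by (rule sets.empty_sets)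
qed

lemma seg_sets: "{\<omega> \<in> space M. seg X m a \<omega> = s} \<in> sets M"
proof -
  have "seg X m a \<omega> = s \<longleftrightarrow> length s = Suc a \<and> (\<forall>i\<in>{..a}. X (m + i) \<omega> = s ! i)" for \<omega>
    by (auto simp: list_eq_iff_nth_eq nth_seg less_Suc_eq_le)
  then have "{\<omega> \<in> space M. seg X m a \<omega> = s} = (if length s
      = Suc a then {\<omega> \<in> space M. \<forall>i\<in>{..a}. X (m + i) \<omega> = s ! i} else {})" by auto
  then show ?thesis using X_eq_sets by (auto intro!: sets.sets_Collect_finite_All)
qed

lemma pre_snoc:
  assumes "length u = Suc m"
  shows "prob {\<omega> \<in> space M. pre X (Suc m) \<omega> = u @ [y]} = prob {\<omega> \<in> space M. pre X m \<omega> = u} * pmf (K (last u)) y"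
proof -
  have e: "{\<omega> \<in> space M. pre X (Suc m) \<omega> = u @ [y]} = {\<omega> \<in> space M. X (Suc m) \<omega> = y \<and> (\<forall>i\<le>m. X i \<omega> = u ! i)}"
    by (auto simp: seg_Suc pre_eq_iff[OF assms])
  have e': "{\<omega> \<in> space M. pre X m \<omega> = u} = {\<omega> \<in> space M. \<forall>i\<le>m. X i \<omega> = u ! i}"
    by (simp add: pre_eq_iff[OF assms])
  have l: "last u = u ! m" using assms by (metis diff_Suc_1 last_conv_nth list.size(3) nat.distinct(1))
  show ?thesis
  proof (cases "prob {\<omega> \<in> space M. pre X m \<omega> = u} = 0")
    \<comment> \<open>\<open>markov_chain\<close> is silent about a past of probability 0; there
      both sides vanish by monotonicity.\<close>
    case True
    have "prob {\<omega> \<in> space M. pre X (Suc m) \<omega> = u @ [y]} \<le> prob {\<omega> \<in> space M. pre X m \<omega> = u}"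
      using seg_sets by (intro finite_measure_mono) (auto simp: seg_Suc)
    then show ?thesis using True by (simp add: measure_le_0_iff)
  next
    case False
    then have "prob {\<omega> \<in> space M. \<forall>i\<le>m. X i \<omega> = u ! i} > 0"
      by (simp add: e' zero_less_measure_iff)
    moreover then have "\<P>(\<omega> in M. X (Suc m) \<omega> = y \<bar> \<forall>i\<le>m. X i \<omega> = u ! i) = pmf (K (u ! m)) y"
      using mc unfolding markov_chain_def by blast
    ultimately show ?thesis unfolding e e' l cond_prob_def by (simp add: field_simps)
  qed
qed

lemma pre_walk:
  assumes u: "length u = Suc m"
  shows "prob {\<omega> \<in> space M. pre X m \<omega> = u \<and> seg X m a \<omega> = s} = prob {\<omega> \<in> space M. pre X m \<omega> = u}
      * pmf (walk K (last u) a) s"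
proof (induction a arbitrary: s)
  case 0
  show ?case
  proof (cases "s = [last u]")
    case True
    have "X m \<omega> = last u" if "pre X m \<omega> = u" for \<omega> using that last_seg[of X 0 m \<omega>] by simp
    then have "{\<omega> \<in> space M. pre X m \<omega> = u \<and> seg X m 0 \<omega> = s} = {\<omega> \<in> space M. pre X m \<omega> = u}" using True by auto
    then show ?thesis using True by (simp only: pmf_walk_0) simp
  next
    case False
    have "X m \<omega> = last u" if "pre X m \<omega> = u" for \<omega> using that last_seg[of X 0 m \<omega>] by simp
    then have "{\<omega> \<in> space M. pre X m \<omega> = u \<and> seg X m 0 \<omega> = s} = {}" using False by auto
    then show ?thesis using False by (simp only: pmf_walk_0) simp
  qed
next
  case (Suc a)
  show ?case
  proof (cases "length s = Suc (Suc a) \<and> hd s = last u")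
    case False
    have "{\<omega> \<in> space M. pre X m \<omega> = u \<and> seg X m (Suc a) \<omega> = s} = {}"
      unfolding pre_seg_iff[OF u] using False by auto
    moreover have "pmf (walk K (last u) (Suc a)) s = 0"
      using False set_walk by (metis set_pmf_iff)
    ultimately show ?thesis by (simp only: measure_empty mult_zero_right)
  next
    case True
    then obtain s' y where s: "s = s' @ [y]" by (cases s rule: rev_cases) auto
    have s': "length s' = Suc a" "hd s' = last u" using True s by (auto simp: hd_append split: if_splits)
    have "{\<omega> \<in> space M. pre X m \<omega> = u \<and> seg X m (Suc a) \<omega> = s}
        = {\<omega> \<in> space M. pre X (Suc (m + a)) \<omega> = (butlast u @ s') @ [y]}"
      unfolding pre_seg_iff[OF u] using True s by simp
    then have "prob {\<omega> \<in> space M. pre X m \<omega> = u \<and> seg X m (Suc a) \<omega> = s} =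
      prob {\<omega> \<in> space M. pre X (m + a) \<omega> = butlast u @ s'} * pmf (K (last (butlast u @ s'))) y"
      using u s' by (simp only:) (rule pre_snoc, simp)
    also have "{\<omega> \<in> space M. pre X (m + a) \<omega> = butlast u @ s'} = {\<omega> \<in> space M. pre X m \<omega> = u \<and> seg X m a \<omega> = s'}"
      unfolding pre_seg_iff[OF u] using s' by simp
    also have "last (butlast u @ s') = last s'" using s'(1) by (metis last_appendR length_0_conv nat.distinct(1))
    finally show ?thesis unfolding Suc.IH s pmf_walk_snoc by simp
  qed
qed

end

text \<open>Carries transience, which is stated for \<open>path_law\<close>, over to finite walks:
  the coordinates under \<open>path_law\<close> form a chain themselves, so their segments are
  distributed as \<open>walk\<close>.\<close>

lemma walk_return_le:
  "measure (walk K x T) {s. x \<in> set (tl s)} \<le> \<P>(\<omega> in path_law K x. \<exists>n\<ge>1. \<omega> n = x)"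
proof -
  let ?X = "\<lambda>n \<omega>. \<omega> n :: 'a"
  interpret chain "path_law K x" UNIV K ?X
    by (intro chain.intro chain_axioms.intro prob_space_path_law markov_chain_path_law)
  let ?Q = "{s. x \<in> set (tl s)} \<inter> set_pmf (walk K x T)"
  let ?E = "{\<omega> \<in> space (path_law K x). pre ?X 0 \<omega> = [x]}"
  have E: "?E \<in> sets (path_law K x)" by (rule seg_sets)
  have "?E = {\<omega> \<in> space (path_law K x). \<omega> 0 = x}" by simp
  then have E1: "prob ?E = 1" using E prob_eq_1[of ?E] path_law_initial[of x K] by auto
  have "measure (walk K x T) {s. x \<in> set (tl s)} = 1 * measure (walk K x T) ?Q"
    by (simp add: measure_Int_set_pmf)
  also have "\<dots> = prob {\<omega> \<in> ?E. pre ?X T \<omega> \<in> ?Q}"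
  proof (rule measure_countable_fibres(1)[symmetric])
    fix c
    show "prob {\<omega> \<in> ?E. pre ?X T \<omega> = c} = 1 * pmf (walk K x T) c"
      using pre_walk[of "[x]" 0 T c] E1 by simp
  qed (use E seg_sets in \<open>auto intro: countable_subset finite_measure_axioms\<close>)
  also have "\<dots> \<le> prob {\<omega> \<in> space (path_law K x). \<exists>n\<ge>1. \<omega> n = x}"
  proof (rule finite_measure_mono)
    show "{\<omega> \<in> ?E. pre ?X T \<omega> \<in> ?Q} \<subseteq> {\<omega> \<in> space (path_law K x). \<exists>n\<ge>1. \<omega> n = x}"
    proof safe
      fix \<omega> assume "x \<in> set (tl (pre ?X T \<omega>))"
      then obtain i where "i < T" "tl (pre ?X T \<omega>) ! i = x" by (auto simp: in_set_conv_nth)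
      then have "\<omega> (Suc i) = x" by (simp add: nth_tl nth_seg)
      then show "\<exists>n\<ge>1. \<omega> n = x" by (intro exI[of _ "Suc i"]) simp
    qed
    show "{\<omega> \<in> space (path_law K x). \<exists>n\<ge>1. \<omega> n = x} \<in> sets (path_law K x)"
      using sets_return_event by (simp add: space_path_law)
  qed
  finally show ?thesis .
qed

context chain
begin

lemma seg_in_lists: "\<omega> \<in> space M \<Longrightarrow> seg X m a \<omega> \<in> lists S"
  using X_in_S by (auto simp: set_seg)

lemma seg_Coll:
  assumes "countable S"
  shows "{\<omega> \<in> space M. seg X m a \<omega> \<in> Q} \<in> sets M"
proof -
  have "{\<omega> \<in> space M. seg X m a \<omega> \<in> Q} = (\<Union>s\<in>Q \<inter> lists S. {\<omega> \<in> space M. seg X m a \<omega> = s})"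
    using seg_in_lists by auto
  also have "\<dots> \<in> sets M" using assms seg_sets by (intro sets.countable_UN') auto
  finally show ?thesis .
qed

lemma pre_walk_set:
  assumes u: "length u = Suc m" and S: "countable S"
  shows "prob {\<omega> \<in> space M. pre X m \<omega> = u \<and> seg X m a \<omega> \<in> Q} = prob {\<omega> \<in> space M. pre X m \<omega> = u}
      * measure (walk K (last u) a) Q"
proof (cases "last u \<in> S")
  case False
  then have "pre X m \<omega> \<noteq> u" if "\<omega> \<in> space M" for \<omega>
    using X_in_S[OF that, of m] last_seg[of X 0 m \<omega>] by auto
  then have e: "{\<omega> \<in> space M. pre X m \<omega> = u} = {}" "{\<omega> \<in> space M. pre X m \<omega> = u \<and> seg X m a \<omega> \<in> Q} = {}" by auto
  show ?thesis unfolding e by simp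
next
  case True
  let ?E = "{\<omega> \<in> space M. pre X m \<omega> = u}"
  have "measure (walk K (last u) a) Q = measure (walk K (last u) a) (Q \<inter> lists S)"
    using set_walk_subset[where K=K, OF K_closed True] by (intro measure_prob_cong_0) (auto simp: set_pmf_iff)
  moreover have "{\<omega> \<in> space M. pre X m \<omega> = u \<and> seg X m a \<omega> \<in> Q} = {\<omega> \<in> ?E. seg X m a \<omega> \<in> Q \<inter> lists S}"
    using seg_in_lists by blast
  moreover have "prob {\<omega> \<in> ?E. seg X m a \<omega> \<in> Q \<inter> lists S} = prob ?E * measure (walk K (last u) a) (Q \<inter> lists S)"
  proof (rule measure_countable_fibres(1))
    fix c 
    show "prob {\<omega> \<in> ?E. seg X m a \<omega> = c} = prob ?E * pmf (walk K (last u) a) c"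
      using pre_walk[OF u, of a c] by (simp add: conj_assoc)
  qed (use seg_sets S in \<open>auto intro: finite_measure_axioms\<close>)
  ultimately show ?thesis by simp
qed

text \<open>Decomposition by the last visit: after a visit at time \<open>m\<close> the chain never
  returns with probability at least \<open>d > 0\<close>, so \<open>d\<close> times the probability
  of a visit at \<open>m\<close> is at most that of a last visit at \<open>m\<close>. Last visits at
  different times are disjoint events, so the visit probabilities are summable and Borel-Cantelli
  applies.\<close>

lemma finitely_many_visits:
  assumes S: "countable S" and tr: "\<forall>x\<in>S. transient_state K x"
  shows "AE \<omega> in M. \<forall>x\<in>S. finite {n. X n \<omega> = x}"
proof (subst AE_ball_countable[OF S], intro ballI)
  fix x assume x: "x \<in> S"
  define d where "d = 1 - \<P>(\<omega> in path_law K x. \<exists>n\<ge>1. \<omega> n = x)"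
  have d: "d > 0" using tr x by (simp add: d_def transient_state_def)
  define L where "L m = {\<omega> \<in> space M. X m \<omega> = x \<and> (\<forall>i\<in>{m<..}. X i \<omega> \<noteq> x)}" for m
  have L: "L m \<in> sets M" for m
    unfolding L_def using X_eq_sets by (intro sets.sets_Collect_conj sets.sets_Collect_countable_Ball
        sets.sets_Collect_neg) auto
  have le: "d * prob {\<omega> \<in> space M. X m \<omega> = x} \<le> prob (L m)" for m
  proof (rule measure_le_fibres[where f="pre X m" and C="lists S"])
    fix u
    show "d * prob {\<omega> \<in> {\<omega> \<in> space M. X m \<omega> = x}. pre X m \<omega> = u} \<le> prob {\<omega> \<in> L m. pre X m \<omega> = u}"
    proof (cases "length u = Suc m \<and> last u = x")
      case False
      then have "{\<omega> \<in> {\<omega> \<in> space M. X m \<omega> = x}. pre X m \<omega> = u} = {}" by auto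
      then show ?thesis by (simp only: measure_empty) simp
    next
      case True
      let ?E = "{\<omega> \<in> space M. pre X m \<omega> = u}"
      have E: "X m \<omega> = x" if "pre X m \<omega> = u" for \<omega> using that True last_seg[of X 0 m \<omega>] by simp
      let ?F = "\<lambda>T. {\<omega> \<in> space M. pre X m \<omega> = u \<and> seg X m T \<omega> \<in> {s. x \<notin> set (tl s)}}"
      have F_iff: "x \<notin> set (tl (seg X m T \<omega>)) \<longleftrightarrow> (\<forall>i\<in>{m<..m + T}. X i \<omega> \<noteq> x)" for T \<omega>
      proof -
        have "tl (seg X m T \<omega>) = map (\<lambda>i. X i \<omega>) [Suc m..<Suc (m + T)]"
          by (simp add: seg_def upt_conv_Cons del: upt_Suc)
        then show ?thesis by auto
      qed
      \<comment> \<open>Absence of any return is the decreasing limit of absence of return within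
        \<open>T\<close> steps, which finite walks describe.\<close>
      have lim: "{\<omega> \<in> L m. pre X m \<omega> = u} = (\<Inter>T. ?F T)"
      proof -
        have "(\<forall>T. \<forall>i\<in>{m<..m + T}. X i \<omega> \<noteq> x) \<longleftrightarrow> (\<forall>i\<in>{m<..}. X i \<omega> \<noteq> x)" for \<omega>
          by (metis greaterThanAtMost_iff greaterThan_iff le_add2)
        then show ?thesis unfolding L_def using E F_iff by auto
      qed
      have Fs: "?F T \<in> sets M" for T
        using seg_sets seg_Coll[OF S] by (intro sets.sets_Collect_conj)
      have "decseq ?F" unfolding decseq_def using F_iff by auto
      then have "(\<lambda>T. prob (?F T)) \<longlonglongrightarrow> prob (\<Inter>T. ?F T)"
        using Fs by (intro finite_Lim_measure_decseq) auto
      moreover have "d * prob ?E \<le> prob (?F T)" for T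
      proof -
        have "measure (walk K x T) {s. x \<notin> set (tl s)} = 1 - measure (walk K x T) {s. x \<in> set (tl s)}"
          using measure_pmf.prob_compl[of "{s. x \<in> set (tl s)}" "walk K x T"]
              by (simp add: Compl_eq_Diff_UNIV[symmetric] Collect_neg_eq)
        then have "d \<le> measure (walk K x T) {s. x \<notin> set (tl s)}"
          using walk_return_le[of K x T] unfolding d_def by simp
        then have "d * prob ?E \<le> measure (walk K x T) {s. x \<notin> set (tl s)} * prob ?E"
          by (rule mult_right_mono) simp
        also have "\<dots> = prob ?E * measure (walk K x T) {s. x \<notin> set (tl s)}" by (rule mult.commute)
        also have "\<dots> = prob (?F T)" using True by (simp only: pre_walk_set[OF _ S])
        finally show ?thesis .
      qed
      ultimately have "d * prob ?E \<le> prob {\<omega> \<in> L m. pre X m \<omega> = u}" unfolding lim by (intro LIMSEQ_le_const) auto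
      moreover have "{\<omega> \<in> {\<omega> \<in> space M. X m \<omega> = x}. pre X m \<omega> = u} = ?E" using E by auto
      ultimately show ?thesis by simp
    qed
  qed (use S X_eq_sets L d seg_sets seg_in_lists in \<open>auto intro: finite_measure_axioms\<close>)
  have "summable (\<lambda>m. prob {\<omega> \<in> space M. X m \<omega> = x})"
  proof (rule bounded_imp_summable[where B="1 / d"])
    fix n
    have "d * (\<Sum>m\<le>n. prob {\<omega> \<in> space M. X m \<omega> = x}) \<le> (\<Sum>m\<le>n. prob (L m))"
      unfolding sum_distrib_left by (intro sum_mono le)
    also have "\<dots> = prob (\<Union>m\<le>n. L m)"
    proof (rule finite_measure_finite_Union[symmetric])
      show "disjoint_family_on L {..n}"
        unfolding disjoint_family_on_def L_def by auto (metis greaterThan_iff linorder_neqE_nat)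
    qed (use L in auto)
    also have "\<dots> \<le> 1" by simp
    finally show "(\<Sum>m\<le>n. prob {\<omega> \<in> space M. X m \<omega> = x}) \<le> 1 / d" using d by (simp add: field_simps)
  qed simp
  then have "AE \<omega> in M. eventually (\<lambda>n. \<omega> \<in> space M - {\<omega> \<in> space M. X n \<omega> = x}) sequentially"
    using X_eq_sets by (intro borel_cantelli_AE1) (auto simp: emeasure_eq_measure)
  then show "AE \<omega> in M. finite {n. X n \<omega> = x}"
  proof (rule AE_mp, intro AE_I2 impI)
    fix \<omega> assume \<omega>: "\<omega> \<in> space M" and "eventually (\<lambda>n. \<omega> \<in> space M - {\<omega> \<in> space M. X n \<omega> = x}) sequentially"
    then obtain N where "\<forall>n\<ge>N. X n \<omega> \<noteq> x" by (auto simp: eventually_sequentially)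
    then have "{n. X n \<omega> = x} \<subseteq> {..<N}" by (auto simp: not_le[symmetric])
    then show "finite {n. X n \<omega> = x}" using finite_subset by blast
  qed
qed

end

section \<open>Loop-erasure and exchangeability of the futures\<close>

text \<open>The loop-erasure of \<open>v 0, \<dots>, v m\<close>, continued by the constant \<open>v m\<close> once its end is reached.\<close>

primrec prefix_erasure :: "(nat \<Rightarrow> 's) \<Rightarrow> nat \<Rightarrow> nat \<Rightarrow> 's" where
  "prefix_erasure v m 0 = v 0"
| "prefix_erasure v m (Suc j) = v (min m (Suc (Max {k. k \<le> m \<and> v k = prefix_erasure v m j})))"

lemma prefix_erasure_cong: "(\<And>i. i \<le> m \<Longrightarrow> v i = v' i) \<Longrightarrow> prefix_erasure v m j = prefix_erasure v' m j"
proof (induction j)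
  case (Suc j)
  have "{k. k \<le> m \<and> v k = prefix_erasure v m j} = {k. k \<le> m \<and> v' k = prefix_erasure v' m j}" using Suc by auto
  then show ?case using Suc.prems by simp
qed simp

text \<open>Each step moves the last visit on by at least one until \<open>m\<close> is reached, so
  index \<open>m\<close> exhausts the erasure.\<close>

lemma prefix_erasure_visited: "\<exists>k\<le>m. min j m \<le> k \<and> v k = prefix_erasure v m j"
proof (induction j)
  case 0 then show ?case by auto
next
  case (Suc j)
  let ?A = "{k. k \<le> m \<and> v k = prefix_erasure v m j}"
  obtain k where k: "k \<le> m" "min j m \<le> k" "v k = prefix_erasure v m j" using Suc by blast
  define t where "t = Max ?A"
  have "k \<le> t" unfolding t_def using k by (intro Max_ge) auto
  moreover have "prefix_erasure v m (Suc j) = v (min m (Suc t))" by (simp add: t_def)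
  ultimately show ?case using k by (intro exI[of _ "min m (Suc t)"]) auto
qed

lemma prefix_erasure_last: "prefix_erasure v m m = v m"
  using prefix_erasure_visited[of m m v] by (metis le_antisym min.idem)

text \<open>If the path from time \<open>m\<close> on avoids the first \<open>r\<close> vertices,
  their last visits in the prefix are their last visits overall. The constructions then agree up to
  and including vertex \<open>r\<close>, which may itself be revisited.\<close>

lemma prefix_erasure_eq_loop_erasure:
  assumes fin: "\<And>x. finite {k. v k = x}" and avoid: "\<And>i t. i < r \<Longrightarrow> m \<le> t \<Longrightarrow> v t \<noteq> prefix_erasure v m i"
  shows "j \<le> r \<Longrightarrow> prefix_erasure v m j = loop_erasure v j"
proof (induction j)
  case (Suc j)
  let ?A = "{k. k \<le> m \<and> v k = prefix_erasure v m j}" and ?B = "{k. v k = loop_erasure v j}"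
  have lt: "k < m" if "v k = prefix_erasure v m j" for k using avoid[of j k] that Suc.prems
      by (metis Suc_le_lessD not_le)
  have IH: "prefix_erasure v m j = loop_erasure v j" using Suc by simp
  have eq: "?A = ?B" unfolding IH[symmetric] using lt less_imp_le by blast
  obtain k where "v k = prefix_erasure v m j" using prefix_erasure_visited by metis
  then have "?A \<noteq> {}" using lt less_imp_le by blast
  then have "Max ?A \<in> ?A" by (intro Max_in) auto
  then have "Max ?A < m" using lt by blast
  then show ?case using eq by simp
qed simp

section \<open>Joint law of the two futures given both pasts\<close>

locale chain_couple = X: chain M S K X + Y: chain M S K Y
  for M :: "'a measure" and S :: "'s set" and K and X Y +
  assumes S: "countable S" and transient: "\<forall>x\<in>S. transient_state K x"
    and indep: "X.indep_var (PiM UNIV (\<lambda>_. count_space S)) (\<lambda>\<omega> m. X m \<omega>)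
           (PiM UNIV (\<lambda>_. count_space S)) (\<lambda>\<omega> n. Y n \<omega>)"
begin

lemma indep_pre:
  "X.prob {\<omega> \<in> space M. pre X m \<omega> = u \<and> pre Y n \<omega> = v} = 
   X.prob {\<omega> \<in> space M. pre X m \<omega> = u} * X.prob {\<omega> \<in> space M. pre Y n \<omega> = v}"
proof -
  let ?P = "PiM UNIV (\<lambda>_::nat. count_space S)"
  define A where "A m u = {f \<in> space ?P. map f [0..<Suc m] = u}" for m and u :: "'s list"
  have A: "A m u \<in> sets ?P" for m u
  proof -
    have "map f [0..<Suc m] = u \<longleftrightarrow> length u = Suc m \<and> (\<forall>i\<in>{..m}. f i = u ! i)" for f
      by (auto simp: list_eq_iff_nth_eq less_Suc_eq_le simp del: upt_Suc)
    then have "A m u = (if length u = Suc m then {f \<in> space ?P. \<forall>i\<in>{..m}. f i = u ! i} else {})"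
      by (auto simp: A_def simp del: upt_Suc)
    moreover have "{f \<in> space ?P. f i = c} \<in> sets ?P" for i c
    proof (cases "c \<in> S")
      case True
      have "(\<lambda>f. f i) -` {c} \<inter> space ?P \<in> sets ?P"
        by (rule measurable_sets[OF measurable_component_singleton]) (use True in auto)
      also have "(\<lambda>f. f i) -` {c} \<inter> space ?P = {f \<in> space ?P. f i = c}" by auto
      finally show ?thesis .
    next
      case False
      then have e: "{f \<in> space ?P. f i = c} = {}" by (auto simp: space_PiM)
      show ?thesis unfolding e by (rule sets.empty_sets)
    qed
    ultimately show ?thesis by (auto intro!: sets.sets_Collect_finite_All)
  qed
  have sp: "(\<lambda>m. X m \<omega>) \<in> space ?P" "(\<lambda>m. Y m \<omega>) \<in> space ?P" if "\<omega> \<in> space M" for \<omega>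
    using X.X_in_S Y.X_in_S that by (auto simp: space_PiM)
  have "X.prob ((\<lambda>\<omega>. ((\<lambda>m. X m \<omega>), (\<lambda>n. Y n \<omega>))) -` (A m u \<times> A n v) \<inter> space M) =
    X.prob ((\<lambda>\<omega> m. X m \<omega>) -` A m u \<inter> space M) * X.prob ((\<lambda>\<omega> m. Y m \<omega>) -` A n v \<inter> space M)"
    using X.indep_varD[OF indep A A] .
  moreover have "(\<lambda>\<omega>. ((\<lambda>m. X m \<omega>), (\<lambda>n. Y n \<omega>))) -` (A m u \<times> A n v) \<inter> space M
      = {\<omega> \<in> space M. pre X m \<omega> = u \<and> pre Y n \<omega> = v}"
    using sp by (auto simp: A_def seg_def)
  moreover have "(\<lambda>\<omega> m. X m \<omega>) -` A m u \<inter> space M = {\<omega> \<in> space M. pre X m \<omega> = u}"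
    using sp by (auto simp: A_def seg_def)
  moreover have "(\<lambda>\<omega> m. Y m \<omega>) -` A n v \<inter> space M = {\<omega> \<in> space M. pre Y n \<omega> = v}"
    using sp by (auto simp: A_def seg_def)
  ultimately show ?thesis by simp
qed

text \<open>A past with the segment following it is one longer initial segment, and initial segments
  of the two chains are independent; so given both pasts the futures are independent walks.\<close>

lemma joint_walk:
  assumes u: "length u = Suc m" and v: "length v = Suc n"
  shows "X.prob {\<omega> \<in> space M. (pre X m \<omega> = u \<and> pre Y n \<omega> = v) \<and> (seg X m a \<omega>, seg Y n b \<omega>) \<in> Q} =
    X.prob {\<omega> \<in> space M. pre X m \<omega> = u} * X.prob {\<omega> \<in> space M. pre Y n \<omega> = v} *
    measure (pair_pmf (walk K (last u) a) (walk K (last v) b)) Q"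
proof -
  let ?E = "{\<omega> \<in> space M. pre X m \<omega> = u \<and> pre Y n \<omega> = v}"
  let ?k = "X.prob {\<omega> \<in> space M. pre X m \<omega> = u} * X.prob {\<omega> \<in> space M. pre Y n \<omega> = v}"
  let ?r = "pair_pmf (walk K (last u) a) (walk K (last v) b)"
  let ?L = "lists S \<times> lists S"
  have E: "?E \<in> sets M" using X.seg_sets Y.seg_sets by (intro sets.sets_Collect_conj)
  have eq: "X.prob {\<omega> \<in> ?E. (seg X m a \<omega>, seg Y n b \<omega>) = c} = ?k * pmf ?r c" for c
  proof -
    obtain s t where c: "c = (s, t)" by force
    have X: "X.prob {\<omega> \<in> space M. pre X m \<omega> = u \<and> seg X m a \<omega> = s} = X.prob {\<omega> \<in> space M. pre X m \<omega> = u}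
        * pmf (walk K (last u) a) s"
      by (rule X.pre_walk[OF u])
    have Y: "X.prob {\<omega> \<in> space M. pre Y n \<omega> = v \<and> seg Y n b \<omega> = t} = X.prob {\<omega> \<in> space M. pre Y n \<omega> = v}
        * pmf (walk K (last v) b) t"
      by (rule Y.pre_walk[OF v])
    have "X.prob {\<omega> \<in> ?E. (seg X m a \<omega>, seg Y n b \<omega>) = c} =
      X.prob {\<omega> \<in> space M. (pre X m \<omega> = u \<and> seg X m a \<omega> = s) \<and> (pre Y n \<omega> = v \<and> seg Y n b \<omega> = t)}"
      unfolding c by (intro arg_cong[where f=X.prob]) auto
    also have "\<dots> = X.prob {\<omega> \<in> space M. pre X m \<omega> = u \<and> seg X m a \<omega> = s}
        * X.prob {\<omega> \<in> space M. pre Y n \<omega> = v \<and> seg Y n b \<omega> = t}"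
    proof -
      \<comment> \<open>If a segment cannot be glued to its past, both sides vanish.\<close>
      consider "length s = Suc a \<and> hd s = last u" "length t = Suc b \<and> hd t = last v"
        | "\<not> (length s = Suc a \<and> hd s = last u)" | "\<not> (length t = Suc b \<and> hd t = last v)" by blast
      then show ?thesis
      proof cases
        case 1
        have iff: "(pre X m \<omega> = u \<and> seg X m a \<omega> = s) \<longleftrightarrow> pre X (m + a) \<omega> = butlast u @ s"
          "(pre Y n \<omega> = v \<and> seg Y n b \<omega> = t) \<longleftrightarrow> pre Y (n + b) \<omega> = butlast v @ t" for \<omega>
          using pre_seg_iff[OF u, of X \<omega> a s] pre_seg_iff[OF v, of Y \<omega> b t] 1 by blast+
        show ?thesis by (simp only: iff indep_pre)
      next
        case 2
        have n: "\<not> (pre X m \<omega> = u \<and> seg X m a \<omega> = s)" for \<omega>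
          using 2 pre_seg_iff[OF u, of X \<omega> a s] by blast
        have "{\<omega> \<in> space M. pre X m \<omega> = u \<and> seg X m a \<omega> = s} = {}"
          "{\<omega> \<in> space M. (pre X m \<omega> = u \<and> seg X m a \<omega> = s) \<and> (pre Y n \<omega> = v \<and> seg Y n b \<omega> = t)} = {}"
          using n by blast+
        then show ?thesis by (simp only: measure_empty mult_zero_left)
      next
        case 3
        have n: "\<not> (pre Y n \<omega> = v \<and> seg Y n b \<omega> = t)" for \<omega>
          using 3 pre_seg_iff[OF v, of Y \<omega> b t] by blast
        have "{\<omega> \<in> space M. pre Y n \<omega> = v \<and> seg Y n b \<omega> = t} = {}"
          "{\<omega> \<in> space M. (pre X m \<omega> = u \<and> seg X m a \<omega> = s) \<and> (pre Y n \<omega> = v \<and> seg Y n b \<omega> = t)} = {}"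
          using n by blast+
        then show ?thesis by (simp only: measure_empty mult_zero_right)
      qed
    qed
    finally show ?thesis unfolding X Y c pmf_pair by simp
  qed
  have "X.prob {\<omega> \<in> space M. (pre X m \<omega> = u \<and> pre Y n \<omega> = v) \<and> (seg X m a \<omega>, seg Y n b \<omega>) \<in> Q}
    = X.prob {\<omega> \<in> ?E. (seg X m a \<omega>, seg Y n b \<omega>) \<in> Q \<inter> ?L}"
    using X.seg_in_lists Y.seg_in_lists by (intro arg_cong[where f=X.prob]) blast
  also have "\<dots> = ?k * measure ?r (Q \<inter> ?L)"
  proof (rule measure_countable_fibres(1))
    fix c
    show "{\<omega> \<in> space M. (seg X m a \<omega>, seg Y n b \<omega>) = c} \<in> sets M"
      using X.seg_sets Y.seg_sets by (cases c) (auto intro: sets.sets_Collect_conj)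
    show "X.prob {\<omega> \<in> ?E. (seg X m a \<omega>, seg Y n b \<omega>) = c} = ?k * pmf ?r c" by (rule eq)
  qed (use E S in \<open>auto intro: X.finite_measure_axioms countable_subset[OF Int_lower2]\<close>)
  also have "\<dots> = ?k * measure ?r Q"
  proof (cases "?E = {}")
    case True
    then have "?k = 0" using indep_pre[of m u n v] by (simp only: measure_empty)
    then show ?thesis by (simp only: mult_zero_left)
  next
    case False
    then obtain \<omega> where "\<omega> \<in> space M" "pre X m \<omega> = u" "pre Y n \<omega> = v" by blast
    then have lS: "last u \<in> S" "last v \<in> S" using X.X_in_S Y.X_in_S last_seg[of X 0 m \<omega>]
        last_seg[of Y 0 n \<omega>] by auto
    have "measure ?r (Q \<inter> ?L) = measure ?r Q"
      using set_walk_subset[where K=K, OF X.K_closed lS(1)] set_walk_subset[where K=K, OF X.K_closed lS(2)]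
      by (intro measure_prob_cong_0) (fastforce simp: set_pmf_iff pmf_pair)+
    then show ?thesis by simp
  qed
  finally show ?thesis .
qed

end

text \<open>Time 0 counts, so this is 0 at points of \<open>D\<close>. The finite-walk probabilities
  decrease in \<open>T\<close>, so \<open>lim\<close> is a true limit, and their form matches
  \<open>joint_walk\<close>.\<close>

definition avoid :: "('s \<Rightarrow> 's pmf) \<Rightarrow> 's \<Rightarrow> 's set \<Rightarrow> real" where
  "avoid K z D = lim (\<lambda>T. measure (walk K z T) {s. set s \<inter> D = {}})"

lemma avoid_LIMSEQ: "(\<lambda>T. measure (walk K z T) {s. set s \<inter> D = {}}) \<longlonglongrightarrow> avoid K z D"
proof -
  have "decseq (\<lambda>T. measure (walk K z T) {s. set s \<inter> D = {}})"
  proof (rule decseq_SucI)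
    fix T
    have "map_pmf butlast (walk K z (Suc T)) = walk K z T"
      by (simp add: map_bind_pmf map_pmf_comp bind_return_pmf')
    then have eq: "measure (walk K z T) {s. set s \<inter> D = {}}
        = measure (walk K z (Suc T)) (butlast -` {s. set s \<inter> D = {}})"
      using measure_map_pmf[of butlast "walk K z (Suc T)"] by simp
    have "measure (walk K z (Suc T)) {s. set s \<inter> D = {}}
        \<le> measure (walk K z (Suc T)) (butlast -` {s. set s \<inter> D = {}})"
      by (intro measure_pmf.finite_measure_mono) (auto dest: in_set_butlastD)
    then show "measure (walk K z (Suc T)) {s. set s \<inter> D = {}} \<le> measure (walk K z T) {s. set s \<inter> D = {}}"
      by (simp only: eq)
  qed
  then have "convergent (\<lambda>T. measure (walk K z T) {s. set s \<inter> D = {}})"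
    by (intro Bseq_monoseq_convergent decseq_imp_monoseq BseqI'[where K=1]) auto
  then show ?thesis unfolding avoid_def by (simp add: convergent_LIMSEQ_iff)
qed

lemma avoid_empty: "avoid K z {} = 1"
  using avoid_LIMSEQ[of K z "{}"] by (simp add: LIMSEQ_const_iff)

lemma avoid_self: "z \<in> D \<Longrightarrow> avoid K z D = 0"
proof -
  assume z: "z \<in> D"
  have "measure (walk K z T) {s. set s \<inter> D = {}} = 0" for T
  proof -
    have "set_pmf (walk K z T) \<inter> {s. set s \<inter> D = {}} = {}"
      using z set_walk[of _ K z T] by (auto) (metis IntI emptyE hd_in_set length_0_conv nat.distinct(1))
    then show ?thesis by (simp add: measure_pmf_zero_iff)
  qed
  then show ?thesis using avoid_LIMSEQ[of K z D] by (simp add: LIMSEQ_const_iff)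
qed

definition clear :: "(nat \<Rightarrow> 'a \<Rightarrow> 's) \<Rightarrow> nat \<Rightarrow> 's set \<Rightarrow> 'a \<Rightarrow> bool" where
  "clear Z m D \<omega> \<longleftrightarrow> (\<forall>i\<ge>m. Z i \<omega> \<notin> D)"

lemma clear_iff: "clear Z m D \<omega> \<longleftrightarrow> (\<forall>T. set (seg Z m T \<omega>) \<inter> D = {})"
  unfolding clear_def set_seg by (auto) (metis IntI atLeastAtMost_iff emptyE imageI le_add_diff_inverse
      order_refl)

context chain_couple
begin

lemma clear_sets: "{\<omega> \<in> space M. clear X m D \<omega>} \<in> sets M" "{\<omega> \<in> space M. clear Y m D \<omega>} \<in> sets M"
proof -
  have "{\<omega> \<in> space M. seg X m T \<omega> \<in> {s. set s \<inter> D = {}}} \<in> sets M" 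
    "{\<omega> \<in> space M. seg Y m T \<omega> \<in> {s. set s \<inter> D = {}}} \<in> sets M" for T
    using X.seg_Coll[OF S] Y.seg_Coll[OF S] by blast+
  then show "{\<omega> \<in> space M. clear X m D \<omega>} \<in> sets M" "{\<omega> \<in> space M. clear Y m D \<omega>} \<in> sets M"
    unfolding clear_iff by (auto intro!: sets.sets_Collect_countable_All)
qed

lemma pre_pre_sets: "{\<omega> \<in> space M. pre X m \<omega> = u \<and> pre Y n \<omega> = v} \<in> sets M"
  using X.seg_sets Y.seg_sets by (intro sets.sets_Collect_conj)

lemma set_seg_mono: "T \<le> T' \<Longrightarrow> set (seg Z m T \<omega>) \<subseteq> set (seg Z m T' \<omega>)"
  by (auto simp: set_seg)

lemma measure_pair_pmf_Times: "measure (pair_pmf p q) (A \<times> B) = measure p A * measure q B"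
proof -
  have "measure (pair_pmf p q) (A \<times> B) = measure (pair_pmf p q) ((A \<inter> set_pmf p) \<times> (B \<inter> set_pmf q))"
    by (intro measure_prob_cong_0) (auto simp: pmf_pair set_pmf_iff)
  also have "\<dots> = measure p (A \<inter> set_pmf p) * measure q (B \<inter> set_pmf q)"
    by (intro measure_pmf_prob_product countable_Int2 countable_set_pmf)
  finally show ?thesis by (simp add: measure_Int_set_pmf)
qed

lemma joint_avoid:
  assumes u: "length u = Suc m" and v: "length v = Suc n"
  shows "X.prob {\<omega> \<in> space M. (pre X m \<omega> = u \<and> pre Y n \<omega> = v) \<and> clear X m D \<omega> \<and> clear Y n D' \<omega>} =
    X.prob {\<omega> \<in> space M. pre X m \<omega> = u \<and> pre Y n \<omega> = v} * (avoid K (last u) D * avoid K (last v) D')"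
proof -
  let ?Q = "{s. set s \<inter> D = {}} \<times> {s. set s \<inter> D' = {}}"
  let ?F = "\<lambda>T. {\<omega> \<in> space M. (pre X m \<omega> = u \<and> pre Y n \<omega> = v) \<and> (seg X m T \<omega>, seg Y n T \<omega>) \<in> ?Q}"
  let ?k = "X.prob {\<omega> \<in> space M. pre X m \<omega> = u \<and> pre Y n \<omega> = v}"
  have F: "X.prob (?F T) = ?k * (measure (walk K (last u) T) {s. set s \<inter> D = {}}
      * measure (walk K (last v) T) {s. set s \<inter> D' = {}})" for T
    unfolding joint_walk[OF u v] indep_pre measure_pair_pmf_Times ..
  have "{\<omega> \<in> space M. (pre X m \<omega> = u \<and> pre Y n \<omega> = v) \<and> clear X m D \<omega> \<and> clear Y n D' \<omega>} = (\<Inter>T. ?F T)"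
    unfolding clear_iff by auto
  moreover have "(\<lambda>T. X.prob (?F T)) \<longlonglongrightarrow> X.prob (\<Inter>T. ?F T)"
  proof (rule X.finite_Lim_measure_decseq)
    have "?F T = {\<omega> \<in> space M. pre X m \<omega> = u \<and> pre Y n \<omega> = v}
        \<inter> ({\<omega> \<in> space M. seg X m T \<omega> \<in> {s. set s \<inter> D = {}}}
        \<inter> {\<omega> \<in> space M. seg Y n T \<omega> \<in> {s. set s \<inter> D' = {}}})" for T
      by auto
    moreover have "\<dots> T \<in> sets M" for T
      by (intro sets.Int pre_pre_sets X.seg_Coll[OF S] Y.seg_Coll[OF S])
    ultimately show "range ?F \<subseteq> sets M" by auto
    show "decseq ?F"
      unfolding decseq_def
    proof (intro allI impI subsetI)
      fix T T' :: nat and \<omega> assume "T \<le> T'" "\<omega> \<in> ?F T'"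
      then show "\<omega> \<in> ?F T"
        using set_seg_mono[OF \<open>T \<le> T'\<close>, of X m \<omega>] set_seg_mono[OF \<open>T \<le> T'\<close>, of Y n \<omega>] by blast
    qed
  qed
  moreover have "(\<lambda>T. X.prob (?F T)) \<longlonglongrightarrow> ?k * (avoid K (last u) D * avoid K (last v) D')"
    unfolding F by (intro tendsto_mult tendsto_const avoid_LIMSEQ)
  ultimately show ?thesis by (simp add: LIMSEQ_unique)
qed

text \<open>\<open>r\<close> is the index of the first vertex of the current erasure that
  \<open>Y\<close> visits from time \<open>n\<close> on. \<open>X\<close> has to miss the earlier
  vertices but may return to vertex \<open>r\<close>: ties count as good.\<close>

definition good :: "nat \<Rightarrow> nat \<Rightarrow> 'a \<Rightarrow> bool" where
  "good m n \<omega> \<longleftrightarrow> (\<exists>r\<le>m. clear X m (prefix_erasure (\<lambda>i. X i \<omega>) m ` {..<r}) \<omega>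
      \<and> clear Y n (prefix_erasure (\<lambda>i. X i \<omega>) m ` {..<r}) \<omega>
     \<and> \<not> clear Y n (prefix_erasure (\<lambda>i. X i \<omega>) m ` {..r}) \<omega>)"

text \<open>Given the pasts up to an intersection \<open>X m = Y n\<close>, the two futures are exchangeable, so the
  first point of the current loop-erased path hit by \<open>Y\<close> precedes the one hit by \<open>X\<close> with
  probability at least one half.\<close>

lemma good_half:
  assumes u: "length u = Suc m" and v: "length v = Suc n" and last: "last u = last v"
  shows "X.prob {\<omega> \<in> space M. pre X m \<omega> = u \<and> pre Y n \<omega> = v} / 2 \<le>
    X.prob {\<omega> \<in> space M. (pre X m \<omega> = u \<and> pre Y n \<omega> = v) \<and> good m n \<omega>}"
    and "{\<omega> \<in> space M. (pre X m \<omega> = u \<and> pre Y n \<omega> = v) \<and> good m n \<omega>} \<in> sets M"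
proof -
  let ?E = "{\<omega> \<in> space M. pre X m \<omega> = u \<and> pre Y n \<omega> = v}"
  define D where "D r = prefix_erasure ((!) u) m ` {..<r}" for r :: nat
  define a where "a r = avoid K (last u) (D r)" for r
  define B where "B r r' = {\<omega> \<in> space M. (pre X m \<omega> = u \<and> pre Y n \<omega> = v) \<and> clear X m (D r) \<omega>
      \<and> clear Y n (D r') \<omega>}" for r r'
  have D: "prefix_erasure (\<lambda>i. X i \<omega>) m ` {..<r} = D r"
      "prefix_erasure (\<lambda>i. X i \<omega>) m ` {..r} = D (Suc r)" if "pre X m \<omega> = u" for \<omega> r
  proof -
    have "prefix_erasure (\<lambda>i. X i \<omega>) m j = prefix_erasure ((!) u) m j" for j
      using that pre_eq_iff[OF u, of X \<omega>] by (intro prefix_erasure_cong) auto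
    then show "prefix_erasure (\<lambda>i. X i \<omega>) m ` {..<r} = D r" "prefix_erasure (\<lambda>i. X i \<omega>) m ` {..r} = D (Suc r)"
      by (simp_all add: D_def lessThan_Suc_atMost)
  qed
  have Bs: "B r r' \<in> sets M" for r r'
    unfolding B_def using pre_pre_sets clear_sets by (intro sets.sets_Collect_conj X.seg_sets Y.seg_sets)
  have BP: "X.prob (B r r') = X.prob ?E * (a r * a r')" for r r'
    unfolding B_def a_def joint_avoid[OF u v] last by simp
  have B_sub: "B r (Suc r) \<subseteq> B r r" for r
    unfolding B_def clear_def D_def by auto
  \<comment> \<open>In the piece with index \<open>r\<close> both futures miss the first
    \<open>r\<close> vertices and \<open>Y\<close> visits vertex \<open>r\<close>; as
    \<open>r\<close> is determined, the pieces are disjoint.\<close>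
  have G: "{\<omega> \<in> space M. (pre X m \<omega> = u \<and> pre Y n \<omega> = v) \<and> good m n \<omega>} = (\<Union>r\<le>m. B r r - B r (Suc r))"
    unfolding good_def B_def using D by auto
  show "{\<omega> \<in> space M. (pre X m \<omega> = u \<and> pre Y n \<omega> = v) \<and> good m n \<omega>} \<in> sets M"
    unfolding G using Bs by auto
  have disj: "disjoint_family_on (\<lambda>r. B r r - B r (Suc r)) {..m}"
  proof -
    have *: "(B r r - B r (Suc r)) \<inter> (B r' r' - B r' (Suc r')) = {}" if "r < r'" for r r'
    proof -
      have "D (Suc r) \<subseteq> D r'" using that by (auto simp: D_def)
      then show ?thesis unfolding B_def clear_def by blast
    qed
    show ?thesis unfolding disjoint_family_on_def
    proof (intro ballI impI)
      fix r r' :: nat assume "r \<noteq> r'"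
      then consider "r < r'" | "r' < r" by linarith
      then show "(B r r - B r (Suc r)) \<inter> (B r' r' - B r' (Suc r')) = {}" by cases (use * in blast)+
    qed
  qed
  have a0: "a 0 = 1" by (simp add: a_def D_def avoid_empty)
  \<comment> \<open>Both futures start at the common last state, which is the vertex with index
    \<open>m\<close>, so neither misses all vertices.\<close>
  have am: "a (Suc m) = 0"
  proof -
    have "u ! m = last u" using u by (metis diff_Suc_1 last_conv_nth list.size(3) nat.distinct(1))
    then have "last u \<in> D (Suc m)" using prefix_erasure_last[of "(!) u" m] unfolding D_def
        by (metis imageI lessThan_iff lessI)
    then show ?thesis by (simp add: a_def avoid_self)
  qed
  have "1 / 2 = (\<Sum>r\<le>m. (a r ^ 2 - a (Suc r) ^ 2) / 2)"
    using sum_telescope[of "\<lambda>r. a r ^ 2 / 2" m] a0 am by (simp add: diff_divide_distrib)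
  \<comment> \<open>The term discarded is half of the square of \<open>a r - a (Suc r)\<close>, that
    is, half the conditional probability of a tie at \<open>r\<close>.\<close>
  also have "\<dots> \<le> (\<Sum>r\<le>m. a r * a r - a r * a (Suc r))"
  proof (rule sum_mono)
    fix r
    have "0 \<le> (a r - a (Suc r)) ^ 2" by simp
    then show "(a r ^ 2 - a (Suc r) ^ 2) / 2 \<le> a r * a r - a r * a (Suc r)"
      by (simp add: power2_eq_square field_simps)
  qed
  finally have "X.prob ?E * (1 / 2) \<le> X.prob ?E * (\<Sum>r\<le>m. a r * a r - a r * a (Suc r))"
    by (rule mult_left_mono) simp
  also have "\<dots> = (\<Sum>r\<le>m. X.prob (B r r - B r (Suc r)))"
    unfolding sum_distrib_left
    by (intro sum.cong refl) (simp add: X.finite_measure_Diff[OF Bs Bs B_sub] BP right_diff_distrib)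
  also have "\<dots> = X.prob (\<Union>r\<le>m. B r r - B r (Suc r))"
    using disj Bs by (intro X.finite_measure_finite_Union[symmetric]) auto
  finally show "X.prob ?E / 2 \<le> X.prob {\<omega> \<in> space M. (pre X m \<omega> = u \<and> pre Y n \<omega> = v) \<and> good m n \<omega>}"
    unfolding G by simp
qed

end

section \<open>The second moment method\<close>

text \<open>Pointwise \<open>2 * \<tau> * s - \<tau>\<^sup>2 * s\<^sup>2 \<le> 1\<close>, the
  difference being the square of \<open>1 - \<tau> * s\<close>, and \<open>s\<close> vanishes off
  \<open>R\<close>. The best \<open>\<tau>\<close> gives the usual ratio of squared mean to second
  moment; a free \<open>\<tau>\<close> avoids the division.\<close>

lemma (in finite_measure) second_moment_lower_bound:
  assumes T: "finite T" and g: "\<And>t. t \<in> T \<Longrightarrow> g t \<in> sets M" "\<And>t. t \<in> T \<Longrightarrow> g t \<subseteq> R" and R: "R \<in> sets M"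
  shows "2 * \<tau> * (\<Sum>t\<in>T. w t * measure M (g t)) - \<tau>\<^sup>2 * (\<Sum>t\<in>T. \<Sum>t'\<in>T. w t * w t' * measure M (g t \<inter> g t'))
      \<le> measure M R"
proof -
  define s where "s \<omega> = (\<Sum>t\<in>T. w t * indicator (g t) \<omega>)" for \<omega>
  have sq: "(s \<omega>)\<^sup>2 = (\<Sum>t\<in>T. \<Sum>t'\<in>T. w t * w t' * indicator (g t \<inter> g t') \<omega>)" for \<omega>
    unfolding s_def power2_eq_square sum_product by (intro sum.cong refl)
        (simp add: indicator_inter_arith mult_ac)
  have ind: "integrable M (\<lambda>\<omega>. c * indicator A \<omega> :: real)" if "A \<in> sets M" for A c
    using that by (intro integrable_mult_right integrable_real_indicator) (auto simp: emeasure_eq_measure)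
  have int: "(\<integral>\<omega>. c * indicator A \<omega> \<partial>M) = c * measure M A" if "A \<in> sets M" for A and c :: real
    using that by simp
  have i1: "integrable M s" unfolding s_def by (intro Bochner_Integration.integrable_sum ind g)
  have i2: "integrable M (\<lambda>\<omega>. (s \<omega>)\<^sup>2)" unfolding sq by (intro Bochner_Integration.integrable_sum ind sets.Int g)
  have "(\<integral>\<omega>. 2 * \<tau> * s \<omega> - \<tau>\<^sup>2 * (s \<omega>)\<^sup>2 \<partial>M) \<le> (\<integral>\<omega>. 1 * indicator R \<omega> \<partial>M)"
  proof (rule integral_mono)
    show "integrable M (\<lambda>\<omega>. 2 * \<tau> * s \<omega> - \<tau>\<^sup>2 * (s \<omega>)\<^sup>2)" using i1 i2 by auto
    show "integrable M (\<lambda>\<omega>. 1 * indicator R \<omega> :: real)" by (rule ind) (rule R)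
    fix \<omega>
    show "2 * \<tau> * s \<omega> - \<tau>\<^sup>2 * (s \<omega>)\<^sup>2 \<le> 1 * indicator R \<omega>"
    proof (cases "\<omega> \<in> R")
      case True
      have "0 \<le> (1 - \<tau> * s \<omega>)\<^sup>2" by simp
      then show ?thesis using True by (simp add: power2_eq_square algebra_simps)
    next
      case False
      then have "s \<omega> = 0" unfolding s_def using g(2) by (intro sum.neutral ballI) (auto simp: indicator_def)
      then show ?thesis by simp
    qed
  qed
  also have "\<dots> = measure M R" using R by (subst int) auto
  also have "(\<integral>\<omega>. 2 * \<tau> * s \<omega> - \<tau>\<^sup>2 * (s \<omega>)\<^sup>2 \<partial>M) = 2 * \<tau> * (\<integral>\<omega>. s \<omega> \<partial>M) - \<tau>\<^sup>2 * (\<integral>\<omega>. (s \<omega>)\<^sup>2 \<partial>M)"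
    using i1 i2 by (subst Bochner_Integration.integral_diff) auto
  also have "(\<integral>\<omega>. s \<omega> \<partial>M) = (\<Sum>t\<in>T. w t * measure M (g t))"
  proof -
    have "(\<integral>\<omega>. s \<omega> \<partial>M) = (\<Sum>t\<in>T. (\<integral>\<omega>. w t * indicator (g t) \<omega> \<partial>M))"
      unfolding s_def by (intro Bochner_Integration.integral_sum ind g)
    also have "\<dots> = (\<Sum>t\<in>T. w t * measure M (g t))" by (intro sum.cong refl int g)
    finally show ?thesis .
  qed
  also have "(\<integral>\<omega>. (s \<omega>)\<^sup>2 \<partial>M) = (\<Sum>t\<in>T. \<Sum>t'\<in>T. w t * w t' * measure M (g t \<inter> g t'))"
  proof -
    have "(\<integral>\<omega>. (\<Sum>t'\<in>T. w t * w t' * indicator (g t \<inter> g t') \<omega>) \<partial>M) = (\<Sum>t'\<in>T. w t * w t' * measure M (g t \<inter> g t'))"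
      if "t \<in> T" for t
    proof -
      have "(\<integral>\<omega>. (\<Sum>t'\<in>T. w t * w t' * indicator (g t \<inter> g t') \<omega>) \<partial>M)
          = (\<Sum>t'\<in>T. (\<integral>\<omega>. w t * w t' * indicator (g t \<inter> g t') \<omega> \<partial>M))"
        by (intro Bochner_Integration.integral_sum ind sets.Int g that)
      also have "\<dots> = (\<Sum>t'\<in>T. w t * w t' * measure M (g t \<inter> g t'))"
        by (intro sum.cong refl int sets.Int g that)
      finally show ?thesis .
    qed
    moreover have "(\<integral>\<omega>. (s \<omega>)\<^sup>2 \<partial>M) = (\<Sum>t\<in>T. (\<integral>\<omega>. (\<Sum>t'\<in>T. w t * w t' * indicator (g t \<inter> g t') \<omega>) \<partial>M))"
      unfolding sq by (intro Bochner_Integration.integral_sum Bochner_Integration.integrable_sum ind sets.Int g)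
    ultimately show ?thesis by simp
  qed
  finally show ?thesis .
qed

text \<open>The approximable sets form a sigma-algebra: a countable union is cut to finitely many
  sets at the cost of half of \<open>\<epsilon>\<close>, and these share the other half.\<close>

lemma (in finite_measure) approx_by_algebra:
  assumes alg: "algebra (space M) \<A>" and sub: "\<A> \<subseteq> sets M"
  shows "A \<in> sigma_sets (space M) \<A> \<Longrightarrow> 0 < \<epsilon> \<Longrightarrow> \<exists>C\<in>\<A>. measure M ((A - C) \<union> (C - A)) < \<epsilon>"
proof (induction A arbitrary: \<epsilon> rule: sigma_sets.induct)
  case (Basic a)
  then show ?case by (intro bexI[of _ a]) auto
next
  case Empty
  interpret algebra "space M" \<A> by fact
  show ?case using Empty by (intro bexI[of _ "{}"]) auto
next
  case (Compl a)
  interpret algebra "space M" \<A> by fact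
  obtain C where C: "C \<in> \<A>" "measure M ((a - C) \<union> (C - a)) < \<epsilon>" using Compl by blast
  have "(space M - a - (space M - C)) \<union> (space M - C - (space M - a)) = (a - C) \<union> (C - a)"
    using C(1) sets_into_space Compl(1) sigma_sets_into_sp[OF space_closed] by blast
  then show ?case using C by (intro bexI[of _ "space M - C"]) auto
next
  case (Union a)
  interpret algebra "space M" \<A> by fact
  have sets: "a i \<in> sets M" for i
    using Union(1)[of i] sets.sigma_sets_subset[OF sub] by blast
  let ?U = "\<Union>i. a i"
  have "(\<lambda>n. measure M (\<Union>i<n. a i)) \<longlonglongrightarrow> measure M (\<Union>n. \<Union>i<n. a i)"
    using sets by (intro finite_Lim_measure_incseq) (auto simp: incseq_def intro: less_le_trans)
  moreover have "(\<Union>n. \<Union>i<n. a i) = ?U" by auto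
  ultimately have lim: "(\<lambda>n. measure M (\<Union>i<n. a i)) \<longlonglongrightarrow> measure M ?U" by simp
  then obtain n where n: "measure M ?U - measure M (\<Union>i<n. a i) < \<epsilon> / 2"
    using LIMSEQ_D[OF lim, of "\<epsilon> / 2"] \<open>0 < \<epsilon>\<close> by (smt (verit, best) half_gt_zero le_refl real_norm_def)
  have U: "?U \<in> sets M" "(\<Union>i<n. a i) \<in> sets M" using sets by auto
  have d: "measure M (?U - (\<Union>i<n. a i)) < \<epsilon> / 2"
    using n U by (subst finite_measure_Diff) auto
  \<comment> \<open>\<open>Suc n\<close> keeps the denominator positive when
    \<open>n = 0\<close>.\<close>
  define \<delta> where "\<delta> = \<epsilon> / (2 * Suc n)"
  have \<delta>: "0 < \<delta>" using \<open>0 < \<epsilon>\<close> by (simp add: \<delta>_def)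
  then have "\<forall>i. \<exists>C\<in>\<A>. measure M ((a i - C) \<union> (C - a i)) < \<delta>" using Union(2) by blast
  then obtain C where C: "\<And>i. C i \<in> \<A>" "\<And>i. measure M ((a i - C i) \<union> (C i - a i)) < \<delta>" by metis
  have Cs: "C i \<in> sets M" for i using C(1) sub by blast
  let ?D = "\<lambda>i. (a i - C i) \<union> (C i - a i)"
  have "measure M (\<Union>i<n. ?D i) \<le> (\<Sum>i<n. measure M (?D i))"
    using sets Cs by (intro finite_measure_subadditive_finite) auto
  also have "\<dots> \<le> (\<Sum>i<n. \<delta>)" using C(2) by (intro sum_mono less_imp_le) auto
  also have "\<dots> \<le> \<epsilon> / 2" using \<open>0 < \<epsilon>\<close> by (simp add: \<delta>_def field_simps)
  finally have 1: "measure M (\<Union>i<n. ?D i) \<le> \<epsilon> / 2" .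
  have "measure M ((?U - (\<Union>i<n. C i)) \<union> ((\<Union>i<n. C i) - ?U)) \<le> measure M ((?U - (\<Union>i<n. a i)) \<union> (\<Union>i<n. ?D i))"
    using sets Cs by (intro finite_measure_mono) auto
  also have "\<dots> \<le> measure M (?U - (\<Union>i<n. a i)) + measure M (\<Union>i<n. ?D i)"
    using sets Cs by (intro measure_Un_le) auto
  finally have "measure M ((?U - (\<Union>i<n. C i)) \<union> ((\<Union>i<n. C i) - ?U)) < \<epsilon>" using d 1 by simp
  moreover have "(\<Union>i<n. C i) \<in> \<A>" using C(1) by (intro finite_UN) auto
  ultimately show ?case by blast
qed

lemma expect_of_bool: "expect p (\<lambda>x. of_bool (P x)) = measure p {x. P x}"
proof -
  have "(\<lambda>x. of_bool (P x) :: real) = indicator {x. P x}" by (auto simp: indicator_def)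
  then show ?thesis by simp
qed

lemma expect_expect_of_bool: "expect p (\<lambda>x. expect q (\<lambda>y. of_bool (P x y)))
    = measure (pair_pmf p q) {(x, y). P x y}"
proof -
  have "measure (pair_pmf p q) {(x, y). P x y} = expect (pair_pmf p q) (\<lambda>z. of_bool (P (fst z) (snd z)))"
    unfolding expect_of_bool by (intro arg_cong[where f="measure _"]) auto
  also have "\<dots> = expect p (\<lambda>x. expect q (\<lambda>y. of_bool (P x y)))"
    unfolding pair_pmf_def by (subst expect_bind, simp)+ simp
  finally show ?thesis by simp
qed

context chain_couple
begin

lemma joint_eq_sets: "{\<omega> \<in> space M. X m \<omega> = z \<and> Y n \<omega> = z'} \<in> sets M"
  using X.X_eq_sets Y.X_eq_sets by (intro sets.sets_Collect_conj)

lemma pre_pre_Coll: "{\<omega> \<in> space M. (pre X m \<omega>, pre Y n \<omega>) \<in> Q} \<in> sets M"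
proof -
  have "{\<omega> \<in> space M. (pre X m \<omega>, pre Y n \<omega>) \<in> Q} =
    (\<Union>c\<in>Q \<inter> lists S \<times> lists S. {\<omega> \<in> space M. pre X m \<omega> = fst c \<and> pre Y n \<omega> = snd c})"
    using X.seg_in_lists Y.seg_in_lists by fastforce
  also have "\<dots> \<in> sets M"
    using S pre_pre_sets by (intro sets.countable_UN') (auto intro: countable_subset[OF Int_lower2])
  finally show ?thesis .
qed

text \<open>\<open>good\<close> involves all later times; measurability comes from splitting by the
  countably many pairs of pasts.\<close>

lemma good_sets: "{\<omega> \<in> space M. X m \<omega> = Y n \<omega> \<and> good m n \<omega>} \<in> sets M"
proof -
  have "{\<omega> \<in> space M. X m \<omega> = Y n \<omega> \<and> good m n \<omega>} =
    (\<Union>c\<in>{(u, v). length u = Suc m \<and> length v = Suc n \<and> last u = last v} \<inter> lists S \<times> lists S.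
       {\<omega> \<in> space M. (pre X m \<omega> = fst c \<and> pre Y n \<omega> = snd c) \<and> good m n \<omega>})"
  proof (intro set_eqI iffI)
    fix \<omega> assume "\<omega> \<in> {\<omega> \<in> space M. X m \<omega> = Y n \<omega> \<and> good m n \<omega>}"
    then show "\<omega> \<in> (\<Union>c\<in>{(u, v). length u = Suc m \<and> length v = Suc n \<and> last u = last v} \<inter> lists S \<times> lists S.
       {\<omega> \<in> space M. (pre X m \<omega> = fst c \<and> pre Y n \<omega> = snd c) \<and> good m n \<omega>})"
      using X.seg_in_lists[of \<omega> 0 m] Y.seg_in_lists[of \<omega> 0 n]
      by (intro UN_I[of "(pre X m \<omega>, pre Y n \<omega>)"]) (simp_all del: in_lists_conv_set)
  next
    fix \<omega> assume "\<omega> \<in> (\<Union>c\<in>{(u, v). length u = Suc m \<and> length v = Suc n \<and> last u = last v} \<inter> lists S \<times> lists S.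
       {\<omega> \<in> space M. (pre X m \<omega> = fst c \<and> pre Y n \<omega> = snd c) \<and> good m n \<omega>})"
    then have "last (pre X m \<omega>) = last (pre Y n \<omega>)" "\<omega> \<in> space M" "good m n \<omega>" by auto
    then show "\<omega> \<in> {\<omega> \<in> space M. X m \<omega> = Y n \<omega> \<and> good m n \<omega>}" by simp
  qed
  also have "\<dots> \<in> sets M"
    using S good_half(2) by (intro sets.countable_UN') (auto intro: countable_subset[OF Int_lower2])
  finally show ?thesis .
qed

definition Hit :: "nat \<Rightarrow> nat \<Rightarrow> 'a \<Rightarrow> bool" where
  "Hit k n0 \<omega> \<longleftrightarrow> (\<exists>m\<ge>k. \<exists>n\<ge>n0. X m \<omega> = Y n \<omega>)"

definition Good :: "nat \<Rightarrow> nat \<Rightarrow> 'a \<Rightarrow> bool" where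
  "Good k n0 \<omega> \<longleftrightarrow> (\<exists>m\<ge>k. \<exists>n\<ge>n0. X m \<omega> = Y n \<omega> \<and> good m n \<omega>)"

lemma Hit_sets: "{\<omega> \<in> space M. Hit k n0 \<omega>} \<in> sets M"
proof -
  have "{\<omega> \<in> space M. X m \<omega> = Y n \<omega>} \<in> sets M" for m n
  proof -
    have "{\<omega> \<in> space M. X m \<omega> = Y n \<omega>} = (\<Union>z\<in>S. {\<omega> \<in> space M. X m \<omega> = z \<and> Y n \<omega> = z})"
      using Y.X_in_S by auto
    also have "\<dots> \<in> sets M" using S joint_eq_sets by (intro sets.countable_UN') auto
    finally show ?thesis .
  qed
  moreover have "{\<omega> \<in> space M. Hit k n0 \<omega>} = (\<Union>m\<in>{k..}. \<Union>n\<in>{n0..}. {\<omega> \<in> space M. X m \<omega> = Y n \<omega>})"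
    by (auto simp: Hit_def)
  ultimately show ?thesis by (simp only:) (intro sets.countable_UN', auto)
qed

lemma Good_sets: "{\<omega> \<in> space M. Good k n0 \<omega>} \<in> sets M"
proof -
  have "{\<omega> \<in> space M. Good k n0 \<omega>} = (\<Union>m\<in>{k..}. \<Union>n\<in>{n0..}. {\<omega> \<in> space M. X m \<omega> = Y n \<omega> \<and> good m n \<omega>})"
    by (auto simp: Good_def)
  also have "\<dots> \<in> sets M" using good_sets by (intro sets.countable_UN') auto
  finally show ?thesis .
qed

text \<open>Sums \<open>good_half\<close> over the pasts up to \<open>m\<close> and \<open>n\<close>
  that extend \<open>xs\<close> and \<open>ys\<close> and end in \<open>z\<close>; such a pair of
  pasts decides every condition except \<open>good\<close>.\<close>

lemma good_half_state:
  assumes xs: "length xs = Suc k" and ys: "length ys = Suc k" and le: "k \<le> m" "k \<le> n"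
  shows "1 / 2 * X.prob {\<omega> \<in> space M. (pre X k \<omega> = xs \<and> pre Y k \<omega> = ys) \<and> X m \<omega> = z \<and> Y n \<omega> = z} \<le>
    X.prob {\<omega> \<in> space M. (pre X k \<omega> = xs \<and> pre Y k \<omega> = ys) \<and> X m \<omega> = z \<and> Y n \<omega> = z \<and> good m n \<omega>}"
proof (rule measure_le_fibres[where f="\<lambda>\<omega>. (pre X m \<omega>, pre Y n \<omega>)" and C="lists S \<times> lists S"])
  let ?e = "{\<omega> \<in> space M. (pre X k \<omega> = xs \<and> pre Y k \<omega> = ys) \<and> X m \<omega> = z \<and> Y n \<omega> = z}"
  let ?g = "{\<omega> \<in> space M. (pre X k \<omega> = xs \<and> pre Y k \<omega> = ys) \<and> X m \<omega> = z \<and> Y n \<omega> = z \<and> good m n \<omega>}"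
  show "finite_measure M" by (rule X.finite_measure_axioms)
  show "countable (lists S \<times> lists S)" using S by auto
  show e: "?e \<in> sets M" by (intro sets.sets_Collect_conj pre_pre_sets joint_eq_sets X.seg_sets Y.seg_sets
      X.X_eq_sets Y.X_eq_sets)
  have "?g = ?e \<inter> {\<omega> \<in> space M. X m \<omega> = Y n \<omega> \<and> good m n \<omega>}" by auto
  then show "?g \<in> sets M" using e good_sets by (simp only:) (rule sets.Int)
  show "(pre X m \<omega>, pre Y n \<omega>) \<in> lists S \<times> lists S" if "\<omega> \<in> ?e" for \<omega>
    using that X.seg_in_lists Y.seg_in_lists by blast
  fix c assume "c \<in> lists S \<times> lists S"
  obtain u v where c: "c = (u, v)" by force
  show "{\<omega> \<in> space M. (pre X m \<omega>, pre Y n \<omega>) = c} \<in> sets M" unfolding c prod.inject by (rule pre_pre_sets)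
  show "1 / 2 * X.prob {\<omega> \<in> ?e. (pre X m \<omega>, pre Y n \<omega>) = c} \<le> X.prob {\<omega> \<in> ?g. (pre X m \<omega>, pre Y n \<omega>) = c}"
  proof (cases "{\<omega> \<in> ?e. (pre X m \<omega>, pre Y n \<omega>) = c} = {}")
    case True
    then show ?thesis by (simp only: measure_empty) simp
  next
    case False
    then obtain \<omega>0 where \<omega>0: "pre X k \<omega>0 = xs" "pre Y k \<omega>0 = ys" "X m \<omega>0 = z" "Y n \<omega>0 = z" "pre X m \<omega>0 = u"
        "pre Y n \<omega>0 = v"
      unfolding c by blast
    have lu: "length u = Suc m" and lv: "length v = Suc n" using \<omega>0(5,6) by auto
    have last: "last u = z" "last v = z" using \<omega>0 last_seg[of X 0 m \<omega>0] last_seg[of Y 0 n \<omega>0] by auto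
    have det: "pre X k \<omega> = xs \<and> X m \<omega> = z" if "pre X m \<omega> = u" for \<omega>
    proof
      have eq: "X i \<omega> = X i \<omega>0" if "i \<le> m" for i
        using \<open>pre X m \<omega> = u\<close> \<omega>0(5) that nth_seg[of i m X 0 \<omega>] nth_seg[of i m X 0 \<omega>0] by simp
      then show "X m \<omega> = z" using \<omega>0 by simp
      have "pre X k \<omega> = pre X k \<omega>0" unfolding seg_def using eq le by (intro map_cong) auto
      then show "pre X k \<omega> = xs" using \<omega>0 by simp
    qed
    have det': "pre Y k \<omega> = ys \<and> Y n \<omega> = z" if "pre Y n \<omega> = v" for \<omega>
    proof
      have eq: "Y i \<omega> = Y i \<omega>0" if "i \<le> n" for i
        using \<open>pre Y n \<omega> = v\<close> \<omega>0(6) that nth_seg[of i n Y 0 \<omega>] nth_seg[of i n Y 0 \<omega>0] by simp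
      then show "Y n \<omega> = z" using \<omega>0 by simp
      have "pre Y k \<omega> = pre Y k \<omega>0" unfolding seg_def using eq le by (intro map_cong) auto
      then show "pre Y k \<omega> = ys" using \<omega>0 by simp
    qed
    have "{\<omega> \<in> ?e. (pre X m \<omega>, pre Y n \<omega>) = c} = {\<omega> \<in> space M. pre X m \<omega> = u \<and> pre Y n \<omega> = v}"
      unfolding c using det det' by blast
    moreover have "{\<omega> \<in> ?g. (pre X m \<omega>, pre Y n \<omega>) = c}
        = {\<omega> \<in> space M. (pre X m \<omega> = u \<and> pre Y n \<omega> = v) \<and> good m n \<omega>}"
      unfolding c using det det' by blast
    ultimately show ?thesis using good_half(1)[OF lu lv] last by simp
  qed
qed simp

text \<open>The weights belong to the walks after time \<open>k\<close>, with the initial segments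
  fixed, whereas \<open>good\<close> still refers to the loop-erasure from time 0.\<close>

lemma hit_le_good_finite:
  assumes xs: "length xs = Suc k" and ys: "length ys = Suc k" and B: "finite B"
  shows "1 / 256 * X.prob {\<omega> \<in> space M. (pre X k \<omega> = xs \<and> pre Y k \<omega> = ys) \<and>
       (\<exists>n m. n0 \<le> n \<and> n \<le> N \<and> m \<le> N \<and> Y (k + n) \<omega> \<in> B \<and> X (k + m) \<omega> = Y (k + n) \<omega>)} \<le>
    X.prob {\<omega> \<in> space M. (pre X k \<omega> = xs \<and> pre Y k \<omega> = ys) \<and> Good k n0 \<omega>}"
proof -
  interpret W: chain_pair "walk K (last xs) N" "walk K (last ys) N" "\<lambda>i s. s ! i" "\<lambda>i s. s ! i" N n0 B
    by (intro chain_pair.intro markov_prop_walk B)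
  let ?C = "\<lambda>\<omega>. pre X k \<omega> = xs \<and> pre Y k \<omega> = ys"
  define c where "c = X.prob {\<omega> \<in> space M. ?C \<omega>}"
  have c0: "0 \<le> c" by (simp add: c_def)
  define e where "e t = {\<omega> \<in> space M. ?C \<omega> \<and> X (k + fst t) \<omega> = snd (snd t) \<and> Y (k + fst (snd t)) \<omega>
      = snd (snd t)}" for t :: "nat \<times> nat \<times> 's"
  define g where "g t = {\<omega> \<in> space M. ?C \<omega> \<and> X (k + fst t) \<omega> = snd (snd t) \<and> Y (k + fst (snd t)) \<omega> = snd (snd t) \<and>
     good (k + fst t) (k + fst (snd t)) \<omega>}" for t :: "nat \<times> nat \<times> 's"
  define R where "R = {\<omega> \<in> space M. ?C \<omega> \<and> Good k n0 \<omega>}"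
  have joint: "X.prob {\<omega> \<in> space M. ?C \<omega> \<and> (seg X k N \<omega>, seg Y k N \<omega>) \<in> Q} =
     c * measure (pair_pmf (walk K (last xs) N) (walk K (last ys) N)) Q" for Q
    unfolding joint_walk[OF xs ys] c_def indep_pre ..
  have e_sets: "e t \<in> sets M" for t
    unfolding e_def by (intro sets.sets_Collect_conj X.seg_sets Y.seg_sets X.X_eq_sets Y.X_eq_sets)
  have g_eq: "g t = e t \<inter> {\<omega> \<in> space M. X (k + fst t) \<omega> = Y (k + fst (snd t)) \<omega>
      \<and> good (k + fst t) (k + fst (snd t)) \<omega>}" for t
    unfolding g_def e_def by auto
  have g_sets: "g t \<in> sets M" for t unfolding g_eq by (intro sets.Int e_sets good_sets)
  have R_sets: "R \<in> sets M"
  proof -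
    have "R = {\<omega> \<in> space M. ?C \<omega>} \<inter> {\<omega> \<in> space M. Good k n0 \<omega>}" by (auto simp: R_def)
    then show ?thesis using pre_pre_sets Good_sets by auto
  qed
  have hit: "X.prob {\<omega> \<in> space M. ?C \<omega> \<and> (\<exists>n m. n0 \<le> n \<and> n \<le> N \<and> m \<le> N \<and> Y (k + n) \<omega> \<in> B \<and> X (k + m) \<omega>
      = Y (k + n) \<omega>)} = c * W.H"
  proof -
    have "{\<omega> \<in> space M. ?C \<omega> \<and> (\<exists>n m. n0 \<le> n \<and> n \<le> N \<and> m \<le> N \<and> Y (k + n) \<omega> \<in> B \<and> X (k + m) \<omega> = Y (k + n) \<omega>)} =
      {\<omega> \<in> space M. ?C \<omega> \<and> (seg X k N \<omega>, seg Y k N \<omega>) \<in> {(x, y). W.hit x y}}"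
      unfolding W.hit_def by (auto simp: nth_seg) (metis nth_seg)+
    then show ?thesis by (simp only: joint W.H_def expect_expect_of_bool)
  qed
  have P1: "X.prob (e (m, n, z)) = c * (W.\<alpha> m z * W.\<beta> n z)" if "m \<le> N" "n \<le> N" for m n z
  proof -
    have "e (m, n, z) = {\<omega> \<in> space M. ?C \<omega> \<and> (seg X k N \<omega>, seg Y k N \<omega>) \<in> {s. s ! m = z} \<times> {s. s ! n = z}}"
      unfolding e_def using that by (auto simp: nth_seg)
    then show ?thesis by (simp only: joint measure_pair_pmf_Times W.\<alpha>_def W.\<beta>_def expect_of_bool)
  qed
  have P2: "X.prob (e (m, n, z) \<inter> e (m', n', z')) = c * (W.p2 m z m' z' * W.q2 n z n' z')"
    if "m \<le> N" "n \<le> N" "m' \<le> N" "n' \<le> N" for m n z m' n' z'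
  proof -
    have "e (m, n, z) \<inter> e (m', n', z') = {\<omega> \<in> space M. ?C \<omega>
        \<and> (seg X k N \<omega>, seg Y k N \<omega>) \<in> {s. s ! m = z \<and> s ! m' = z'} \<times> {s. s ! n = z \<and> s ! n' = z'}}"
      unfolding e_def using that by (auto simp: nth_seg)
    then show ?thesis by (simp only: joint measure_pair_pmf_Times W.p2_def W.q2_def expect_of_bool)
  qed
  \<comment> \<open>Triples before \<open>n0\<close> have weight 0, since none of them is ever
    selected; removing them puts every \<open>g t\<close> inside \<open>R\<close>.\<close>
  define T' where "T' = {t \<in> W.T. n0 \<le> fst (snd t)}"
  define w where "w t = (case t of (m, n, z) \<Rightarrow> W.w m n z)" for t
  have w0: "0 \<le> w t" for t by (cases t) (auto simp: w_def W.nonneg)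
  have finT: "finite T'" by (simp add: T'_def)
  have T'D: "fst t \<le> N" "fst (snd t) \<le> N" "n0 \<le> fst (snd t)" if "t \<in> T'" for t
    using that by (auto simp: T'_def W.T_def)
  have w_zero: "w t = 0" if "t \<in> W.T - T'" for t
  proof -
    obtain m n z where t: "t = (m, n, z)" by (cases t)
    have "\<not> W.sel m n z x y" for x y using that t by (auto simp: T'_def W.sel_def W.first_hit_def)
    then show ?thesis by (simp add: t w_def W.w_def W.\<nu>_def)
  qed
  have "g t \<subseteq> R" if "t \<in> T'" for t
  proof
    fix \<omega> assume \<omega>: "\<omega> \<in> g t"
    then have "k + fst t \<ge> k" "k + fst (snd t) \<ge> n0" "X (k + fst t) \<omega> = Y (k + fst (snd t)) \<omega>"
      "good (k + fst t) (k + fst (snd t)) \<omega>" using T'D[OF that] by (auto simp: g_def)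
    then have "Good k n0 \<omega>" unfolding Good_def by blast
    then show "\<omega> \<in> R" using \<omega> by (simp add: R_def g_def)
  qed
  from X.second_moment_lower_bound[OF finT g_sets this R_sets, where \<tau>="1 / 128" and w=w]
  have "1 / 64 * (\<Sum>t\<in>T'. w t * X.prob (g t)) - 1 / 16384 * (\<Sum>t\<in>T'. \<Sum>t'\<in>T'. w t * w t' * X.prob (g t \<inter> g t'))
      \<le> X.prob R"
    by (simp add: power2_eq_square)
  moreover have "c * W.H / 2 \<le> (\<Sum>t\<in>T'. w t * X.prob (g t))"
  proof -
    have "c * W.H / 2 = (\<Sum>t\<in>W.T. w t * (1 / 2 * X.prob (e t)))"
      unfolding W.first_moment[symmetric] sum_distrib_left sum_divide_distrib
      by (intro sum.cong refl) (auto simp: W.T_def P1 w_def)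
    also have "\<dots> = (\<Sum>t\<in>T'. w t * (1 / 2 * X.prob (e t)))"
      using w_zero by (intro sum.mono_neutral_right) (auto simp: T'_def)
    also have "\<dots> \<le> (\<Sum>t\<in>T'. w t * X.prob (g t))"
    proof (intro sum_mono mult_left_mono w0)
      fix t
      show "1 / 2 * X.prob (e t) \<le> X.prob (g t)"
        unfolding e_def g_def by (rule good_half_state[OF xs ys]) auto
    qed
    finally show ?thesis .
  qed
  moreover have "(\<Sum>t\<in>T'. \<Sum>t'\<in>T'. w t * w t' * X.prob (g t \<inter> g t')) \<le> c * (64 * W.H)"
  proof -
    \<comment> \<open>An upper bound is wanted here, so \<open>good\<close> is simply
      dropped.\<close>
    have "(\<Sum>t\<in>T'. \<Sum>t'\<in>T'. w t * w t' * X.prob (g t \<inter> g t')) \<le> (\<Sum>t\<in>T'. \<Sum>t'\<in>T'. w t * w t' * X.prob (e t \<inter> e t'))"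
    proof (intro sum_mono mult_left_mono mult_nonneg_nonneg w0)
      fix t t'
      show "X.prob (g t \<inter> g t') \<le> X.prob (e t \<inter> e t')"
        unfolding g_eq using e_sets by (intro X.finite_measure_mono) auto
    qed
    also have "\<dots> \<le> (\<Sum>t\<in>W.T. \<Sum>t'\<in>T'. w t * w t' * X.prob (e t \<inter> e t'))"
      using w0 by (intro sum_mono2) (auto simp: T'_def intro!: sum_nonneg mult_nonneg_nonneg)
    also have "\<dots> \<le> (\<Sum>t\<in>W.T. \<Sum>t'\<in>W.T. w t * w t' * X.prob (e t \<inter> e t'))"
      using w0 by (intro sum_mono sum_mono2) (auto simp: T'_def intro!: sum_nonneg mult_nonneg_nonneg)
    also have "\<dots> = c * W.E2"
      unfolding W.E2_def sum_distrib_left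
    proof (intro sum.cong refl)
      fix t assume t: "t \<in> W.T"
      obtain m n z where tt: "t = (m, n, z)" by (cases t)
      have "(\<Sum>t'\<in>W.T. w t * w t' * X.prob (e t \<inter> e t')) =
        (\<Sum>(m', n', z')\<in>W.T. c * (W.w m n z * W.w m' n' z' * (W.p2 m z m' z' * W.q2 n z n' z')))"
        using t unfolding tt by (intro sum.cong refl) (auto simp: W.T_def P2 w_def)
      also have "\<dots> = c * (\<Sum>(m', n', z')\<in>W.T. W.w m n z * W.w m' n' z' * (W.p2 m z m' z' * W.q2 n z n' z'))"
        by (simp add: sum_distrib_left split_def)
      finally show "(\<Sum>t'\<in>W.T. w t * w t' * X.prob (e t \<inter> e t')) = c * (case t of (m, n, z) \<Rightarrow>
        (\<Sum>(m', n', z')\<in>W.T. W.w m n z * W.w m' n' z' * (W.p2 m z m' z' * W.q2 n z n' z')))"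
        by (simp add: tt)
    qed
    also have "\<dots> \<le> c * (64 * W.H)" using W.second_moment c0 by (rule mult_left_mono)
    finally show ?thesis .
  qed
  ultimately have "1 / 256 * (c * W.H) \<le> X.prob R" by simp
  then show ?thesis unfolding hit R_def .
qed

end

section \<open>From a uniform lower bound to an almost sure statement\<close>

context chain_couple
begin

text \<open>The constant is the same for all windows, so \<open>N\<close> and \<open>B N\<close> may
  exhaust all times and states. The shift to \<open>k + n0\<close> arises because the walks are
  timed from \<open>k\<close>.\<close>

lemma hit_le_good:
  assumes xs: "length xs = Suc k" and ys: "length ys = Suc k"
  shows "1 / 256 * X.prob {\<omega> \<in> space M. (pre X k \<omega> = xs \<and> pre Y k \<omega> = ys) \<and> Hit k (k + n0) \<omega>} \<le>
    X.prob {\<omega> \<in> space M. (pre X k \<omega> = xs \<and> pre Y k \<omega> = ys) \<and> Good k n0 \<omega>}"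
proof -
  define B where "B N = {s \<in> S. to_nat_on S s \<le> N}" for N
  have B: "finite (B N)" for N
  proof -
    have "finite (to_nat_on S ` B N)" by (rule finite_subset[of _ "{..N}"]) (auto simp: B_def)
    moreover have "inj_on (to_nat_on S) (B N)"
      using inj_on_to_nat_on[OF S] by (rule inj_on_subset) (auto simp: B_def)
    ultimately show ?thesis by (rule finite_imageD)
  qed
  let ?F = "\<lambda>N. {\<omega> \<in> space M. (pre X k \<omega> = xs \<and> pre Y k \<omega> = ys) \<and>
    (\<exists>n m. n0 \<le> n \<and> n \<le> N \<and> m \<le> N \<and> Y (k + n) \<omega> \<in> B N \<and> X (k + m) \<omega> = Y (k + n) \<omega>)}"
  have Fs: "?F N \<in> sets M" for N
  proof -
    let ?E = "{\<omega> \<in> space M. pre X k \<omega> = xs \<and> pre Y k \<omega> = ys} \<inter>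
      (\<Union>n\<in>{n0..N}. \<Union>m\<in>{..N}. \<Union>z\<in>B N. {\<omega> \<in> space M. X (k + m) \<omega> = z \<and> Y (k + n) \<omega> = z})"
    have "?E = ?F N"
    proof (intro set_eqI iffI)
      fix \<omega> assume "\<omega> \<in> ?E"
      then obtain n m where *: "\<omega> \<in> space M" "pre X k \<omega> = xs" "pre Y k \<omega> = ys" "n0 \<le> n" "n \<le> N" "m \<le> N"
        "X (k + m) \<omega> \<in> B N" "Y (k + n) \<omega> = X (k + m) \<omega>" by auto
      then have "Y (k + n) \<omega> \<in> B N" "X (k + m) \<omega> = Y (k + n) \<omega>" by simp_all
      with *(1-6) show "\<omega> \<in> ?F N" by blast
    next
      fix \<omega> assume "\<omega> \<in> ?F N"
      then obtain n m where *: "\<omega> \<in> space M" "pre X k \<omega> = xs" "pre Y k \<omega> = ys" "n0 \<le> n" "n \<le> N" "m \<le> N"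
        "Y (k + n) \<omega> \<in> B N" "X (k + m) \<omega> = Y (k + n) \<omega>" by blast
      then show "\<omega> \<in> ?E" by (intro IntI UN_I[of n] UN_I[of m] UN_I[of "Y (k + n) \<omega>"]) simp_all
    qed
    moreover have "?E \<in> sets M"
      by (intro sets.Int pre_pre_sets sets.finite_UN joint_eq_sets B finite_atLeastAtMost finite_atMost)
    ultimately show ?thesis by (rule subst)
  qed
  have "incseq ?F"
  proof (unfold incseq_def, intro allI impI subsetI)
    fix N N' :: nat and \<omega> assume "N \<le> N'" "\<omega> \<in> ?F N"
    moreover have "B N \<subseteq> B N'" using \<open>N \<le> N'\<close> by (auto simp: B_def)
    ultimately show "\<omega> \<in> ?F N'" by simp (meson order_trans subsetD)
  qed
  then have lim: "(\<lambda>N. X.prob (?F N)) \<longlonglongrightarrow> X.prob (\<Union>N. ?F N)"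
    using Fs by (intro X.finite_Lim_measure_incseq) auto
  have "(\<Union>N. ?F N) = {\<omega> \<in> space M. (pre X k \<omega> = xs \<and> pre Y k \<omega> = ys) \<and> Hit k (k + n0) \<omega>}"
  proof (intro set_eqI iffI)
    fix \<omega> assume "\<omega> \<in> (\<Union>N. ?F N)"
    then obtain n m where "\<omega> \<in> space M" "pre X k \<omega> = xs" "pre Y k \<omega> = ys" "n0 \<le> n"
        "X (k + m) \<omega> = Y (k + n) \<omega>" by auto
    moreover have "Hit k (k + n0) \<omega>" unfolding Hit_def
      by (rule exI[of _ "k + m"], rule conjI, simp, rule exI[of _ "k + n"]) (use calculation in simp)
    ultimately show "\<omega> \<in> {\<omega> \<in> space M. (pre X k \<omega> = xs \<and> pre Y k \<omega> = ys) \<and> Hit k (k + n0) \<omega>}" by simp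
  next
    fix \<omega> assume \<omega>: "\<omega> \<in> {\<omega> \<in> space M. (pre X k \<omega> = xs \<and> pre Y k \<omega> = ys) \<and> Hit k (k + n0) \<omega>}"
    then obtain m n where mn: "k \<le> m" "k + n0 \<le> n" "X m \<omega> = Y n \<omega>" unfolding Hit_def by blast
    define N where "N = max (max m n) (to_nat_on S (Y n \<omega>))"
    have "Y n \<omega> \<in> B N" using Y.X_in_S \<omega> by (simp add: B_def N_def)
    then have "n0 \<le> n - k \<and> n - k \<le> N \<and> m - k \<le> N \<and> Y (k + (n - k)) \<omega> \<in> B N \<and> X (k + (m - k)) \<omega>
        = Y (k + (n - k)) \<omega>"
      using mn by (auto simp: N_def)
    then have "\<omega> \<in> ?F N" using \<omega> by blast
    then show "\<omega> \<in> (\<Union>N. ?F N)" by blast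
  qed
  then have "(\<lambda>N. 1 / 256 * X.prob (?F N)) \<longlonglongrightarrow> 
      1 / 256 * X.prob {\<omega> \<in> space M. (pre X k \<omega> = xs \<and> pre Y k \<omega> = ys) \<and> Hit k (k + n0) \<omega>}"
    using lim by (intro tendsto_mult tendsto_const) simp
  then show ?thesis
    using hit_le_good_finite[OF xs ys B] by (intro LIMSEQ_le_const2) auto
qed

text \<open>For transient paths this says that the loop-erasure of \<open>X\<close> contains some \<open>Y n\<close> with \<open>n \<ge> n0\<close>, but it
  avoids \<open>loop_erasure\<close>, whose value is junk on the exceptional null set.\<close>

definition Meet :: "nat \<Rightarrow> 'a \<Rightarrow> bool" where
  "Meet n0 \<omega> \<longleftrightarrow> (\<exists>n\<ge>n0. \<exists>m r. prefix_erasure (\<lambda>i. X i \<omega>) m r = Y n \<omega> \<and>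
     (\<forall>i\<ge>m. \<forall>j<r. X i \<omega> \<noteq> prefix_erasure (\<lambda>i. X i \<omega>) m j))"

text \<open>The common point is vertex \<open>r\<close>, visited by \<open>Y\<close> at some time
  from \<open>n\<close> on; in general it is not the intersection \<open>X m = Y n\<close>
  itself.\<close>

lemma Good_imp_Meet:
  assumes "Good k n0 \<omega>" shows "Meet n0 \<omega>"
proof -
  obtain m n where n: "n \<ge> n0" and "good m n \<omega>" using assms unfolding Good_def by blast
  then obtain r where r: "clear X m (prefix_erasure (\<lambda>i. X i \<omega>) m ` {..<r}) \<omega>"
      "clear Y n (prefix_erasure (\<lambda>i. X i \<omega>) m ` {..<r}) \<omega>"
    "\<not> clear Y n (prefix_erasure (\<lambda>i. X i \<omega>) m ` {..r}) \<omega>" unfolding good_def by blast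
  obtain i where i: "i \<ge> n" "Y i \<omega> \<in> prefix_erasure (\<lambda>i. X i \<omega>) m ` {..r}" using r(3) unfolding clear_def by blast
  moreover have "Y i \<omega> \<notin> prefix_erasure (\<lambda>i. X i \<omega>) m ` {..<r}" using r(2) i(1) unfolding clear_def by blast
  ultimately have "Y i \<omega> = prefix_erasure (\<lambda>i. X i \<omega>) m r" by (auto simp: le_less)
  moreover have "\<forall>i\<ge>m. \<forall>j<r. X i \<omega> \<noteq> prefix_erasure (\<lambda>i. X i \<omega>) m j" using r(1) unfolding clear_def by blast
  ultimately show ?thesis unfolding Meet_def using i(1) n by (intro exI[of _ i]) auto
qed

lemma Meet_antimono: "n \<le> n' \<Longrightarrow> Meet n' \<omega> \<Longrightarrow> Meet n \<omega>"
  unfolding Meet_def by (meson order_trans)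

text \<open>One length \<open>k\<close> serves both paths; \<open>take\<close> recovers shorter
  segments, which gives closure under intersection.\<close>

definition Cyl :: "'a set set" where
  "Cyl = {{\<omega> \<in> space M. Q (pre X k \<omega>) (pre Y k \<omega>)} | k Q. True}"

lemma Cyl_sub: "Cyl \<subseteq> sets M"
proof
  fix A assume "A \<in> Cyl"
  then obtain k Q where "A = {\<omega> \<in> space M. Q (pre X k \<omega>) (pre Y k \<omega>)}" unfolding Cyl_def by blast
  then show "A \<in> sets M" using pre_pre_Coll[of k k "{(u, v). Q u v}"] by simp
qed

lemma take_pre: "k \<le> k' \<Longrightarrow> take (Suc k) (pre Z k' \<omega>) = pre Z k \<omega>"
  unfolding seg_def take_map by (simp add: take_upt del: upt_Suc)

lemma algebra_Cyl: "algebra (space M) Cyl"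
  unfolding algebra_iff_Int
proof (intro conjI ballI)
  show "Cyl \<subseteq> Pow (space M)" using Cyl_sub sets.space_closed by blast
  show "{} \<in> Cyl" unfolding Cyl_def by (intro CollectI exI[of _ 0] exI[of _ "\<lambda>_ _. False"]) simp
next
  fix A assume "A \<in> Cyl"
  then obtain k Q where A: "A = {\<omega> \<in> space M. Q (pre X k \<omega>) (pre Y k \<omega>)}" unfolding Cyl_def by blast
  show "space M - A \<in> Cyl" unfolding Cyl_def A by (intro CollectI exI[of _ k] exI[of _ "\<lambda>u v. \<not> Q u v"]) auto
next
  fix A B assume "A \<in> Cyl" "B \<in> Cyl"
  then obtain k Q k' Q' where A: "A = {\<omega> \<in> space M. Q (pre X k \<omega>) (pre Y k \<omega>)}"
    and B: "B = {\<omega> \<in> space M. Q' (pre X k' \<omega>) (pre Y k' \<omega>)}" unfolding Cyl_def by blast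
  let ?l = "max k k'"
  show "A \<inter> B \<in> Cyl" unfolding Cyl_def A B
    by (intro CollectI exI[of _ ?l] exI[of _ "\<lambda>u v. Q (take (Suc k) u) (take (Suc k) v)
        \<and> Q' (take (Suc k') u) (take (Suc k') v)"])
      (auto simp: take_pre)
qed

lemma pred_Cyl:
  assumes "\<And>\<omega>. P \<omega> \<longleftrightarrow> Q (pre X k \<omega>) (pre Y k \<omega>)"
  shows "Measurable.pred (sigma (space M) Cyl) P"
proof -
  have "{\<omega> \<in> space M. P \<omega>} \<in> Cyl" unfolding Cyl_def using assms by blast
  then have "{\<omega> \<in> space (sigma (space M) Cyl). P \<omega>} \<in> sets (sigma (space M) Cyl)"
    using subset_trans[OF Cyl_sub sets.space_closed]
        by (simp add: space_measure_of_conv sets_measure_of_conv sigma_sets.Basic)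
  then show ?thesis by (simp add: pred_def)
qed

lemma prefix_erasure_pre: "m \<le> k \<Longrightarrow> prefix_erasure (\<lambda>i. X i \<omega>) m r = prefix_erasure ((!) (pre X k \<omega>)) m r"
  by (intro prefix_erasure_cong) (simp add: nth_seg)

text \<open>Measurability is established in the sigma-algebra of the cylinders, because
  \<open>Hits - Meets\<close> is to be approximated by them.\<close>

lemma Meet_Cyl: "Measurable.pred (sigma (space M) Cyl) (Meet n)"
proof -
  have 0: "Measurable.pred (sigma (space M) Cyl) (\<lambda>_. b)" for b by simp
  have 1: "Measurable.pred (sigma (space M) Cyl) (\<lambda>\<omega>. prefix_erasure (\<lambda>i. X i \<omega>) m r = Y n \<omega>)" for m r n
    by (rule pred_Cyl[of _ "\<lambda>u v. prefix_erasure ((!) u) m r = v ! n" "max m n"])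
        (simp add: prefix_erasure_pre[of m "max m n"] nth_seg)
  have 2: "Measurable.pred (sigma (space M) Cyl) (\<lambda>\<omega>. X i \<omega> \<noteq> prefix_erasure (\<lambda>i. X i \<omega>) m j)" for i m j
    by (rule pred_Cyl[of _ "\<lambda>u v. u ! i \<noteq> prefix_erasure ((!) u) m j" "max m i"])
        (simp add: prefix_erasure_pre[of m "max m i"] nth_seg)
  show ?thesis unfolding Meet_def[abs_def]
    by (intro pred_intros_countable pred_intros_logic 0 1 2)
qed

lemma Hit_Cyl: "Measurable.pred (sigma (space M) Cyl) (Hit k n)"
proof -
  have 0: "Measurable.pred (sigma (space M) Cyl) (\<lambda>_. b)" for b by simp
  have 1: "Measurable.pred (sigma (space M) Cyl) (\<lambda>\<omega>. X m \<omega> = Y n \<omega>)" for m n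
    by (rule pred_Cyl[of _ "\<lambda>u v. u ! m = v ! n" "max m n"]) (simp add: nth_seg)
  show ?thesis unfolding Hit_def[abs_def]
    by (intro pred_intros_countable pred_intros_logic 0 1)
qed

definition Hits :: "'a set" where "Hits = {\<omega> \<in> space M. \<forall>n. Hit n n \<omega>}"
definition Meets :: "'a set" where "Meets = {\<omega> \<in> space M. \<forall>n. Meet n \<omega>}"

lemma sigma_sets_Cyl: "sets (sigma (space M) Cyl) = sigma_sets (space M) Cyl"
  using Cyl_sub sets.space_closed by (intro sets_measure_of) blast

lemma Hits_Meets_Cyl: "Hits \<in> sigma_sets (space M) Cyl" "Meets \<in> sigma_sets (space M) Cyl"
proof -
  have "Measurable.pred (sigma (space M) Cyl) (\<lambda>\<omega>. \<forall>n. Hit n n \<omega>)"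
    by (intro pred_intros_countable Hit_Cyl)
  then show "Hits \<in> sigma_sets (space M) Cyl"
    unfolding Hits_def pred_def sigma_sets_Cyl[symmetric] by (simp add: space_measure_of_conv)
  have "Measurable.pred (sigma (space M) Cyl) (\<lambda>\<omega>. \<forall>n. Meet n \<omega>)"
    by (intro pred_intros_countable Meet_Cyl)
  then show "Meets \<in> sigma_sets (space M) Cyl"
    unfolding Meets_def pred_def sigma_sets_Cyl[symmetric] by (simp add: space_measure_of_conv)
qed

lemma Hits_Meets_sets: "Hits \<in> sets M" "Meets \<in> sets M"
  using Hits_Meets_Cyl sets.sigma_sets_subset[OF Cyl_sub] by blast+

lemma Meet_sets: "{\<omega> \<in> space M. Meet n \<omega>} \<in> sets M"
proof -
  have "{\<omega> \<in> space M. Meet n \<omega>} \<in> sigma_sets (space M) Cyl"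
    using Meet_Cyl[of n] unfolding pred_def sigma_sets_Cyl[symmetric] by (simp add: space_measure_of_conv)
  then show ?thesis using sets.sigma_sets_subset[OF Cyl_sub] by blast
qed

text \<open>On \<open>Hits\<close> there are intersections later than every \<open>n\<close>, and
  the bound is uniform in \<open>n\<close>. \<open>Meet n\<close>, unlike \<open>Good k n\<close>,
  does not mention \<open>k\<close> and decreases to \<open>Meets\<close>.\<close>

lemma Hits_le_Meets_atom:
  "1 / 256 * X.prob {\<omega> \<in> Hits. pre X k \<omega> = xs \<and> pre Y k \<omega> = ys}
      \<le> X.prob {\<omega> \<in> Meets. pre X k \<omega> = xs \<and> pre Y k \<omega> = ys}"
proof (cases "length xs = Suc k \<and> length ys = Suc k")
  case False
  then have "{\<omega> \<in> Hits. pre X k \<omega> = xs \<and> pre Y k \<omega> = ys} = {}" by auto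
  then show ?thesis by (simp only: measure_empty) simp
next
  case True
  let ?A = "{\<omega> \<in> space M. pre X k \<omega> = xs \<and> pre Y k \<omega> = ys}"
  let ?F = "\<lambda>n. ?A \<inter> {\<omega> \<in> space M. Meet n \<omega>}"
  have "1 / 256 * X.prob {\<omega> \<in> Hits. pre X k \<omega> = xs \<and> pre Y k \<omega> = ys} \<le> X.prob (?F n)" for n
  proof -
    have H: "Hit k (k + n) \<omega>" if "\<omega> \<in> Hits" for \<omega>
      using that unfolding Hits_def Hit_def by (auto) (meson le_add1 le_trans)
    have s1: "{\<omega> \<in> space M. (pre X k \<omega> = xs \<and> pre Y k \<omega> = ys) \<and> Hit k (k + n) \<omega>} = ?A
        \<inter> {\<omega> \<in> space M. Hit k (k + n) \<omega>}" by auto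
    have "X.prob {\<omega> \<in> Hits. pre X k \<omega> = xs \<and> pre Y k \<omega> = ys} \<le> X.prob (?A \<inter> {\<omega> \<in> space M. Hit k (k + n) \<omega>})"
      by (intro X.finite_measure_mono sets.Int pre_pre_sets Hit_sets) (use H in \<open>auto simp: Hits_def\<close>)
    then have "1 / 256 * X.prob {\<omega> \<in> Hits. pre X k \<omega> = xs \<and> pre Y k \<omega> = ys} \<le>
      1 / 256 * X.prob {\<omega> \<in> space M. (pre X k \<omega> = xs \<and> pre Y k \<omega> = ys) \<and> Hit k (k + n) \<omega>}" unfolding s1 by simp
    also have "\<dots> \<le> X.prob {\<omega> \<in> space M. (pre X k \<omega> = xs \<and> pre Y k \<omega> = ys) \<and> Good k n \<omega>}"
      using True by (intro hit_le_good) auto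
    also have "\<dots> \<le> X.prob (?F n)"
      by (intro X.finite_measure_mono sets.Int pre_pre_sets Meet_sets) (auto dest: Good_imp_Meet)
    finally show ?thesis .
  qed
  moreover have "(\<lambda>n. X.prob (?F n)) \<longlonglongrightarrow> X.prob (\<Inter>n. ?F n)"
  proof (rule X.finite_Lim_measure_decseq)
    show "range ?F \<subseteq> sets M" using pre_pre_sets Meet_sets by auto
    show "decseq ?F" unfolding decseq_def using Meet_antimono by blast
  qed
  moreover have "(\<Inter>n. ?F n) = {\<omega> \<in> Meets. pre X k \<omega> = xs \<and> pre Y k \<omega> = ys}" by (auto simp: Meets_def)
  ultimately show ?thesis by (intro LIMSEQ_le_const) auto
qed

lemma Hits_le_Meets_Cyl:
  assumes "C \<in> Cyl" shows "1 / 256 * X.prob (C \<inter> Hits) \<le> X.prob (C \<inter> Meets)"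
proof -
  obtain k Q where C: "C = {\<omega> \<in> space M. Q (pre X k \<omega>) (pre Y k \<omega>)}" using assms unfolding Cyl_def by blast
  have Cs: "C \<in> sets M" using assms Cyl_sub by blast
  show ?thesis
  proof (rule measure_le_fibres[where f="\<lambda>\<omega>. (pre X k \<omega>, pre Y k \<omega>)" and C="lists S \<times> lists S"])
    show "finite_measure M" by (rule X.finite_measure_axioms)
    show "countable (lists S \<times> lists S)" using S by auto
    show "(pre X k \<omega>, pre Y k \<omega>) \<in> lists S \<times> lists S" if "\<omega> \<in> C \<inter> Hits" for \<omega>
      using that X.seg_in_lists Y.seg_in_lists by (auto simp: C simp del: in_lists_conv_set)
    fix c :: "'s list \<times> 's list"
    obtain u v where c: "c = (u, v)" by force
    show "{\<omega> \<in> space M. (pre X k \<omega>, pre Y k \<omega>) = c} \<in> sets M" unfolding c prod.inject by (rule pre_pre_sets)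
    show "1 / 256 * X.prob {\<omega> \<in> C \<inter> Hits. (pre X k \<omega>, pre Y k \<omega>) = c}
        \<le> X.prob {\<omega> \<in> C \<inter> Meets. (pre X k \<omega>, pre Y k \<omega>) = c}"
    proof (cases "Q u v")
      case True
      have "{\<omega> \<in> C \<inter> Z. (pre X k \<omega>, pre Y k \<omega>) = c} = {\<omega> \<in> Z. pre X k \<omega> = u \<and> pre Y k \<omega> = v}" if
          "Z \<subseteq> space M" for Z
        using True that by (auto simp: C c)
      moreover have "Hits \<subseteq> space M" "Meets \<subseteq> space M" by (auto simp: Hits_def Meets_def)
      ultimately show ?thesis using Hits_le_Meets_atom[of k u v] by simp
    next
      case False
      then have "{\<omega> \<in> C \<inter> Hits. (pre X k \<omega>, pre Y k \<omega>) = c} = {}" by (auto simp: C c)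
      then show ?thesis by (simp only: measure_empty) simp
    qed
  qed (use Cs Hits_Meets_sets in auto)
qed

text \<open>\<open>Hits - Meets\<close> is nearly a cylinder event \<open>C\<close>, and \<open>Meets\<close> nearly misses \<open>C\<close>, so the bound on cylinders
  forces it to be null; this replaces an appeal to the zero-one law.\<close>

lemma Hits_diff_Meets_null: "X.prob (Hits - Meets) = 0"
proof (rule ccontr)
  let ?A = "Hits - Meets"
  assume "X.prob ?A \<noteq> 0"
  \<comment> \<open>1000 is generous: with relative error \<open>\<delta>\<close> the contradiction
    arises as soon as \<open>1 - \<delta> \<ge> 256 * \<delta>\<close>, so any number from 257 on
    would do.\<close>
  then have pos: "0 < X.prob ?A / 1000" by (simp add: zero_less_measure_iff)
  have A: "?A \<in> sets M" using Hits_Meets_sets by auto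
  have "?A \<in> sigma_sets (space M) Cyl"
    using Hits_Meets_Cyl sets.Diff[of Hits "sigma (space M) Cyl" Meets] by (simp add: sigma_sets_Cyl)
  from X.approx_by_algebra[OF algebra_Cyl Cyl_sub this pos]
  obtain C where C: "C \<in> Cyl" "X.prob ((?A - C) \<union> (C - ?A)) < X.prob ?A / 1000" by blast
  have Cs: "C \<in> sets M" using C(1) Cyl_sub by blast
  have 1: "X.prob (?A - C) \<le> X.prob ((?A - C) \<union> (C - ?A))" and 2: "X.prob (C - ?A) \<le> X.prob ((?A - C) \<union> (C - ?A))"
    using A Cs by (auto intro!: X.finite_measure_mono)
  have "X.prob ?A = X.prob (?A \<inter> C) + X.prob (?A - C)"
    using A Cs by (subst X.finite_measure_Union[symmetric]) (auto intro!: arg_cong[where f=X.prob])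
  moreover have "X.prob (?A \<inter> C) \<le> X.prob (C \<inter> Hits)" using Hits_Meets_sets Cs
      by (intro X.finite_measure_mono) auto
  \<comment> \<open>\<open>?A\<close> is disjoint from \<open>Meets\<close>, so the part of
    \<open>C\<close> in \<open>Meets\<close> belongs to the approximation error.\<close>
  moreover have "X.prob (C \<inter> Meets) \<le> X.prob (C - ?A)" using Hits_Meets_sets Cs
      by (intro X.finite_measure_mono) auto
  moreover note Hits_le_Meets_Cyl[OF C(1)] 1 2 C(2)
  ultimately show False using pos by simp
qed

text \<open>An infinite intersection contains a state visited by neither path before
  \<open>n0\<close>, hence an intersection late for both. Conversely, points \<open>Y n\<close> of
  the erasure with arbitrarily large \<open>n\<close> form an infinite set, as \<open>Y\<close>
  visits each state only finitely often.\<close>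

lemma infinite_intersection:
  assumes fin: "\<And>x. finite {n. X n \<omega> = x}" "\<And>x. finite {n. Y n \<omega> = x}"
    and hm: "\<omega> \<in> Hits \<Longrightarrow> \<omega> \<in> Meets" and \<omega>: "\<omega> \<in> space M"
    and inf: "infinite (range (\<lambda>m. X m \<omega>) \<inter> range (\<lambda>n. Y n \<omega>))"
  shows "infinite (range (loop_erasure (\<lambda>m. X m \<omega>)) \<inter> range (\<lambda>n. Y n \<omega>))"
proof
  have "Hit n0 n0 \<omega>" for n0
  proof -
    let ?F = "(\<lambda>m. X m \<omega>) ` {..<n0} \<union> (\<lambda>m. Y m \<omega>) ` {..<n0}"
    have "\<not> range (\<lambda>m. X m \<omega>) \<inter> range (\<lambda>n. Y n \<omega>) \<subseteq> ?F" using inf finite_subset by blast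
    then obtain s where s: "s \<in> range (\<lambda>m. X m \<omega>)" "s \<in> range (\<lambda>n. Y n \<omega>)" "s \<notin> ?F" by blast
    then obtain m n where mn: "s = X m \<omega>" "s = Y n \<omega>" by blast
    have "n0 \<le> m" using s(3) unfolding mn(1) by (metis UnI1 imageI lessThan_iff not_le)
    moreover have "n0 \<le> n" using s(3) unfolding mn(2) by (metis UnI2 imageI lessThan_iff not_le)
    ultimately show ?thesis unfolding Hit_def using mn by blast
  qed
  then have meet: "Meet n \<omega>" for n using hm \<omega> by (simp add: Hits_def Meets_def)
  let ?I = "range (loop_erasure (\<lambda>m. X m \<omega>)) \<inter> range (\<lambda>n. Y n \<omega>)"
  assume "finite ?I"
  then have "finite (\<Union>x\<in>?I. {n. Y n \<omega> = x})" using fin by auto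
  then obtain b where b: "\<And>n. Y n \<omega> \<in> ?I \<Longrightarrow> n < b" by (auto simp: finite_nat_set_iff_bounded)
  obtain n m r where n: "n \<ge> b" "prefix_erasure (\<lambda>i. X i \<omega>) m r = Y n \<omega>"
      "\<And>i j. j < r \<Longrightarrow> i \<ge> m \<Longrightarrow> X i \<omega> \<noteq> prefix_erasure (\<lambda>i. X i \<omega>) m j"
    using meet[of b] unfolding Meet_def by blast
  have "Y n \<omega> = loop_erasure (\<lambda>m. X m \<omega>) r"
    using prefix_erasure_eq_loop_erasure[of "\<lambda>i. X i \<omega>" r m r] fin(1) n(2,3) by simp
  then have "Y n \<omega> \<in> ?I" by (metis IntI rangeI)
  then show False using b[of n] n(1) by simp
qed

lemma AE_infinite_intersection:
  "AE \<omega> in M. infinite (range (\<lambda>m. X m \<omega>) \<inter> range (\<lambda>n. Y n \<omega>)) \<longrightarrow>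
     infinite (range (loop_erasure (\<lambda>m. X m \<omega>)) \<inter> range (\<lambda>n. Y n \<omega>))"
proof -
  have "Hits - Meets \<in> null_sets M"
    using Hits_diff_Meets_null Hits_Meets_sets by (auto simp: null_sets_def X.emeasure_eq_measure)
  then have "AE \<omega> in M. \<omega> \<notin> Hits - Meets" by (rule AE_not_in)
  moreover have "AE \<omega> in M. \<omega> \<in> space M" by (rule AE_space)
  moreover note X.finitely_many_visits[OF S transient] Y.finitely_many_visits[OF S transient]
  ultimately show ?thesis
  proof eventually_elim
    case (elim \<omega>)
    \<comment> \<open>The almost sure statement covers the states in \<open>S\<close>; the others
      are never visited.\<close>
    have fin: "finite {n. Z n \<omega> = x}" if "\<And>n. Z n \<omega> \<in> S" "\<forall>x\<in>S. finite {n. Z n \<omega> = x}" for Z ::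
        "nat \<Rightarrow> 'a \<Rightarrow> 's" and x
    proof (cases "x \<in> S")
      case False
      then have "{n. Z n \<omega> = x} = {}" using that(1) by blast
      then show ?thesis by (simp only: finite.emptyI)
    qed (use that in blast)
    show ?case
      by (intro impI infinite_intersection fin X.X_in_S Y.X_in_S) (use elim in blast)+
  qed
qed

end

theorem theorem1p1:
  fixes M :: "'a measure" and S :: "'s set" and K :: "'s \<Rightarrow> 's pmf"
    and X Y :: "nat \<Rightarrow> 'a \<Rightarrow> 's"
  assumes "prob_space M"
    and "countable S"
    and "markov_chain M S K X"
    and "markov_chain M S K Y"
    and "\<forall>x\<in>S. transient_state K x"
    and "prob_space.indep_var M
           (PiM UNIV (\<lambda>_. count_space S)) (\<lambda>\<omega> m. X m \<omega>)
           (PiM UNIV (\<lambda>_. count_space S)) (\<lambda>\<omega> n. Y n \<omega>)"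
  shows "AE \<omega> in M. infinite (range (\<lambda>m. X m \<omega>) \<inter> range (\<lambda>n. Y n \<omega>)) \<longrightarrow>
           infinite (range (loop_erasure (\<lambda>m. X m \<omega>)) \<inter> range (\<lambda>n. Y n \<omega>))"
proof -
  interpret chain_couple M S K X Y
    using assms by (intro chain_couple.intro chain.intro chain_axioms.intro chain_couple_axioms.intro)
  show ?thesis by (rule AE_infinite_intersection)
qed

end
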